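(* Let $0<p<1$. Let $\{\omega_{n,j}: n\in\mathbb{Z}_+,\ j=0,1,\dots,2^n-1\}$ be independent and identically distributed random variables on a probability space $(\Omega,\mathcal{F},\mathrm{P})$ with $\mathrm{P}(\omega_{n,j}=1)=p=1-\mathrm{P}(\omega_{n,j}=-1)$. Set $\omega_n(x):=\omega_{n,j}$ if $x\in[j/2^n,(j+1)/2^n)$, and let $f$ be the random function $$f(x)=\sum_{n=0}^\infty\frac{\omega_n(x)}{2^n}\phi(2^n x),\qquad 0\le x\le 1.$$ Let $M_f:=\max_{x\in[0,1]}f(x)$ and $\mathcal{M}_f:=\{x\in[0,1]: f(x)=M_f\}$. (i) The probability that $M_f$ attains the maximum possible value of $2/3$ is $$\mathrm{P}(M_f=2/3)=\max\left\{\frac{2p^2-1}{p^3},\,0\right\}.$$ (ii) If $p>1/\sqrt2$, then $$\dim_H\mathcal{M}_f=\frac{\log(2p^2)}{\log 4}\qquad\text{almost surely},$$ and the distribution of $M_f$ is discrete, supported on the set $$\left\{\frac12\sum_{j\in\Delta}4^{-j}:\ \Delta\subset\mathbb{Z}_+,\ \#(\mathbb{Z}_+\setminus\Delta)<\infty\right\}$$ (i.e. $M_f$ belongs to this countable set almost surely).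
   Context: $\mathbb{Z}_+$ is the set of nonnegative integers and $\#$ denotes cardinality. $\phi(x)=\operatorname{dist}(x,\mathbb{Z})$ is the distance from $x\in\mathbb{R}$ to the nearest integer. The value $\omega_n(1)$ is immaterial since $\phi(2^n)=0$. Every realization of $f$ satisfies $f\le T$, where $T(x)=\sum_{n=0}^\infty 2^{-n}\phi(2^n x)$ has maximum $2/3$, so always $M_f\le 2/3$. $\dim_H$ denotes Hausdorff dimension. *)

theory Defs
  imports "HOL-Probability.Probability"
begin

subsection \<open>Hausdorff measure and dimension\<close>

text \<open>The \<open>s\<close>-weight \<open>(diam U)^s\<close> of a covering set, with the usual conventions that the empty
  set has weight \<open>0\<close> and that \<open>0^0 = 1\<close> (recall \<open>0 powr 0 = 0\<close> in the library).\<close>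

definition hausdorff_weight :: "real \<Rightarrow> 'a::metric_space set \<Rightarrow> ennreal" where
  "hausdorff_weight s U =
     (if U = {} then 0 else if s = 0 then 1 else ennreal (diameter U powr s))"

text \<open>Boundedness is required of the covering sets because \<open>diameter\<close> is only meaningful for
  bounded sets. Finite covers are included, since the \<open>U i\<close> may be empty.\<close>

definition hausdorff_premeasure :: "real \<Rightarrow> real \<Rightarrow> 'a::metric_space set \<Rightarrow> ennreal" where
  "hausdorff_premeasure s \<delta> A =
     (INF U \<in> {U :: nat \<Rightarrow> 'a set.
                 A \<subseteq> (\<Union>i. U i) \<and> (\<forall>i. bounded (U i) \<and> diameter (U i) \<le> \<delta>)}.
        \<Sum>i. hausdorff_weight s (U i))"

definition hausdorff_measure :: "real \<Rightarrow> 'a::metric_space set \<Rightarrow> ennreal" where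
  "hausdorff_measure s A = (SUP \<delta> \<in> {0<..}. hausdorff_premeasure s \<delta> A)"

definition hausdorff_dim :: "'a::metric_space set \<Rightarrow> ereal" where
  "hausdorff_dim A = Inf {ereal s | s. 0 \<le> s \<and> hausdorff_measure s A = 0}"

subsection \<open>Takagi functions with signs\<close>

definition dist_int :: "real \<Rightarrow> real" where
  "dist_int x = infdist x \<int>"

text \<open>For \<open>0 \<le> x < 1\<close>, \<open>nat \<lfloor>2 ^ n * x\<rfloor>\<close> is the unique \<open>j < 2 ^ n\<close> such that
  \<open>x \<in> [j / 2 ^ n, (j + 1) / 2 ^ n)\<close>. At \<open>x = 1\<close> the index is \<open>2 ^ n\<close>, but the value of the sign
  there is immaterial, because it is multiplied by \<open>dist_int (2 ^ n) = 0\<close>.\<close>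

definition signed_takagi :: "(nat \<Rightarrow> nat \<Rightarrow> real) \<Rightarrow> real \<Rightarrow> real" where
  "signed_takagi \<sigma> x = (\<Sum>n. \<sigma> n (nat \<lfloor>2 ^ n * x\<rfloor>) / 2 ^ n * dist_int (2 ^ n * x))"

definition max_value :: "(real \<Rightarrow> real) \<Rightarrow> real" where
  "max_value g = (GREATEST y. y \<in> g ` {0..1})"

definition max_set :: "(real \<Rightarrow> real) \<Rightarrow> real set" where
  "max_set g = {x \<in> {0..1}. g x = max_value g}"

definition cofinite_quarter_sums :: "real set" where
  "cofinite_quarter_sums =
     {1 / 2 * (\<Sum>\<^sub>\<infinity>j\<in>\<Delta>. 1 / 4 ^ j) | \<Delta> :: nat set. finite (UNIV - \<Delta>)}"

end

theory Submission
  imports Defs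
begin

text \<open>Look at \<open>f\<close> on the dyadic grid of mesh \<open>4^-m\<close>, in the unit \<open>2 * 4^-m\<close>.
The partial sum of the first \<open>2m\<close> layers interpolates \<open>f\<close> linearly between grid
points, its values there are integers in this unit, and refining the grid twice sends the maximum
\<open>P\<close> of these integers to \<open>4 P\<close> or \<open>4 P + 1\<close> (\<open>peak_Suc\<close>).
Hence \<open>M_f = 1/2 \<Sum> \<epsilon>_m 4^-m\<close> with \<open>\<epsilon>_m \<in> {0, 1}\<close>
(\<open>max_value_sums\<close>), and the maximum is \<open>2/3\<close> exactly if all
\<open>\<epsilon>_m\<close> equal \<open>1\<close>. The digit \<open>\<epsilon>_m\<close> is \<open>1\<close>
exactly if some interval of this grid on which the partial sum is constant and maximal (an element of the
\<open>crest\<close>) carries the sign \<open>+1\<close> (\<open>gain_iff\<close>). If so, the new crest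
consists of the second quarters of those crest intervals whose own sign and left half's sign are both
\<open>+1\<close>, and of the third quarters for which this holds with the right half
(\<open>crest_Suc\<close>). So the crest develops as a branching process: an individual has no offspring with
probability \<open>1 - p\<close>, and otherwise a binomial number with parameters \<open>2\<close> and
\<open>p\<close>. The mean is \<open>2p\<^sup>2\<close>, and the survival probability \<open>q\<close> is the
larger root of \<open>q = p (1 - (1 - p q)\<^sup>2)\<close>; this is the first claim.

Let \<open>2p\<^sup>2 > 1\<close>, so that \<open>q > 0\<close>. To the right of a maximal grid point the
slopes of the partial sums form a random walk with drift towards \<open>0\<close> (here \<open>p > 2/3 >
1/2\<close>), so almost surely the crest is again and again nonempty, even after the process has died out
(\<open>crest_recurs\<close>). Each time there is a fresh chance \<open>q\<close> of survival, independent of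
the past; thus almost surely some crest interval founds a surviving line (\<open>survivor_AE\<close>). From
then on all digits are \<open>1\<close>, which is the claim on the distribution of \<open>M_f\<close>, and the
maximum set is the union of the boundaries of finitely many branching trees, at least one of them infinite.
Their vertices are nested intervals whose lengths shrink by the factor \<open>4\<close> from one generation to
the next.

The dimension \<open>d\<close> is determined by \<open>4^d = 2p\<^sup>2\<close>. For \<open>s > d\<close> the
generations themselves are good covers, since the expected size of generation \<open>n\<close> is
\<open>(2p\<^sup>2)^n\<close> (\<open>offspring_small\<close>). For \<open>s < d\<close> thin the tree by
keeping every edge independently with probability \<open>r = 4^-s\<close>. The thinned process has mean
\<open>2p\<^sup>2 r > 1\<close>. Its conditional survival probability, given the tree, is an explicit function
\<open>reach_lim r\<close> of the signs. This function is at most \<open>\<Sum> r^|v|\<close> over any set of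
vertices \<open>v\<close> that meets all infinite lines; a cover of the boundary by small sets yields such a
set, so positivity of \<open>reach_lim r\<close> forces positive \<open>s\<close>-dimensional measure
(\<open>hausdorff_measure_rays_nonzero\<close>). Finally positivity has the same probability \<open>q\<close>
as survival, since both probabilities are nonzero solutions of the same recursion
(\<open>reach_lim_pos_AE\<close>). Taking \<open>r = 1\<close> in \<open>reach_lim r\<close> gives the
indicator of survival, so one functional serves all purposes.\<close>

section \<open>Layers of signed Takagi functions\<close>

lemma dist_int_add:
  fixes k :: int and t :: real
  assumes "0 \<le> t" "t \<le> 1"
  shows "dist_int (of_int k + t) = min t (1 - t)"
proof -
  let ?x = "of_int k + t"
  have "infdist ?x \<int> \<le> dist ?x (of_int k)" "infdist ?x \<int> \<le> dist ?x (of_int (k + 1))"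
    by (intro infdist_le; simp)+
  then have "infdist ?x \<int> \<le> min t (1 - t)"
    using assms by (auto simp: dist_real_def)
  moreover have "min t (1 - t) \<le> infdist ?x \<int>"
  proof -
    have "min t (1 - t) \<le> dist ?x a" if a: "a \<in> \<int>" for a
    proof -
      obtain i where i: "a = of_int i" using a by (rule Ints_cases)
      consider "i \<le> k" | "i \<ge> k + 1" by linarith
      then show ?thesis
      proof cases
        case 1
        then have "real_of_int i \<le> of_int k" by simp
        then show ?thesis using assms by (auto simp: dist_real_def i)
      next
        case 2
        then have "real_of_int i \<ge> of_int k + 1" by linarith
        then show ?thesis using assms by (auto simp: dist_real_def i)
      qed
    qed
    then show ?thesis
      unfolding infdist_def by (auto intro!: cINF_greatest)
  qed
  ultimately show ?thesis unfolding dist_int_def by linarith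
qed

definition layer :: "(nat \<Rightarrow> nat \<Rightarrow> real) \<Rightarrow> nat \<Rightarrow> real \<Rightarrow> real" where
  "layer \<sigma> n x = \<sigma> n (nat \<lfloor>2 ^ n * x\<rfloor>) / 2 ^ n * dist_int (2 ^ n * x)"

text \<open>The representation \<open>x = (j + t) / 2^n\<close> with \<open>t \<in> [0, 1]\<close> is used in place of the floor
function throughout. It also covers the right end point of an interval, where the sign belongs to the
next interval but is multiplied by \<open>0\<close>.\<close>

lemma layer_at:
  assumes "0 \<le> t" "t \<le> 1"
  shows "layer \<sigma> n ((real j + t) / 2 ^ n) = \<sigma> n j / 2 ^ n * min t (1 - t)"
proof -
  have d: "dist_int (real j + t) = min t (1 - t)"
    using dist_int_add[OF assms, of "int j"] by simp
  show ?thesis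
  proof (cases "t = 1")
    case True then show ?thesis using d by (simp add: layer_def)
  next
    case False
    then have "\<lfloor>real j + t\<rfloor> = int j" using assms by linarith
    then show ?thesis using d by (simp add: layer_def)
  qed
qed

lemma dyadic_cell:
  assumes "x \<in> {0..1}"
  obtains j :: nat and t :: real where "j < 2 ^ n" "0 \<le> t" "t \<le> 1" "x = (real j + t) / 2 ^ n"
proof (cases "x = 1")
  case True
  have "x = (real (2 ^ n - 1) + 1) / 2 ^ n" using True by (simp add: of_nat_diff)
  then show ?thesis using that[of "2 ^ n - 1" 1] by simp
next
  case False
  define j where "j = nat \<lfloor>2 ^ n * x\<rfloor>"
  have x: "0 \<le> x" "x < 1" using assms False by auto
  have j: "real j = of_int \<lfloor>2 ^ n * x\<rfloor>" using x by (simp add: j_def)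
  have "2 ^ n * x < 2 ^ n" using x by simp
  then have "real j < 2 ^ n" unfolding j by linarith
  then have "j < 2 ^ n" by (metis of_nat_less_iff of_nat_numeral of_nat_power)
  moreover have "x = (real j + (2 ^ n * x - real j)) / 2 ^ n" by simp
  ultimately show ?thesis using that[of j "2 ^ n * x - real j"] j by linarith
qed

definition signs :: "(nat \<Rightarrow> nat \<Rightarrow> real) \<Rightarrow> bool" where
  "signs \<sigma> \<longleftrightarrow> (\<forall>n j. j < 2 ^ n \<longrightarrow> \<sigma> n j \<in> {-1, 1})"

lemma signsD: "signs \<sigma> \<Longrightarrow> j < 2 ^ n \<Longrightarrow> \<sigma> n j = -1 \<or> \<sigma> n j = 1"
  by (auto simp: signs_def)

lemma layer_bound:
  assumes "signs \<sigma>" "x \<in> {0..1}"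
  shows "\<bar>layer \<sigma> n x\<bar> \<le> (1 / 2) * (1 / 2) ^ n"
proof -
  obtain j t where j: "j < 2 ^ n" "0 \<le> t" "t \<le> 1" "x = (real j + t) / 2 ^ n"
    using dyadic_cell[OF assms(2)] .
  have "\<bar>\<sigma> n j\<bar> = 1" using signsD[OF assms(1) j(1)] by auto
  moreover have "\<bar>min t (1 - t)\<bar> \<le> 1 / 2" using j(2,3) by (simp add: min_def)
  ultimately have "\<bar>layer \<sigma> n x\<bar> \<le> 1 / 2 ^ n * (1 / 2)"
    using j(2,3) unfolding j(4) layer_at[OF j(2,3)] abs_mult abs_divide
    by (intro mult_mono) auto
  then show ?thesis by (simp add: power_one_over)
qed

text \<open>A sign can only change at an integer multiple of \<open>2^-n\<close>. Two points on different sides of such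
a multiple are at least as far apart as the sum of their distances to it, so the change of sign does no
harm to the Lipschitz constant of the unsigned layer.\<close>

lemma layer_Lipschitz:
  assumes "signs \<sigma>" "x \<in> {0..1}" "y \<in> {0..1}"
  shows "\<bar>layer \<sigma> n x - layer \<sigma> n y\<bar> \<le> \<bar>x - y\<bar>"
proof -
  obtain j t where j: "j < 2 ^ n" "0 \<le> t" "t \<le> 1" "x = (real j + t) / 2 ^ n"
    using dyadic_cell[OF assms(2)] .
  obtain k s where k: "k < 2 ^ n" "0 \<le> s" "s \<le> 1" "y = (real k + s) / 2 ^ n"
    using dyadic_cell[OF assms(3)] .
  have sj: "\<sigma> n j = -1 \<or> \<sigma> n j = 1" and sk: "\<sigma> n k = -1 \<or> \<sigma> n k = 1"
    using signsD[OF assms(1)] j k by auto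
  define p where "p = min t (1 - t)"
  define q where "q = min s (1 - s)"
  \<comment> \<open>Everything is rescaled by \<open>2^n\<close>, which turns the kinks into integers.\<close>
  have "\<bar>\<sigma> n j * p - \<sigma> n k * q\<bar> \<le> \<bar>(real j + t) - (real k + s)\<bar>"
  proof (cases j k rule: linorder_cases)
    case equal
    have "\<bar>p - q\<bar> \<le> \<bar>t - s\<bar>" unfolding p_def q_def by linarith
    then show ?thesis using sj equal by auto
  next
    case less
    then have "real j + 1 \<le> real k" by simp
    moreover have "0 \<le> p" "p \<le> 1 - t" "0 \<le> q" "q \<le> s" using j k by (auto simp: p_def q_def)
    ultimately show ?thesis using sj sk by auto
  next
    case greater
    then have "real k + 1 \<le> real j" by simp
    moreover have "0 \<le> p" "p \<le> t" "0 \<le> q" "q \<le> 1 - s" using j k by (auto simp: p_def q_def)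
    ultimately show ?thesis using sj sk by auto
  qed
  then have "\<bar>\<sigma> n j * p - \<sigma> n k * q\<bar> / 2 ^ n \<le> \<bar>(real j + t) - (real k + s)\<bar> / 2 ^ n"
    by (simp add: divide_right_mono)
  moreover have "layer \<sigma> n x - layer \<sigma> n y = (\<sigma> n j * p - \<sigma> n k * q) / 2 ^ n"
    using j k by (simp add: layer_at p_def q_def diff_divide_distrib)
  moreover have "x - y = ((real j + t) - (real k + s)) / 2 ^ n"
    using j k by (simp add: diff_divide_distrib)
  ultimately show ?thesis by (simp add: abs_divide)
qed

lemma summable_half_layer: "summable (\<lambda>n. (1 / 2) * (1 / 2 :: real) ^ n)"
  by (intro summable_mult summable_geometric) simp

lemma summable_layer:
  assumes "signs \<sigma>" "x \<in> {0..1}"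
  shows "summable (\<lambda>n. layer \<sigma> n x)"
  by (rule summable_comparison_test'[OF summable_half_layer, of 0])
    (use layer_bound[OF assms] in simp)

lemma signed_takagi_layer: "signed_takagi \<sigma> x = (\<Sum>n. layer \<sigma> n x)"
  by (simp add: signed_takagi_def layer_def)

lemma continuous_on_signed_takagi:
  assumes "signs \<sigma>"
  shows "continuous_on {0..1} (signed_takagi \<sigma>)"
proof -
  have lay: "continuous_on {0..1} (layer \<sigma> n)" for n
  proof -
    have "1-lipschitz_on {0..1} (layer \<sigma> n)"
      by (rule lipschitz_onI) (use layer_Lipschitz[OF assms] in \<open>auto simp: dist_real_def\<close>)
    then show ?thesis by (rule lipschitz_on_continuous_on)
  qed
  have "uniform_limit {0..1} (\<lambda>n x. \<Sum>i<n. layer \<sigma> i x) (\<lambda>x. \<Sum>i. layer \<sigma> i x) sequentially"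
    by (rule Weierstrass_m_test[OF _ summable_half_layer]) (use layer_bound[OF assms] in simp)
  then have "continuous_on {0..1} (\<lambda>x. \<Sum>i. layer \<sigma> i x)"
    by (rule uniform_limit_theorem[rotated]) (auto intro!: always_eventually continuous_on_sum lay)
  then show ?thesis by (simp add: signed_takagi_layer[abs_def])
qed

definition psum :: "(nat \<Rightarrow> nat \<Rightarrow> real) \<Rightarrow> nat \<Rightarrow> real \<Rightarrow> real" where
  "psum \<sigma> n x = (\<Sum>i<n. layer \<sigma> i x)"

lemma signed_takagi_remainder:
  assumes "signs \<sigma>" "x \<in> {0..1}"
  shows "\<bar>signed_takagi \<sigma> x - psum \<sigma> n x\<bar> \<le> (1 / 2) ^ n"
proof -
  note s = summable_layer[OF assms]
  have e: "signed_takagi \<sigma> x - psum \<sigma> n x = (\<Sum>i. layer \<sigma> (i + n) x)"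
    using suminf_split_initial_segment[OF s, of n] by (simp add: signed_takagi_layer psum_def)
  have g: "(\<lambda>i. (1 / 2) ^ Suc n * (1 / 2 :: real) ^ i) sums ((1 / 2) ^ Suc n * 2)"
    using sums_mult[OF geometric_sums[of "1 / 2 :: real"], of "(1 / 2) ^ Suc n"] by simp
  have "norm (\<Sum>i. layer \<sigma> (i + n) x) \<le> (\<Sum>i. (1 / 2) ^ Suc n * (1 / 2 :: real) ^ i)"
  proof (rule norm_suminf_le)
    show "norm (layer \<sigma> (i + n) x) \<le> (1 / 2) ^ Suc n * (1 / 2) ^ i" for i
      using layer_bound[OF assms, of "i + n"] by (simp add: power_add mult_ac)
  qed (rule sums_summable[OF g])
  also have "\<dots> = (1 / 2) ^ n" using sums_unique[OF g] by simp
  finally show ?thesis using e by simp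
qed

lemma layer_dyadic_0:
  assumes "n \<le> i" shows "layer \<sigma> i (real j / 2 ^ n) = 0"
proof -
  have "real j / 2 ^ n = (real (j * 2 ^ (i - n)) + 0) / 2 ^ i"
    using assms by (simp add: field_simps flip: power_add)
  then show ?thesis using layer_at[of 0 \<sigma> i "j * 2 ^ (i - n)"] by simp
qed

lemma signed_takagi_dyadic: "signed_takagi \<sigma> (real j / 2 ^ n) = psum \<sigma> n (real j / 2 ^ n)"
  unfolding signed_takagi_layer psum_def
  by (rule suminf_finite) (auto simp: layer_dyadic_0)

text \<open>The layer \<open>i < n\<close> has its kinks at multiples of \<open>2^-(i + 1)\<close> only, so the first \<open>n\<close> layers have none
inside an interval of level \<open>n\<close>.\<close>

lemma psum_affine:
  assumes "0 \<le> t" "t \<le> 1"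
  shows "psum \<sigma> n ((real j + t) / 2 ^ n)
    = (1 - t) * psum \<sigma> n (real j / 2 ^ n) + t * psum \<sigma> n (real (Suc j) / 2 ^ n)"
  using assms
proof (induction n arbitrary: j t)
  case 0
  then show ?case by (simp add: psum_def)
next
  case (Suc n)
  define i where "i = j div 2"
  define A where "A = psum \<sigma> n (real i / 2 ^ n)"
  define B where "B = psum \<sigma> n (real (Suc i) / 2 ^ n)"
  have IH: "psum \<sigma> n ((real i + s) / 2 ^ n) = (1 - s) * A + s * B" if "0 \<le> s" "s \<le> 1" for s
    using Suc.IH[OF that, of i] by (simp add: A_def B_def)
  have ps: "psum \<sigma> (Suc n) ((real i + s) / 2 ^ n)
      = (1 - s) * A + s * B + \<sigma> n i / 2 ^ n * min s (1 - s)" if "0 \<le> s" "s \<le> 1" for s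
    using IH[OF that] layer_at[OF that, of \<sigma> n i] by (simp add: psum_def)
  show ?case
  proof (cases "even j")
    case True
    then have j: "j = 2 * i" by (simp add: i_def)
    have e: "(real j + t) / 2 ^ Suc n = (real i + t / 2) / 2 ^ n"
      "real j / 2 ^ Suc n = (real i + 0) / 2 ^ n"
      "real (Suc j) / 2 ^ Suc n = (real i + 1 / 2) / 2 ^ n"
      unfolding j by (simp_all add: field_simps)
    have m: "min (t / 2) (1 - t / 2) = t / 2"
      using Suc.prems by (simp add: min_def)
    have t: "0 \<le> t / 2" "t / 2 \<le> 1" using Suc.prems by auto
    have "psum \<sigma> (Suc n) ((real i + 1 / 2) / 2 ^ n) = (A + B) / 2 + \<sigma> n i / 2 ^ n / 2"
      using ps[of "1 / 2"] by (simp add: field_simps)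
    moreover have "psum \<sigma> (Suc n) ((real i + 0) / 2 ^ n) = A"
      using ps[of 0] by simp
    ultimately show ?thesis
      unfolding e ps[OF t] m by (simp only:) (simp add: field_simps)
  next
    case False
    then have j: "j = 2 * i + 1" by (simp add: i_def)
    have e: "(real j + t) / 2 ^ Suc n = (real i + (1 + t) / 2) / 2 ^ n"
      "real j / 2 ^ Suc n = (real i + 1 / 2) / 2 ^ n"
      "real (Suc j) / 2 ^ Suc n = (real i + 1) / 2 ^ n"
      unfolding j by (simp_all add: field_simps)
    have m: "min ((1 + t) / 2) (1 - (1 + t) / 2) = (1 - t) / 2"
      using Suc.prems by (simp add: min_def field_simps)
    have t: "0 \<le> (1 + t) / 2" "(1 + t) / 2 \<le> 1" using Suc.prems by auto
    have "psum \<sigma> (Suc n) ((real i + 1 / 2) / 2 ^ n) = (A + B) / 2 + \<sigma> n i / 2 ^ n / 2"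
      using ps[of "1 / 2"] by (simp add: field_simps)
    moreover have "psum \<sigma> (Suc n) ((real i + 1) / 2 ^ n) = B"
      using ps[of 1] by simp
    ultimately show ?thesis
      unfolding e ps[OF t] m by (simp only:) (simp add: field_simps)
  qed
qed

section \<open>The integer grid and its peak\<close>

text \<open>Value of the signed Takagi function at \<open>j / 4^m\<close> in the unit \<open>2 / 4^m\<close>; this unit makes all
values integers.\<close>

definition grid :: "(nat \<Rightarrow> nat \<Rightarrow> real) \<Rightarrow> nat \<Rightarrow> nat \<Rightarrow> real" where
  "grid \<sigma> m j = psum \<sigma> (2 * m) (real j / 4 ^ m) * 4 ^ m / 2"

lemma two_pow_double: "(2 :: 'b :: comm_semiring_1) ^ (2 * m) = 4 ^ m"
  by (simp add: power_mult)

lemma takagi_grid: "signed_takagi \<sigma> (real j / 4 ^ m) = 2 / 4 ^ m * grid \<sigma> m j"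
  using signed_takagi_dyadic[of \<sigma> j "2 * m"] by (simp add: grid_def two_pow_double)

text \<open>The layers beyond the first \<open>2m\<close> add at most \<open>4^-m\<close>, which is half of the unit of the grid values.\<close>

lemma takagi_cell:
  assumes "signs \<sigma>" "j < 4 ^ m" "0 \<le> t" "t \<le> 1"
  shows "\<bar>signed_takagi \<sigma> ((real j + t) / 4 ^ m)
     - 2 / 4 ^ m * ((1 - t) * grid \<sigma> m j + t * grid \<sigma> m (Suc j))\<bar> \<le> 1 / 4 ^ m"
proof -
  have "real j + 1 \<le> 4 ^ m"
  proof -
    have "real (Suc j) \<le> real (4 ^ m)" using assms(2) by (simp del: of_nat_Suc)
    then show ?thesis by simp
  qed
  then have "(real j + t) / 4 ^ m \<in> {0..1}" using assms by simp
  from signed_takagi_remainder[OF assms(1) this, of "2 * m"]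
  have "\<bar>signed_takagi \<sigma> ((real j + t) / 4 ^ m) - psum \<sigma> (2 * m) ((real j + t) / 4 ^ m)\<bar> \<le> 1 / 4 ^ m"
    by (simp only: two_pow_double power_one_over)
  moreover have "psum \<sigma> (2 * m) ((real j + t) / 4 ^ m)
      = 2 / 4 ^ m * ((1 - t) * grid \<sigma> m j + t * grid \<sigma> m (Suc j))"
    using psum_affine[OF assms(3,4), of \<sigma> "2 * m" j] unfolding two_pow_double
    by (simp add: grid_def distrib_left del: of_nat_Suc)
  ultimately show ?thesis by simp
qed

text \<open>Only the layers \<open>2m\<close> and \<open>2m + 1\<close> are new. At the quarter points the first contributes \<open>1/4\<close>, \<open>1/2\<close>,
\<open>1/4\<close> and the second \<open>1/4\<close>, \<open>0\<close>, \<open>1/4\<close>, times signs and \<open>4^-m\<close>. The factor \<open>4\<close> in the recursion is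
the change of unit.\<close>

lemma grid_children:
  shows "grid \<sigma> (Suc m) (4 * j) = 4 * grid \<sigma> m j"
    and "grid \<sigma> (Suc m) (4 * j + 1)
      = 3 * grid \<sigma> m j + grid \<sigma> m (Suc j) + (\<sigma> (2 * m) j + \<sigma> (2 * m + 1) (2 * j)) / 2"
    and "grid \<sigma> (Suc m) (4 * j + 2) = 2 * grid \<sigma> m j + 2 * grid \<sigma> m (Suc j) + \<sigma> (2 * m) j"
    and "grid \<sigma> (Suc m) (4 * j + 3)
      = grid \<sigma> m j + 3 * grid \<sigma> m (Suc j) + (\<sigma> (2 * m) j + \<sigma> (2 * m + 1) (2 * j + 1)) / 2"
    and "grid \<sigma> (Suc m) (4 * j + 4) = 4 * grid \<sigma> m (Suc j)"
proof -
  have g: "grid \<sigma> (Suc m) k = 2 * 4 ^ m * (psum \<sigma> (2 * m) x + layer \<sigma> (2 * m) x + layer \<sigma> (Suc (2 * m)) x)"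
    if "real k / 4 ^ Suc m = x" for k x
    using that by (simp add: grid_def psum_def)
  have p: "4 ^ m * psum \<sigma> (2 * m) ((real j + t) / 4 ^ m) = 2 * ((1 - t) * grid \<sigma> m j + t * grid \<sigma> m (Suc j))"
    if "0 \<le> t" "t \<le> 1" for t
    using psum_affine[OF that, of \<sigma> "2 * m" j] unfolding two_pow_double
    by (simp add: grid_def distrib_left del: of_nat_Suc)
  have l: "4 ^ m * layer \<sigma> (2 * m) ((real j + t) / 4 ^ m) = \<sigma> (2 * m) j * min t (1 - t)"
    if "0 \<le> t" "t \<le> 1" for t
    using layer_at[OF that, of \<sigma> "2 * m" j] by (simp add: two_pow_double)
  have r: "4 ^ m * layer \<sigma> (Suc (2 * m)) x = \<sigma> (Suc (2 * m)) k * min t (1 - t) / 2"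
    if "0 \<le> t" "t \<le> 1" "(real k + t) / (2 * 4 ^ m) = x" for t k x
    using layer_at[OF that(1,2), of \<sigma> "Suc (2 * m)" k]
    unfolding that(3)[symmetric] power_Suc two_pow_double by simp
  have x: "real (4 * j) / 4 ^ Suc m = (real j + 0) / 4 ^ m"
    "real (4 * j + 1) / 4 ^ Suc m = (real j + 1 / 4) / 4 ^ m"
    "real (4 * j + 2) / 4 ^ Suc m = (real j + 1 / 2) / 4 ^ m"
    "real (4 * j + 3) / 4 ^ Suc m = (real j + 3 / 4) / 4 ^ m"
    "real (4 * j + 4) / 4 ^ Suc m = (real j + 1) / 4 ^ m"
    by (simp_all add: field_simps)
  show "grid \<sigma> (Suc m) (4 * j) = 4 * grid \<sigma> m j"
    using g[OF x(1)] p[of 0] l[of 0] r[of 0 "2 * j" "(real j + 0) / 4 ^ m"] by (simp add: algebra_simps)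
  show "grid \<sigma> (Suc m) (4 * j + 1)
      = 3 * grid \<sigma> m j + grid \<sigma> m (Suc j) + (\<sigma> (2 * m) j + \<sigma> (2 * m + 1) (2 * j)) / 2"
    using g[OF x(2)] p[of "1/4"] l[of "1/4"] r[of "1/2" "2 * j" "(real j + 1/4) / 4 ^ m"]
    by (simp add: field_simps)
  show "grid \<sigma> (Suc m) (4 * j + 2) = 2 * grid \<sigma> m j + 2 * grid \<sigma> m (Suc j) + \<sigma> (2 * m) j"
    using g[OF x(3)] p[of "1/2"] l[of "1/2"] r[of "1" "2 * j" "(real j + 1/2) / 4 ^ m"]
    by (simp add: field_simps)
  show "grid \<sigma> (Suc m) (4 * j + 3)
      = grid \<sigma> m j + 3 * grid \<sigma> m (Suc j) + (\<sigma> (2 * m) j + \<sigma> (2 * m + 1) (2 * j + 1)) / 2"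
    using g[OF x(4)] p[of "3/4"] l[of "3/4"] r[of "1/2" "2 * j + 1" "(real j + 3/4) / 4 ^ m"]
    by (simp add: field_simps)
  show "grid \<sigma> (Suc m) (4 * j + 4) = 4 * grid \<sigma> m (Suc j)"
    using g[OF x(5)] p[of 1] l[of 1] r[of 1 "2 * j + 1" "(real j + 1) / 4 ^ m"] by (simp add: field_simps)
qed

definition peak :: "(nat \<Rightarrow> nat \<Rightarrow> real) \<Rightarrow> nat \<Rightarrow> real" where
  "peak \<sigma> m = Max (grid \<sigma> m ` {..4 ^ m})"

text \<open>The factor \<open>4\<close> is the change of unit: without gain the maximum over the grid stays the same.\<close>

definition gain :: "(nat \<Rightarrow> nat \<Rightarrow> real) \<Rightarrow> nat \<Rightarrow> bool" where
  "gain \<sigma> m \<longleftrightarrow> peak \<sigma> (Suc m) \<noteq> 4 * peak \<sigma> m"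

text \<open>Both ends maximal means that the sum of the first \<open>2m\<close> layers is flat there and equal to its maximum.
Only these intervals can raise the peak.\<close>

definition crest :: "(nat \<Rightarrow> nat \<Rightarrow> real) \<Rightarrow> nat \<Rightarrow> nat set" where
  "crest \<sigma> m = {j. j < 4 ^ m \<and> grid \<sigma> m j = peak \<sigma> m \<and> grid \<sigma> m (Suc j) = peak \<sigma> m}"

lemma grid_le_peak: "j \<le> 4 ^ m \<Longrightarrow> grid \<sigma> m j \<le> peak \<sigma> m"
  by (auto simp: peak_def)

lemma peak_attained: obtains j where "j \<le> 4 ^ m" "grid \<sigma> m j = peak \<sigma> m"
proof -
  have "peak \<sigma> m \<in> grid \<sigma> m ` {..4 ^ m}"
    unfolding peak_def by (intro Max_in) auto
  then show ?thesis using that by auto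
qed

lemma grid_last: "grid \<sigma> m (4 ^ m) = 0" and grid_0: "grid \<sigma> m 0 = 0"
proof -
  have "signed_takagi \<sigma> (real 1 / 2 ^ 0) = 0" "signed_takagi \<sigma> (real 0 / 2 ^ 0) = 0"
    unfolding signed_takagi_dyadic by (simp_all add: psum_def)
  then show "grid \<sigma> m (4 ^ m) = 0" "grid \<sigma> m 0 = 0"
    using takagi_grid[of \<sigma> "4 ^ m" m] takagi_grid[of \<sigma> 0 m] by simp_all
qed

text \<open>If the maximum is attained at the right end point \<open>1\<close> it vanishes, and then \<open>0\<close> is a maximum
point as well. So there is always a maximal grid point with an interval to its right.\<close>

lemma peak_attained_left: obtains j where "j < 4 ^ m" "grid \<sigma> m j = peak \<sigma> m"
proof -
  obtain j where "j \<le> 4 ^ m" "grid \<sigma> m j = peak \<sigma> m" by (rule peak_attained)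
  then show ?thesis using that[of j] that[of 0] by (cases "j = 4 ^ m") (auto simp: grid_last grid_0)
qed

lemma quarter_cases:
  fixes k :: nat
  assumes "k \<le> 4 ^ Suc m"
  obtains j c where "j < 4 ^ m" "c \<le> 4" "k = 4 * j + c"
proof (cases "k = 4 ^ Suc m")
  case True
  have "(1::nat) \<le> 4 ^ m" by simp
  then have "k = 4 * (4 ^ m - 1) + (4::nat)" using True by (simp add: algebra_simps)
  then show ?thesis using that[of "4 ^ m - 1" 4] by simp
next
  case False
  then have "k div 4 < 4 ^ m" using assms by (simp add: less_mult_imp_div_less mult.commute)
  moreover have "k = 4 * (k div 4) + k mod 4" by simp
  moreover have "k mod 4 \<le> 4" by (simp add: less_imp_le)
  ultimately show ?thesis using that by blast
qed

lemma le4_cases: "(c::nat) \<le> 4 \<Longrightarrow> c = 0 \<or> c = 1 \<or> c = 2 \<or> c = 3 \<or> c = 4"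
  by linarith

lemma signs_block:
  assumes "signs \<sigma>" "j < 4 ^ m"
  shows "\<sigma> (2 * m) j = -1 \<or> \<sigma> (2 * m) j = 1"
    and "\<sigma> (2 * m + 1) (2 * j) = -1 \<or> \<sigma> (2 * m + 1) (2 * j) = 1"
    and "\<sigma> (2 * m + 1) (2 * j + 1) = -1 \<or> \<sigma> (2 * m + 1) (2 * j + 1) = 1"
proof -
  have "j < 2 ^ (2 * m)" "2 * j < 2 ^ (2 * m + 1)" "2 * j + 1 < 2 ^ (2 * m + 1)"
    using assms(2) by (simp_all add: power_mult)
  then show "\<sigma> (2 * m) j = -1 \<or> \<sigma> (2 * m) j = 1"
    "\<sigma> (2 * m + 1) (2 * j) = -1 \<or> \<sigma> (2 * m + 1) (2 * j) = 1"
    "\<sigma> (2 * m + 1) (2 * j + 1) = -1 \<or> \<sigma> (2 * m + 1) (2 * j + 1) = 1"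
    using signsD[OF assms(1)] by blast+
qed

lemma grid_Ints:
  assumes "signs \<sigma>" "j \<le> 4 ^ m"
  shows "grid \<sigma> m j \<in> \<int>"
  using assms(2)
proof (induction m arbitrary: j)
  case 0
  then show ?case by (simp add: grid_def psum_def)
next
  case (Suc m)
  obtain i c where i: "i < 4 ^ m" "c \<le> 4" "j = 4 * i + c"
    using quarter_cases[OF Suc.prems] .
  have g: "grid \<sigma> m i \<in> \<int>" "grid \<sigma> m (Suc i) \<in> \<int>"
    using i by (auto intro!: Suc.IH)
  note s = signs_block[OF assms(1) i(1)]
  have h: "(\<sigma> (2 * m) i + \<sigma> (2 * m + 1) (2 * i)) / 2 \<in> \<int>" "\<sigma> (2 * m) i \<in> \<int>"
    "(\<sigma> (2 * m) i + \<sigma> (2 * m + 1) (2 * i + 1)) / 2 \<in> \<int>"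
    using s by auto
  have "4 * grid \<sigma> m i \<in> \<int>" "4 * grid \<sigma> m (Suc i) \<in> \<int>"
    "3 * grid \<sigma> m i + grid \<sigma> m (Suc i) + (\<sigma> (2 * m) i + \<sigma> (2 * m + 1) (2 * i)) / 2 \<in> \<int>"
    "2 * grid \<sigma> m i + 2 * grid \<sigma> m (Suc i) + \<sigma> (2 * m) i \<in> \<int>"
    "grid \<sigma> m i + 3 * grid \<sigma> m (Suc i) + (\<sigma> (2 * m) i + \<sigma> (2 * m + 1) (2 * i + 1)) / 2 \<in> \<int>"
    using g h by (intro Ints_add Ints_mult; simp)+
  then show ?case
    using le4_cases[OF i(2)] grid_children[of \<sigma> m i] unfolding i(3) by (elim disjE) simp_all
qed

lemma peak_Ints: "signs \<sigma> \<Longrightarrow> peak \<sigma> m \<in> \<int>"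
  by (metis peak_attained grid_Ints)

lemma grid_le_peak_minus_1:
  assumes "signs \<sigma>" "j \<le> 4 ^ m" "grid \<sigma> m j \<noteq> peak \<sigma> m"
  shows "grid \<sigma> m j \<le> peak \<sigma> m - 1"
proof -
  obtain a b where "grid \<sigma> m j = of_int a" "peak \<sigma> m = of_int b"
    using grid_Ints[OF assms(1,2)] peak_Ints[OF assms(1)] by (metis Ints_cases)
  moreover have "grid \<sigma> m j < peak \<sigma> m"
    using grid_le_peak[OF assms(2)] assms(3) by (simp add: less_le)
  ultimately show ?thesis by simp
qed

text \<open>If the two ends of an interval are not both maximal, integrality puts one of them at least one unit
below the peak. The interpolation then loses at least one unit of the finer grid at each interior
quarter point, and the two new layers add at most one.\<close>

lemma grid_children_le:
  assumes "signs \<sigma>" "j < 4 ^ m" "c \<le> 4"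
  shows "grid \<sigma> (Suc m) (4 * j + c) \<le> 4 * peak \<sigma> m + 1"
    and "j \<notin> crest \<sigma> m \<Longrightarrow> grid \<sigma> (Suc m) (4 * j + c) \<le> 4 * peak \<sigma> m"
proof -
  note s = signs_block[OF assms(1,2)] and ch = grid_children[of \<sigma> m j] and c = le4_cases[OF assms(3)]
  have le: "grid \<sigma> m j \<le> peak \<sigma> m" "grid \<sigma> m (Suc j) \<le> peak \<sigma> m"
    using assms(2) by (auto intro!: grid_le_peak)
  have b: "\<sigma> (2 * m) j \<le> 1" "\<sigma> (2 * m + 1) (2 * j) \<le> 1" "\<sigma> (2 * m + 1) (2 * j + 1) \<le> 1"
    using s by auto
  have r: "3 * a + b + (x + y) / 2 \<le> 4 * P + 1" "a + 3 * b + (x + y) / 2 \<le> 4 * P + 1"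
    "a \<le> P - 1 \<or> b \<le> P - 1 \<Longrightarrow> 3 * a + b + (x + y) / 2 \<le> 4 * P"
    "a \<le> P - 1 \<or> b \<le> P - 1 \<Longrightarrow> a + 3 * b + (x + y) / 2 \<le> 4 * P"
    if "a \<le> P" "b \<le> P" "x \<le> 1" "y \<le> 1" for a b x y P :: real
    using that by argo+
  show "grid \<sigma> (Suc m) (4 * j + c) \<le> 4 * peak \<sigma> m + 1"
    using c
  proof (elim disjE)
    assume "c = 0" then show ?thesis using ch(1) le by simp
  next
    assume c: "c = 1" show ?thesis unfolding c ch(2) by (intro r le b)
  next
    assume c: "c = 2" show ?thesis unfolding c ch(3) using le b by linarith
  next
    assume c: "c = 3" show ?thesis unfolding c ch(4) by (intro r le b)
  next
    assume c: "c = 4" show ?thesis unfolding c ch(5) using le by linarith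
  qed
  assume "j \<notin> crest \<sigma> m"
  then consider "grid \<sigma> m j \<noteq> peak \<sigma> m" | "grid \<sigma> m (Suc j) \<noteq> peak \<sigma> m"
    using assms(2) by (auto simp: crest_def)
  then have lt: "grid \<sigma> m j \<le> peak \<sigma> m - 1 \<or> grid \<sigma> m (Suc j) \<le> peak \<sigma> m - 1"
    using grid_le_peak_minus_1[OF assms(1), of j m] grid_le_peak_minus_1[OF assms(1), of "Suc j" m] assms(2)
    by (cases; simp)
  show "grid \<sigma> (Suc m) (4 * j + c) \<le> 4 * peak \<sigma> m"
    using c
  proof (elim disjE)
    assume "c = 0" then show ?thesis using ch(1) le by simp
  next
    assume c: "c = 1" show ?thesis unfolding c ch(2) by (intro r le b lt)
  next
    assume c: "c = 2" show ?thesis unfolding c ch(3) using le b lt by linarith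
  next
    assume c: "c = 3" show ?thesis unfolding c ch(4) by (intro r le b lt)
  next
    assume c: "c = 4" show ?thesis unfolding c ch(5) using le by linarith
  qed
qed

lemma peak_ge: "4 * peak \<sigma> m \<le> peak \<sigma> (Suc m)"
proof -
  obtain j where j: "j \<le> 4 ^ m" "grid \<sigma> m j = peak \<sigma> m" by (rule peak_attained)
  then show ?thesis
    using grid_le_peak[of "4 * j" "Suc m" \<sigma>] grid_children(1)[of \<sigma> m j] by simp
qed

lemma peak_Suc:
  assumes "signs \<sigma>"
  shows "peak \<sigma> (Suc m) = 4 * peak \<sigma> m + of_bool (gain \<sigma> m)"
proof -
  obtain k where k: "k \<le> 4 ^ Suc m" "grid \<sigma> (Suc m) k = peak \<sigma> (Suc m)"
    by (rule peak_attained)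
  obtain j c where "j < 4 ^ m" "c \<le> 4" "k = 4 * j + c" using quarter_cases[OF k(1)] .
  then have "peak \<sigma> (Suc m) \<le> 4 * peak \<sigma> m + 1"
    using grid_children_le(1)[OF assms] k by metis
  moreover have "4 * peak \<sigma> m \<in> \<int>" "peak \<sigma> (Suc m) \<in> \<int>"
    using peak_Ints[OF assms] by auto
  ultimately show ?thesis
    using peak_ge[of \<sigma> m] unfolding gain_def
    by (elim Ints_cases) auto
qed

section \<open>Crest intervals and their descendants\<close>

text \<open>A crest interval with sign \<open>+1\<close> has its midpoint one unit higher, whatever the signs of its halves. Conversely
the new layers cannot raise a crest interval with sign \<open>-1\<close>, and intervals outside the crest are left behind by
\<open>grid_children_le\<close>.\<close>

lemma gain_iff:
  assumes "signs \<sigma>"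
  shows "gain \<sigma> m \<longleftrightarrow> (\<exists>j\<in>crest \<sigma> m. \<sigma> (2 * m) j = 1)"
proof
  assume g: "gain \<sigma> m"
  obtain k where k: "k \<le> 4 ^ Suc m" "grid \<sigma> (Suc m) k = peak \<sigma> (Suc m)"
    by (rule peak_attained)
  obtain j c where j: "j < 4 ^ m" "c \<le> 4" "k = 4 * j + c" using quarter_cases[OF k(1)] .
  have v: "grid \<sigma> (Suc m) (4 * j + c) = 4 * peak \<sigma> m + 1"
    using peak_Suc[OF assms, of m] k j g by simp
  then have t: "j \<in> crest \<sigma> m" using grid_children_le(2)[OF assms j(1,2)] by force
  note s = signs_block[OF assms j(1)] and ch = grid_children[of \<sigma> m j]
  have "grid \<sigma> m j = peak \<sigma> m" "grid \<sigma> m (Suc j) = peak \<sigma> m" using t by (auto simp: crest_def)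
  then have "\<sigma> (2 * m) j = 1"
    using le4_cases[OF j(2)] s v ch by (elim disjE) (simp_all only:, auto)
  then show "\<exists>j\<in>crest \<sigma> m. \<sigma> (2 * m) j = 1" using t by blast
next
  assume "\<exists>j\<in>crest \<sigma> m. \<sigma> (2 * m) j = 1"
  then obtain j where j: "j \<in> crest \<sigma> m" "\<sigma> (2 * m) j = 1" by blast
  then have "grid \<sigma> (Suc m) (4 * j + 2) = 4 * peak \<sigma> m + 1" "4 * j + 2 \<le> 4 ^ Suc m"
    unfolding grid_children(3) by (auto simp: crest_def)
  then have "4 * peak \<sigma> m + 1 \<le> peak \<sigma> (Suc m)" by (metis grid_le_peak)
  then show "gain \<sigma> m" by (simp add: gain_def)
qed

text \<open>The two middle quarters of an interval are the places where a flat piece can rise by a full unit and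
be flat again. The second quarter is reached if the interval and its left half carry the sign \<open>+1\<close>, the third
quarter with the right half.\<close>

definition kids :: "(nat \<Rightarrow> nat \<Rightarrow> real) \<Rightarrow> nat \<Rightarrow> nat \<Rightarrow> nat set" where
  "kids \<sigma> m j = {i. \<sigma> (2 * m) j = 1 \<and>
     (i = 4 * j + 1 \<and> \<sigma> (2 * m + 1) (2 * j) = 1 \<or> i = 4 * j + 2 \<and> \<sigma> (2 * m + 1) (2 * j + 1) = 1)}"

lemma crest_Suc:
  assumes "signs \<sigma>" "gain \<sigma> m"
  shows "crest \<sigma> (Suc m) = (\<Union>j\<in>crest \<sigma> m. kids \<sigma> m j)"
proof (intro set_eqI iffI)
  have pk: "peak \<sigma> (Suc m) = 4 * peak \<sigma> m + 1" using peak_Suc[OF assms(1), of m] assms(2) by simp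
  fix k assume "k \<in> crest \<sigma> (Suc m)"
  then have k: "k < 4 ^ Suc m" "grid \<sigma> (Suc m) k = 4 * peak \<sigma> m + 1"
    "grid \<sigma> (Suc m) (Suc k) = 4 * peak \<sigma> m + 1" by (auto simp: crest_def pk)
  define j where "j = k div 4"
  define c where "c = k mod 4"
  have j: "j < 4 ^ m" "c < 4" "k = 4 * j + c"
    using k(1) by (auto simp: j_def c_def less_mult_imp_div_less mult.commute)
  have t: "j \<in> crest \<sigma> m" using grid_children_le(2)[OF assms(1) j(1), of c] j k by force
  then have p: "grid \<sigma> m j = peak \<sigma> m" "grid \<sigma> m (Suc j) = peak \<sigma> m" by (auto simp: crest_def)
  note s = signs_block[OF assms(1) j(1)] and ch = grid_children[of \<sigma> m j, unfolded p]
  have "c = 0 \<or> c = 1 \<or> c = 2 \<or> c = 3" using j(2) by linarith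
  then have "k \<in> kids \<sigma> m j"
  proof (elim disjE)
    assume "c = 0" then show ?thesis using k(2) ch(1) j(3) by simp
  next
    assume c: "c = 1"
    have "\<sigma> (2 * m) j + \<sigma> (2 * m + 1) (2 * j) = 2" using k(2) ch(2) unfolding j(3) c by simp
    then show ?thesis using s j(3) c unfolding kids_def by auto
  next
    assume c: "c = 2"
    have "\<sigma> (2 * m) j = 1" using k(2) ch(3) unfolding j(3) c by simp
    moreover have "\<sigma> (2 * m) j + \<sigma> (2 * m + 1) (2 * j + 1) = 2"
      using k(3) ch(4) unfolding j(3) c by (simp add: numeral_3_eq_3)
    ultimately show ?thesis using j(3) c unfolding kids_def by auto
  next
    assume c: "c = 3"
    then have "Suc k = 4 * j + 4" using j(3) by simp
    then show ?thesis using k(3) ch(5) by (simp only:)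
  qed
  then show "k \<in> (\<Union>j\<in>crest \<sigma> m. kids \<sigma> m j)" using t by blast
next
  have pk: "peak \<sigma> (Suc m) = 4 * peak \<sigma> m + 1" using peak_Suc[OF assms(1), of m] assms(2) by simp
  fix k assume "k \<in> (\<Union>j\<in>crest \<sigma> m. kids \<sigma> m j)"
  then obtain j where j: "j \<in> crest \<sigma> m" "k \<in> kids \<sigma> m j" by blast
  then have p: "grid \<sigma> m j = peak \<sigma> m" "grid \<sigma> m (Suc j) = peak \<sigma> m" "j < 4 ^ m"
    by (auto simp: crest_def)
  note ch = grid_children[of \<sigma> m j, unfolded p]
  have e: "Suc (4 * j + 1) = 4 * j + 2" "Suc (4 * j + 2) = 4 * j + 3" by simp_all
  from j(2) consider "\<sigma> (2 * m) j = 1" "k = 4 * j + 1" "\<sigma> (2 * m + 1) (2 * j) = 1"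
    | "\<sigma> (2 * m) j = 1" "k = 4 * j + 2" "\<sigma> (2 * m + 1) (2 * j + 1) = 1"
    unfolding kids_def by blast
  then show "k \<in> crest \<sigma> (Suc m)"
  proof cases
    case 1
    show ?thesis using p(3) unfolding crest_def pk 1(2) e(1) mem_Collect_eq ch(2,3) 1 by simp
  next
    case 2
    show ?thesis using p(3) unfolding crest_def pk 2(2) e(2) mem_Collect_eq ch(3,4) 2 by simp
  qed
qed

section \<open>The maximum as a series of quarter powers\<close>

lemma peak_constant:
  assumes "\<And>i. m \<le> i \<Longrightarrow> i < m + n \<Longrightarrow> \<not> gain \<sigma> i"
  shows "peak \<sigma> (m + n) = 4 ^ n * peak \<sigma> m"
  using assms by (induction n) (auto simp: gain_def)

lemma takagi_le_peak:
  assumes "signs \<sigma>" "x \<in> {0..1}"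
  shows "signed_takagi \<sigma> x \<le> 2 / 4 ^ m * peak \<sigma> m + 1 / 4 ^ m"
proof -
  obtain j t where "j < 2 ^ (2 * m)" and t: "0 \<le> t" "t \<le> 1" and "x = (real j + t) / 2 ^ (2 * m)"
    using dyadic_cell[OF assms(2)] .
  then have j: "j < 4 ^ m" and x: "x = (real j + t) / 4 ^ m" by (simp_all add: power_mult)
  have "(1 - t) * grid \<sigma> m j + t * grid \<sigma> m (Suc j) \<le> (1 - t) * peak \<sigma> m + t * peak \<sigma> m"
    using j t by (intro add_mono mult_left_mono grid_le_peak) auto
  then have "2 / 4 ^ m * ((1 - t) * grid \<sigma> m j + t * grid \<sigma> m (Suc j)) \<le> 2 / 4 ^ m * peak \<sigma> m"
    by (intro mult_left_mono) (auto simp: algebra_simps)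
  then show ?thesis using takagi_cell[OF assms(1) j t] unfolding x by linarith
qed

lemma max_value_attained:
  assumes "signs \<sigma>"
  obtains x where "x \<in> {0..1}" "max_value (signed_takagi \<sigma>) = signed_takagi \<sigma> x"
    "\<And>y. y \<in> {0..1} \<Longrightarrow> signed_takagi \<sigma> y \<le> max_value (signed_takagi \<sigma>)"
proof -
  obtain x where x: "x \<in> {0..1}" "\<And>y. y \<in> {0..1} \<Longrightarrow> signed_takagi \<sigma> y \<le> signed_takagi \<sigma> x"
    using continuous_attains_sup[OF _ _ continuous_on_signed_takagi[OF assms]] by auto
  have "max_value (signed_takagi \<sigma>) = signed_takagi \<sigma> x"
    unfolding max_value_def by (rule Greatest_equality) (use x in auto)
  then show ?thesis using that x by simp
qed

lemma max_value_bounds: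
  assumes "signs \<sigma>"
  shows "2 / 4 ^ m * peak \<sigma> m \<le> max_value (signed_takagi \<sigma>)"
    and "max_value (signed_takagi \<sigma>) \<le> 2 / 4 ^ m * peak \<sigma> m + 1 / 4 ^ m"
proof -
  obtain x where x: "x \<in> {0..1}" "max_value (signed_takagi \<sigma>) = signed_takagi \<sigma> x"
    "\<And>y. y \<in> {0..1} \<Longrightarrow> signed_takagi \<sigma> y \<le> max_value (signed_takagi \<sigma>)"
    using max_value_attained[OF assms] by blast
  show "max_value (signed_takagi \<sigma>) \<le> 2 / 4 ^ m * peak \<sigma> m + 1 / 4 ^ m"
    using takagi_le_peak[OF assms x(1)] x(2) by simp
  obtain j where j: "j \<le> 4 ^ m" "grid \<sigma> m j = peak \<sigma> m" by (rule peak_attained)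
  have "real j \<le> 4 ^ m" using j(1) by (metis of_nat_le_iff of_nat_numeral of_nat_power)
  then have "real j / 4 ^ m \<in> {0..1}" by simp
  from x(3)[OF this] show "2 / 4 ^ m * peak \<sigma> m \<le> max_value (signed_takagi \<sigma>)"
    using j takagi_grid[of \<sigma> j m] by simp
qed

lemma peak_tendsto_max_value:
  assumes "signs \<sigma>"
  shows "(\<lambda>m. 2 / 4 ^ m * peak \<sigma> m) \<longlonglongrightarrow> max_value (signed_takagi \<sigma>)"
proof (rule tendsto_sandwich)
  let ?v = "max_value (signed_takagi \<sigma>)"
  have "(\<lambda>m. ?v - (1 / 4) ^ m) \<longlonglongrightarrow> ?v - 0"
    by (intro tendsto_intros LIMSEQ_realpow_zero) auto
  then show "(\<lambda>m. ?v - 1 / 4 ^ m) \<longlonglongrightarrow> ?v" by (simp add: power_one_over)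
  show "\<forall>\<^sub>F m in sequentially. ?v - 1 / 4 ^ m \<le> 2 / 4 ^ m * peak \<sigma> m"
    using max_value_bounds(2)[OF assms] by (intro always_eventually) (simp add: algebra_simps)
  show "\<forall>\<^sub>F m in sequentially. 2 / 4 ^ m * peak \<sigma> m \<le> ?v"
    using max_value_bounds(1)[OF assms] by (intro always_eventually) simp
qed (rule tendsto_const)

lemma peak_0: "peak \<sigma> 0 = 0"
proof -
  obtain j where "j < 4 ^ 0" "grid \<sigma> 0 j = peak \<sigma> 0" by (rule peak_attained_left)
  then show ?thesis using grid_0[of \<sigma> 0] by simp
qed

lemma max_value_sums:
  assumes "signs \<sigma>"
  shows "(\<lambda>j. 1 / 2 * (of_bool (gain \<sigma> j) / 4 ^ j)) sums max_value (signed_takagi \<sigma>)"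
proof -
  have "(\<Sum>j<m. 1 / 2 * (of_bool (gain \<sigma> j) / 4 ^ j)) = 2 / 4 ^ m * peak \<sigma> m" for m
    by (induction m) (simp_all add: peak_0 peak_Suc[OF assms] field_simps)
  then show ?thesis using peak_tendsto_max_value[OF assms] by (simp add: sums_def)
qed

text \<open>The series with all digits \<open>1\<close> has sum \<open>2/3\<close>, and each missing digit makes it strictly smaller.\<close>

lemma max_value_eq_two_thirds_iff:
  assumes "signs \<sigma>"
  shows "max_value (signed_takagi \<sigma>) = 2 / 3 \<longleftrightarrow> (\<forall>m. gain \<sigma> m)"
proof
  have t: "(\<lambda>j. 1 / 2 * (1 / 4 ^ j)) sums (2 / 3 :: real)"
    using sums_mult[OF geometric_sums[of "1 / 4 :: real"], of "1 / 2"] by (simp add: power_one_over)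
  show "max_value (signed_takagi \<sigma>) = 2 / 3" if "\<forall>m. gain \<sigma> m"
    using sums_unique2[OF max_value_sums[OF assms]] t that by simp
  assume e: "max_value (signed_takagi \<sigma>) = 2 / 3"
  let ?g = "\<lambda>j. (1 / 2 :: real) * (1 / 4 ^ j) - 1 / 2 * (of_bool (gain \<sigma> j) / 4 ^ j)"
  have s: "?g sums 0"
    using sums_diff[OF t max_value_sums[OF assms]] e by simp
  show "\<forall>m. gain \<sigma> m"
  proof
    fix m
    have "\<forall>n. ?g n = 0"
      using s by (subst suminf_eq_zero_iff[symmetric]) (auto simp: sums_iff)
    then have "?g m = 0" by blast
    then show "gain \<sigma> m" by (cases "gain \<sigma> m") auto
  qed
qed

lemma max_value_cofinite:
  assumes "signs \<sigma>" "\<And>i. m \<le> i \<Longrightarrow> gain \<sigma> i"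
  shows "max_value (signed_takagi \<sigma>) \<in> cofinite_quarter_sums"
proof -
  let ?D = "{j. gain \<sigma> j}"
  have "UNIV - ?D \<subseteq> {..<m}" using assms(2) by (auto simp: not_le[symmetric])
  then have fin: "finite (UNIV - ?D)" by (rule finite_subset) simp
  have s: "(\<lambda>j. of_bool (gain \<sigma> j) / 4 ^ j) sums (2 * max_value (signed_takagi \<sigma>) :: real)"
    using sums_mult[OF max_value_sums[OF assms(1)], of 2] by simp
  have "((\<lambda>j. of_bool (gain \<sigma> j) / 4 ^ j) has_sum (2 * max_value (signed_takagi \<sigma>) :: real)) UNIV"
    by (rule norm_summable_imp_has_sum[OF _ s]) (use s in \<open>simp add: sums_iff\<close>)
  then have "((\<lambda>j. 1 / 4 ^ j) has_sum (2 * max_value (signed_takagi \<sigma>) :: real)) ?D"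
    by (rule has_sum_cong_neutral[THEN iffD1, rotated 3]) auto
  then have "max_value (signed_takagi \<sigma>) = 1 / 2 * (\<Sum>\<^sub>\<infinity>j\<in>?D. 1 / 4 ^ j)"
    by (simp add: infsumI)
  then show ?thesis using fin unfolding cofinite_quarter_sums_def by blast
qed

lemma countable_cofinite_quarter_sums: "countable cofinite_quarter_sums"
proof -
  have "cofinite_quarter_sums
      \<subseteq> (\<lambda>S. 1 / 2 * (\<Sum>\<^sub>\<infinity>j\<in>UNIV - S. 1 / 4 ^ j)) ` {S. finite S}"
  proof
    fix y assume "y \<in> cofinite_quarter_sums"
    then obtain D :: "nat set" where D: "finite (UNIV - D)" "y = 1 / 2 * (\<Sum>\<^sub>\<infinity>j\<in>D. 1 / 4 ^ j)"
      unfolding cofinite_quarter_sums_def by blast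
    have "D = UNIV - (UNIV - D)" by auto
    with D(2) have "y = 1 / 2 * (\<Sum>\<^sub>\<infinity>j\<in>UNIV - (UNIV - D). 1 / 4 ^ j)" by (simp only:)
    with D(1) show "y \<in> (\<lambda>S. 1 / 2 * (\<Sum>\<^sub>\<infinity>j\<in>UNIV - S. 1 / 4 ^ j)) ` {S. finite S}" by blast
  qed
  then show ?thesis
    by (rule countable_subset) (intro countable_image countable_Collect_finite)
qed

section \<open>Survival and percolation on the descendant tree\<close>

text \<open>Keep every edge of the tree of descendants of interval \<open>j\<close> of level \<open>m\<close> independently with
probability \<open>r\<close>. Then \<open>reach r \<sigma> n m j\<close> is the conditional probability, given the signs, that the kept part
contains a line of length \<open>n\<close>. For \<open>r = 1\<close> it is the indicator that generation \<open>n\<close> is not empty.\<close>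

fun reach :: "real \<Rightarrow> (nat \<Rightarrow> nat \<Rightarrow> real) \<Rightarrow> nat \<Rightarrow> nat \<Rightarrow> nat \<Rightarrow> real" where
  "reach r \<sigma> 0 m j = 1"
| "reach r \<sigma> (Suc n) m j = of_bool (\<sigma> (2 * m) j = 1) * (1 -
     (1 - r * (of_bool (\<sigma> (2 * m + 1) (2 * j) = 1) * reach r \<sigma> n (Suc m) (4 * j + 1))) *
     (1 - r * (of_bool (\<sigma> (2 * m + 1) (2 * j + 1) = 1) * reach r \<sigma> n (Suc m) (4 * j + 2))))"

lemma branch_mono:
  fixes x y :: real
  assumes "0 \<le> x" "x \<le> x'" "x' \<le> 1" "0 \<le> y" "y \<le> y'" "y' \<le> 1"
  shows "1 - (1 - x) * (1 - y) \<le> 1 - (1 - x') * (1 - y')"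
    and "0 \<le> 1 - (1 - x) * (1 - y)" and "1 - (1 - x) * (1 - y) \<le> 1"
proof -
  have "(1 - x') * (1 - y') \<le> (1 - x) * (1 - y)" "(1 - x) * (1 - y) \<le> 1 * 1" "0 \<le> (1 - x) * (1 - y)"
    using assms by (intro mult_mono mult_nonneg_nonneg; simp)+
  then show "1 - (1 - x) * (1 - y) \<le> 1 - (1 - x') * (1 - y')"
    "0 \<le> 1 - (1 - x) * (1 - y)" "1 - (1 - x) * (1 - y) \<le> 1" by auto
qed

lemma mult_of_bool_bounds:
  fixes a r :: real
  assumes "0 \<le> r" "r \<le> 1" "0 \<le> a" "a \<le> 1"
  shows "0 \<le> r * (of_bool P * a)" "r * (of_bool P * a) \<le> 1"
  using assms by (auto simp: mult_le_one)

lemma reach_bounds: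
  assumes "0 \<le> r" "r \<le> 1"
  shows "0 \<le> reach r \<sigma> n m j" "reach r \<sigma> n m j \<le> 1"
proof -
  have "0 \<le> reach r \<sigma> n m j \<and> reach r \<sigma> n m j \<le> 1"
  proof (induction n arbitrary: m j)
    case (Suc n)
    note b = mult_of_bool_bounds[OF assms, of "reach r \<sigma> n (Suc m) (4 * j + 1)" "\<sigma> (2 * m + 1) (2 * j) = 1"]
       mult_of_bool_bounds[OF assms, of "reach r \<sigma> n (Suc m) (4 * j + 2)" "\<sigma> (2 * m + 1) (2 * j + 1) = 1"]
    note b = b[OF Suc.IH[THEN conjunct1] Suc.IH[THEN conjunct2]]
    show ?case using branch_mono(2,3)[OF b(1) order_refl b(2,3) order_refl b(4)] by simp
  qed simp
  then show "0 \<le> reach r \<sigma> n m j" "reach r \<sigma> n m j \<le> 1" by auto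
qed

lemma reach_mono:
  assumes "0 \<le> r" "r \<le> r'" "r' \<le> 1"
  shows "reach r \<sigma> n m j \<le> reach r' \<sigma> n m j"
proof (induction n arbitrary: m j)
  case (Suc n)
  have r: "r \<le> 1" "0 \<le> r'" using assms by auto
  note b = reach_bounds[OF assms(1) r(1), of \<sigma> n] reach_bounds[OF r(2) assms(3), of \<sigma> n]
  have st: "r * (of_bool P * reach r \<sigma> n i k) \<le> r' * (of_bool P * reach r' \<sigma> n i k)" for P i k
    using assms Suc.IH[of i k] b by (intro mult_mono) auto
  show ?case
    unfolding reach.simps
    by (intro mult_left_mono branch_mono(1) st mult_of_bool_bounds b assms r) auto
qed simp

lemma reach_decreasing:
  assumes "0 \<le> r" "r \<le> 1"
  shows "reach r \<sigma> (Suc n) m j \<le> reach r \<sigma> n m j"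
proof (induction n arbitrary: m j)
  case 0
  show ?case using reach_bounds(2)[OF assms, of \<sigma> "Suc 0" m j] by simp
next
  case (Suc n)
  note b = reach_bounds[OF assms]
  have st: "r * (of_bool P * reach r \<sigma> (Suc n) i k) \<le> r * (of_bool P * reach r \<sigma> n i k)" for P i k
    using assms Suc.IH[of i k] b by (intro mult_mono) (auto simp del: reach.simps)
  have "reach r \<sigma> (Suc (Suc n)) m j = of_bool (\<sigma> (2 * m) j = 1) * (1 -
     (1 - r * (of_bool (\<sigma> (2 * m + 1) (2 * j) = 1) * reach r \<sigma> (Suc n) (Suc m) (4 * j + 1))) *
     (1 - r * (of_bool (\<sigma> (2 * m + 1) (2 * j + 1) = 1) * reach r \<sigma> (Suc n) (Suc m) (4 * j + 2))))"
    by (rule reach.simps)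
  also have "\<dots> \<le> reach r \<sigma> (Suc n) m j"
    unfolding reach.simps(2)[of r \<sigma> n m j]
    by (intro mult_left_mono branch_mono(1) st mult_of_bool_bounds b assms) auto
  finally show ?case .
qed

lemma reach_decseq: "0 \<le> r \<Longrightarrow> r \<le> 1 \<Longrightarrow> decseq (\<lambda>n. reach r \<sigma> n m j)"
  by (intro decseq_SucI reach_decreasing)

definition reach_lim :: "real \<Rightarrow> (nat \<Rightarrow> nat \<Rightarrow> real) \<Rightarrow> nat \<Rightarrow> nat \<Rightarrow> real" where
  "reach_lim r \<sigma> m j = lim (\<lambda>n. reach r \<sigma> n m j)"

lemma reach_tendsto:
  assumes "0 \<le> r" "r \<le> 1"
  shows "(\<lambda>n. reach r \<sigma> n m j) \<longlonglongrightarrow> reach_lim r \<sigma> m j"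
proof -
  have "convergent (\<lambda>n. reach r \<sigma> n m j)"
    using decseq_convergent[OF reach_decseq[OF assms], of 0 \<sigma> m j] reach_bounds(1)[OF assms]
    by (metis convergentI)
  then show ?thesis by (simp add: reach_lim_def convergent_LIMSEQ_iff)
qed

lemma reach_lim_bounds:
  assumes "0 \<le> r" "r \<le> 1"
  shows "0 \<le> reach_lim r \<sigma> m j" "reach_lim r \<sigma> m j \<le> 1" "reach_lim r \<sigma> m j \<le> reach r \<sigma> n m j"
  using LIMSEQ_le_const[OF reach_tendsto[OF assms]] LIMSEQ_le_const2[OF reach_tendsto[OF assms]]
    reach_bounds[OF assms] decseq_ge[OF reach_decseq[OF assms] reach_tendsto[OF assms]] by blast+

lemma reach_lim_mono:
  assumes "0 \<le> r" "r \<le> r'" "r' \<le> 1"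
  shows "reach_lim r \<sigma> m j \<le> reach_lim r' \<sigma> m j"
  using assms reach_mono[OF assms]
  by (intro LIMSEQ_le[OF reach_tendsto reach_tendsto]) (auto intro!: exI[of _ 0])

lemma reach_lim_rec:
  assumes "0 \<le> r" "r \<le> 1"
  shows "reach_lim r \<sigma> m j = of_bool (\<sigma> (2 * m) j = 1) * (1 -
     (1 - r * (of_bool (\<sigma> (2 * m + 1) (2 * j) = 1) * reach_lim r \<sigma> (Suc m) (4 * j + 1))) *
     (1 - r * (of_bool (\<sigma> (2 * m + 1) (2 * j + 1) = 1) * reach_lim r \<sigma> (Suc m) (4 * j + 2))))"
    (is "_ = ?R")
proof -
  have "(\<lambda>n. reach r \<sigma> (Suc n) m j) \<longlonglongrightarrow> ?R"
    unfolding reach.simps by (intro tendsto_intros reach_tendsto assms)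
  then show ?thesis
    using LIMSEQ_Suc[OF reach_tendsto[OF assms, of \<sigma> m j]] LIMSEQ_unique by blast
qed

text \<open>Positivity of the limit obeys a recursion that does not involve \<open>r\<close>. For this reason the probability
of positivity turns out not to depend on \<open>r\<close> either.\<close>

lemma reach_lim_pos_rec:
  assumes "0 < r" "r \<le> 1"
  shows "reach_lim r \<sigma> m j > 0 \<longleftrightarrow> (\<exists>i\<in>kids \<sigma> m j. reach_lim r \<sigma> (Suc m) i > 0)"
proof -
  have r: "0 \<le> r" using assms by simp
  define x where "x = r * (of_bool (\<sigma> (2 * m + 1) (2 * j) = 1) * reach_lim r \<sigma> (Suc m) (4 * j + 1))"
  define y where "y = r * (of_bool (\<sigma> (2 * m + 1) (2 * j + 1) = 1) * reach_lim r \<sigma> (Suc m) (4 * j + 2))"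
  have b: "0 \<le> x" "x \<le> 1" "0 \<le> y" "y \<le> 1"
    unfolding x_def y_def by (intro mult_of_bool_bounds reach_lim_bounds r assms)+
  have "1 - (1 - x) * (1 - y) > 0 \<longleftrightarrow> x > 0 \<or> y > 0"
  proof
    assume "x > 0 \<or> y > 0"
    moreover have e: "1 - (1 - x) * (1 - y) = x + y * (1 - x)" "1 - (1 - x) * (1 - y) = y + x * (1 - y)"
      by algebra+
    moreover have "0 \<le> y * (1 - x)" "0 \<le> x * (1 - y)" using b by auto
    ultimately show "1 - (1 - x) * (1 - y) > 0" by (metis add_pos_nonneg)
  next
    assume "1 - (1 - x) * (1 - y) > 0"
    then show "x > 0 \<or> y > 0" using b by (cases "x = 0"; cases "y = 0") auto
  qed
  moreover have "reach_lim r \<sigma> m j = of_bool (\<sigma> (2 * m) j = 1) * (1 - (1 - x) * (1 - y))"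
    unfolding x_def y_def by (rule reach_lim_rec[OF r assms(2)])
  moreover have "x > 0 \<longleftrightarrow> \<sigma> (2 * m + 1) (2 * j) = 1 \<and> reach_lim r \<sigma> (Suc m) (4 * j + 1) > 0"
    "y > 0 \<longleftrightarrow> \<sigma> (2 * m + 1) (2 * j + 1) = 1 \<and> reach_lim r \<sigma> (Suc m) (4 * j + 2) > 0"
    unfolding x_def y_def using assms by (auto simp: zero_less_mult_iff)
  ultimately show ?thesis by (auto simp: kids_def)
qed

lemma reach_1_cases: "reach 1 \<sigma> n m j = 0 \<or> reach 1 \<sigma> n m j = 1"
proof (induction n arbitrary: m j)
  case (Suc n)
  show ?case using Suc.IH[of "Suc m" "4 * j + 1"] Suc.IH[of "Suc m" "4 * j + 2"] by auto
qed simp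

lemma reach_1_Suc: "reach 1 \<sigma> (Suc n) m j = 1 \<longleftrightarrow> (\<exists>i\<in>kids \<sigma> m j. reach 1 \<sigma> n (Suc m) i = 1)"
  using reach_1_cases[of \<sigma> n "Suc m" "4 * j + 1"] reach_1_cases[of \<sigma> n "Suc m" "4 * j + 2"]
  by (auto simp: kids_def simp del: One_nat_def)

lemma reach_lim_1_cases:
  "reach_lim 1 \<sigma> m j = 0 \<and> (\<exists>n. reach 1 \<sigma> n m j = 0) \<or> reach_lim 1 \<sigma> m j = 1 \<and> (\<forall>n. reach 1 \<sigma> n m j = 1)"
proof (cases "\<exists>n. reach 1 \<sigma> n m j = 0")
  case True
  then obtain n where "reach 1 \<sigma> n m j = 0" by blast
  then have "reach_lim 1 \<sigma> m j = 0" using reach_lim_bounds(1)[of 1 \<sigma> m j] reach_lim_bounds(3)[of 1 \<sigma> m j n] by simp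
  then show ?thesis using True by blast
next
  case False
  then have a: "\<forall>n. reach 1 \<sigma> n m j = 1" using reach_1_cases by blast
  then have "reach_lim 1 \<sigma> m j = 1" using LIMSEQ_unique[OF reach_tendsto[of 1 \<sigma> m j]] by simp
  then show ?thesis using a by blast
qed

lemma gain_if_reach_lim:
  assumes "signs \<sigma>" "j \<in> crest \<sigma> m" "reach_lim 1 \<sigma> m j > 0"
  shows "gain \<sigma> m" "\<exists>i\<in>crest \<sigma> (Suc m). reach_lim 1 \<sigma> (Suc m) i > 0"
proof -
  obtain i where i: "i \<in> kids \<sigma> m j" "reach_lim 1 \<sigma> (Suc m) i > 0"
    using reach_lim_pos_rec[of 1 \<sigma> m j] assms(3) by auto
  then have "\<sigma> (2 * m) j = 1" by (auto simp: kids_def)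
  then show g: "gain \<sigma> m" using gain_iff[OF assms(1)] assms(2) by blast
  show "\<exists>i\<in>crest \<sigma> (Suc m). reach_lim 1 \<sigma> (Suc m) i > 0"
    using crest_Suc[OF assms(1) g] assms(2) i by blast
qed

text \<open>A surviving line in the crest passes through crest intervals of all later levels, and each of them
has sign \<open>+1\<close> because it has a child.\<close>

lemma gain_forever:
  assumes "signs \<sigma>" "\<exists>j\<in>crest \<sigma> m. reach_lim 1 \<sigma> m j > 0" "m \<le> i"
  shows "gain \<sigma> i \<and> (\<exists>j\<in>crest \<sigma> i. reach_lim 1 \<sigma> i j > 0)"
  using assms(3)
proof (induction i rule: dec_induct)
  case base
  then show ?case using assms gain_if_reach_lim by blast
next
  case (step n)
  then show ?case using assms(1) gain_if_reach_lim by metis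
qed

text \<open>As long as there is a gain at every level, crest intervals descend from crest intervals only, so a
nonempty crest can be traced back.\<close>

lemma reach_if_crest:
  assumes "signs \<sigma>" "\<And>i. m \<le> i \<Longrightarrow> i < m + n \<Longrightarrow> gain \<sigma> i" "crest \<sigma> (m + n) \<noteq> {}"
  shows "\<exists>j\<in>crest \<sigma> m. reach 1 \<sigma> n m j = 1"
  using assms(2,3)
proof (induction n arbitrary: m)
  case 0
  then show ?case by auto
next
  case (Suc n)
  have "\<exists>i\<in>crest \<sigma> (Suc m). reach 1 \<sigma> n (Suc m) i = 1"
    by (rule Suc.IH) (use Suc.prems in auto)
  then obtain i where i: "i \<in> crest \<sigma> (Suc m)" "reach 1 \<sigma> n (Suc m) i = 1" by blast
  have "gain \<sigma> m" using Suc.prems(1) by simp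
  then obtain j where "j \<in> crest \<sigma> m" "i \<in> kids \<sigma> m j"
    using crest_Suc[OF assms(1)] i by blast
  then show ?case using reach_1_Suc i by blast
qed

lemma max_value_two_thirds_iff_reach_lim:
  assumes "signs \<sigma>"
  shows "max_value (signed_takagi \<sigma>) = 2 / 3 \<longleftrightarrow> reach_lim 1 \<sigma> 0 0 > 0"
proof -
  have crest0: "crest \<sigma> 0 = {0}" using grid_0[of \<sigma> 0] grid_last[of \<sigma> 0] by (auto simp: crest_def peak_0)
  have "reach_lim 1 \<sigma> 0 0 > 0" if g: "\<forall>m. gain \<sigma> m"
  proof -
    have "reach 1 \<sigma> n 0 0 = 1" for n
    proof -
      have "crest \<sigma> (0 + n) \<noteq> {}" using g gain_iff[OF assms] by (metis add_0 empty_iff)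
      then show ?thesis using reach_if_crest[OF assms, of 0 n] g crest0 by simp
    qed
    then show ?thesis using reach_lim_1_cases[of \<sigma> 0 0] by auto
  qed
  moreover have "\<forall>m. gain \<sigma> m" if "reach_lim 1 \<sigma> 0 0 > 0"
    using gain_forever[OF assms, of 0] that crest0 by simp
  ultimately show ?thesis using max_value_eq_two_thirds_iff[OF assms] by blast
qed

section \<open>Slopes along the edge of an interval\<close>

text \<open>Along the left edge of an interval the grid value stays the same up to the change of unit, and the
slope of the adjacent interval performs a walk whose steps are given by the signs on that edge.\<close>

lemma edge_walk:
  shows "grid \<sigma> (m + n) (j * 4 ^ n) = 4 ^ n * grid \<sigma> m j"
    and "grid \<sigma> (m + n) (j * 4 ^ n + 1) - grid \<sigma> (m + n) (j * 4 ^ n)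
      = grid \<sigma> m (Suc j) - grid \<sigma> m j
        + (\<Sum>i<n. \<sigma> (2 * (m + i)) (j * 4 ^ i) + \<sigma> (2 * (m + i) + 1) (2 * (j * 4 ^ i))) / 2"
proof (induction n)
  case (Suc n)
  {
    case 1
    show ?case using grid_children(1)[of \<sigma> "m + n" "j * 4 ^ n"] Suc.IH(1) by (simp add: mult_ac)
  next
    case 2
    have e: "4 * (j * 4 ^ n) = j * 4 ^ Suc n" by simp
    show ?case
      using grid_children(1,2)[of \<sigma> "m + n" "j * 4 ^ n"] Suc.IH(2) unfolding e
      by (simp add: add_divide_distrib)
  }
qed simp_all

text \<open>If the crest stays empty, the peak stays the same, so a maximal grid point remains maximal and the
slope to its right can never become positive.\<close>

lemma edge_walk_bounded:
  assumes "signs \<sigma>" "\<And>k. m \<le> k \<Longrightarrow> crest \<sigma> k = {}"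
  obtains j and c :: nat where "j < 4 ^ m"
    "\<And>n. (\<Sum>i<n. \<sigma> (2 * (m + i)) (j * 4 ^ i) + \<sigma> (2 * (m + i) + 1) (2 * (j * 4 ^ i))) \<le> real c"
proof -
  obtain j where j: "j < 4 ^ m" "grid \<sigma> m j = peak \<sigma> m" by (rule peak_attained_left)
  obtain c :: nat where c: "2 * (grid \<sigma> m j - grid \<sigma> m (Suc j)) \<le> real c" using real_arch_simple by blast
  have "(\<Sum>i<n. \<sigma> (2 * (m + i)) (j * 4 ^ i) + \<sigma> (2 * (m + i) + 1) (2 * (j * 4 ^ i))) \<le> real c" for n
  proof -
    have "peak \<sigma> (m + n) = 4 ^ n * peak \<sigma> m"
      by (rule peak_constant) (use assms gain_iff in auto)
    moreover have "(j + 1) * 4 ^ n \<le> 4 ^ m * 4 ^ n" using j by (intro mult_right_mono) auto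
    then have "j * 4 ^ n + 1 \<le> 4 ^ (m + n)" 
      using le_trans[of "j * 4 ^ n + 1" "(j + 1) * 4 ^ n"] by (simp add: power_add)
    then have "grid \<sigma> (m + n) (j * 4 ^ n + 1) \<le> peak \<sigma> (m + n)" by (rule grid_le_peak)
    ultimately show ?thesis using edge_walk[of \<sigma> m n j] j c by simp
  qed
  then show ?thesis using that j by blast
qed

section \<open>Generation sizes\<close>

fun offspring :: "(nat \<Rightarrow> nat \<Rightarrow> real) \<Rightarrow> nat \<Rightarrow> nat \<Rightarrow> nat \<Rightarrow> real" where
  "offspring \<sigma> 0 m j = 1"
| "offspring \<sigma> (Suc n) m j = of_bool (\<sigma> (2 * m) j = 1) *
     (of_bool (\<sigma> (2 * m + 1) (2 * j) = 1) * offspring \<sigma> n (Suc m) (4 * j + 1) +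
      of_bool (\<sigma> (2 * m + 1) (2 * j + 1) = 1) * offspring \<sigma> n (Suc m) (4 * j + 2))"

lemma offspring_nonneg: "0 \<le> offspring \<sigma> n m j"
  by (induction n arbitrary: m j) auto

section \<open>Hausdorff measure of limit sets of quarter intervals\<close>

lemma hausdorff_measure_zero_iff:
  "hausdorff_measure s A = 0 \<longleftrightarrow> (\<forall>\<delta>>0. hausdorff_premeasure s \<delta> A = 0)"
  unfolding hausdorff_measure_def by (auto simp flip: bot_ennreal)

lemma hausdorff_measure_zero_mono:
  assumes "0 \<le> s" "s < s'" "hausdorff_measure s A = 0"
  shows "hausdorff_measure s' A = 0"
  unfolding hausdorff_measure_zero_iff
proof (intro allI impI)
  fix \<delta> :: real assume "\<delta> > 0"
  define \<delta>' where "\<delta>' = min \<delta> 1"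
  have w: "hausdorff_weight s' U \<le> hausdorff_weight s U" if "bounded U" "diameter U \<le> \<delta>'" for U :: "'a set"
  proof -
    have d: "0 \<le> diameter U" "diameter U \<le> 1"
      using that diameter_ge_0 by (auto simp: \<delta>'_def)
    have "diameter U powr s' \<le> diameter U powr s" using d assms by (intro powr_mono') auto
    moreover have "diameter U powr s' \<le> 1"
      using powr_mono2[of s' "diameter U" 1] d assms by simp
    ultimately show ?thesis
      using assms by (auto simp: hausdorff_weight_def intro: ennreal_leI simp flip: ennreal_1)
  qed
  have "hausdorff_premeasure s' \<delta> A \<le> hausdorff_premeasure s \<delta>' A"
    unfolding hausdorff_premeasure_def
  proof (rule INF_mono)
    fix U :: "nat \<Rightarrow> 'a set"
    assume U: "U \<in> {U. A \<subseteq> (\<Union>i. U i) \<and> (\<forall>i. bounded (U i) \<and> diameter (U i) \<le> \<delta>')}"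
    then have "U \<in> {U. A \<subseteq> (\<Union>i. U i) \<and> (\<forall>i. bounded (U i) \<and> diameter (U i) \<le> \<delta>)}"
      by (auto simp: \<delta>'_def)
    moreover have "(\<Sum>i. hausdorff_weight s' (U i)) \<le> (\<Sum>i. hausdorff_weight s (U i))"
      using U by (intro suminf_le w) auto
    ultimately show "\<exists>V\<in>{U. A \<subseteq> (\<Union>i. U i) \<and> (\<forall>i. bounded (U i) \<and> diameter (U i) \<le> \<delta>)}.
        (\<Sum>i. hausdorff_weight s' (V i)) \<le> (\<Sum>i. hausdorff_weight s (U i))" by blast
  qed
  also have "\<dots> = 0" using assms(3) \<open>\<delta> > 0\<close> unfolding hausdorff_measure_zero_iff by (simp add: \<delta>'_def)
  finally show "hausdorff_premeasure s' \<delta> A = 0" by simp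
qed

definition cell :: "nat \<Rightarrow> nat \<Rightarrow> real set" where
  "cell k j = {real j / 4 ^ k .. (real j + 1) / 4 ^ k}"

lemma diameter_cell: "diameter (cell k j) = 1 / 4 ^ k"
proof -
  have "\<not> (real j + 1) / 4 ^ k < real j / 4 ^ k" by (simp add: not_less divide_right_mono)
  then show ?thesis unfolding cell_def by (simp flip: diff_divide_distrib)
qed

lemma quarter_powr: "(1 / 4 ^ k :: real) powr s = (4 powr - s) ^ k"
proof -
  have "(1 / 4 ^ k :: real) = 4 powr (- real k)"
    by (simp add: powr_minus powr_realpow divide_inverse)
  then show ?thesis by (simp add: powr_powr powr_power mult.commute)
qed

text \<open>A cell of level \<open>k\<close> has weight \<open>(4^-s)^k\<close>, so the \<open>n\<close>-th cover weighs \<open>(4^-s)^m\<close> times a null sequence.\<close>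

lemma hausdorff_measure_zero_if_covers:
  assumes s: "0 < s" and fin: "\<And>n. finite (T n)" and cov: "\<And>n. E \<subseteq> (\<Union>j\<in>T n. cell (m + n) j)"
    and lim: "(\<lambda>n. real (card (T n)) * (4 powr - s) ^ n) \<longlonglongrightarrow> 0"
  shows "hausdorff_measure s E = 0"
  unfolding hausdorff_measure_zero_iff
proof (intro allI impI)
  fix \<delta> :: real assume "\<delta> > 0"
  have le: "hausdorff_premeasure s \<delta> E \<le> ennreal \<epsilon>" if "\<epsilon> > 0" for \<epsilon>
  proof -
    have "(\<lambda>n. (1 / 4 :: real) ^ n) \<longlonglongrightarrow> 0" by (rule LIMSEQ_realpow_zero) auto
    then have "\<forall>\<^sub>F n in sequentially. (1 / 4 :: real) ^ n < \<delta>"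
      using \<open>\<delta> > 0\<close> by (rule order_tendstoD)
    moreover have "\<forall>\<^sub>F n in sequentially. real (card (T n)) * (4 powr - s) ^ n < \<epsilon>"
      using lim that by (rule order_tendstoD)
    ultimately have "\<forall>\<^sub>F n in sequentially. (1 / 4 :: real) ^ n < \<delta> \<and> real (card (T n)) * (4 powr - s) ^ n < \<epsilon>"
      by eventually_elim simp
    then obtain n where n: "(1 / 4 :: real) ^ n < \<delta>" "real (card (T n)) * (4 powr - s) ^ n < \<epsilon>"
      by (auto simp: eventually_sequentially)
    define U where "U i = (if i \<in> T n then cell (m + n) i else {})" for i
    have "(1 / 4 :: real) ^ (m + n) \<le> (1 / 4) ^ n" by (rule power_decreasing) auto
    then have d: "1 / 4 ^ (m + n) \<le> \<delta>" using n(1) by (simp add: power_one_over)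
    have "hausdorff_premeasure s \<delta> E \<le> (\<Sum>i. hausdorff_weight s (U i))"
      unfolding hausdorff_premeasure_def
    proof (rule INF_lower, intro CollectI conjI allI)
      show "E \<subseteq> (\<Union>i. U i)" using cov[of n] by (auto simp: U_def)
      show "bounded (U i)" for i by (simp add: U_def cell_def)
      show "diameter (U i) \<le> \<delta>" for i using d \<open>\<delta> > 0\<close> by (simp add: U_def diameter_cell)
    qed
    also have "\<dots> = (\<Sum>i\<in>T n. hausdorff_weight s (U i))"
      by (rule suminf_finite[OF fin]) (simp add: U_def hausdorff_weight_def)
    also have "\<dots> = (\<Sum>i\<in>T n. ennreal ((4 powr - s) ^ (m + n)))"
    proof (rule sum.cong[OF refl])
      fix i assume "i \<in> T n"
      moreover have "cell (m + n) i \<noteq> {}" by (simp add: cell_def divide_right_mono)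
      ultimately show "hausdorff_weight s (U i) = ennreal ((4 powr - s) ^ (m + n))"
        using s by (simp add: U_def hausdorff_weight_def diameter_cell quarter_powr)
    qed
    also have "\<dots> = ennreal (real (card (T n)) * (4 powr - s) ^ (m + n))"
      by (simp add: ennreal_mult ennreal_of_nat_eq_real_of_nat)
    also have "\<dots> \<le> ennreal \<epsilon>"
    proof (rule ennreal_leI)
      have "(4 powr - s) ^ (m + n) \<le> (4 powr - s) ^ n"
        using s by (intro power_decreasing) (auto simp: powr_less_one less_imp_le)
      then have "real (card (T n)) * (4 powr - s) ^ (m + n) \<le> real (card (T n)) * (4 powr - s) ^ n"
        by (intro mult_left_mono) auto
      then show "real (card (T n)) * (4 powr - s) ^ (m + n) \<le> \<epsilon>" using n(2) by linarith
    qed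
    finally show ?thesis .
  qed
  have "hausdorff_premeasure s \<delta> E \<le> 0"
    by (rule ennreal_le_epsilon) (use le in simp)
  then show "hausdorff_premeasure s \<delta> E = 0" by simp
qed

lemma finite_kids: "finite (kids \<sigma> m j)"
  by (rule finite_subset[of _ "{4 * j + 1, 4 * j + 2}"]) (auto simp: kids_def)

lemma reach_lim_le_kids:
  assumes "0 \<le> r" "r \<le> 1"
  shows "reach_lim r \<sigma> m j \<le> (\<Sum>i\<in>kids \<sigma> m j. r * reach_lim r \<sigma> (Suc m) i)"
proof (cases "\<sigma> (2 * m) j = 1")
  case True
  define x where "x = r * (of_bool (\<sigma> (2 * m + 1) (2 * j) = 1) * reach_lim r \<sigma> (Suc m) (4 * j + 1))"
  define y where "y = r * (of_bool (\<sigma> (2 * m + 1) (2 * j + 1) = 1) * reach_lim r \<sigma> (Suc m) (4 * j + 2))"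
  have b: "0 \<le> x" "0 \<le> y"
    unfolding x_def y_def by (intro mult_of_bool_bounds reach_lim_bounds assms)+
  have k: "kids \<sigma> m j = (if \<sigma> (2 * m + 1) (2 * j) = 1 then {4 * j + 1} else {}) \<union>
      (if \<sigma> (2 * m + 1) (2 * j + 1) = 1 then {4 * j + 2} else {})"
    using True by (auto simp: kids_def)
  have "reach_lim r \<sigma> m j = 1 - (1 - x) * (1 - y)"
    using reach_lim_rec[OF assms, of \<sigma> m j] True by (simp add: x_def y_def)
  also have "\<dots> = x + y - x * y" by algebra
  also have "\<dots> \<le> x + y" using b by simp
  also have "\<dots> = (\<Sum>i\<in>kids \<sigma> m j. r * reach_lim r \<sigma> (Suc m) i)"
    unfolding k x_def y_def by auto
  finally show ?thesis .
next
  case False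
  then have "reach_lim r \<sigma> m j = 0" "kids \<sigma> m j = {}"
    using reach_lim_rec[OF assms, of \<sigma> m j] by (auto simp: kids_def)
  then show ?thesis by simp
qed

text \<open>A cut of total weight \<open>\<Sum> r^|v|\<close> below \<open>r^m\<close> times the percolation probability cannot separate the
root from infinity. Call a vertex good if the part of the cut among its descendants (itself included) has
smaller weight than \<open>r^k\<close> times its own percolation probability. Percolation probabilities are
subadditive over children and the weights of the parts of the cut are superadditive, so a good vertex has a good
child. A good vertex is not in the cut, since it would contribute \<open>r^k\<close>. Successive
good children form the line, and infinitely many vertices in the cut do no harm.\<close>

lemma ray_avoiding_cut:
  fixes r :: real and K :: "nat \<Rightarrow> nat" and P :: "nat \<Rightarrow> nat set"
  assumes r: "0 \<le> r" "r \<le> 1" and fin: "\<And>i. finite (P i)"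
    and small: "(\<Sum>i. ennreal (r ^ K i * card (P i))) < ennreal (r ^ m * reach_lim r \<sigma> m j)"
  obtains a where "a m = j" "\<And>k. m \<le> k \<Longrightarrow> a (Suc k) \<in> kids \<sigma> k (a k)"
    "\<And>i. m \<le> K i \<Longrightarrow> a (K i) \<notin> P i"
proof -
  \<comment> \<open>\<open>D k v i\<close> is the part of the \<open>i\<close>-th portion of the cut below \<open>v\<close>, \<open>L\<close> its total weight, and \<open>L < R\<close> means good.\<close>
  define D where "D k v i = {l \<in> P i. k \<le> K i \<and> l div 4 ^ (K i - k) = v}" for k v i
  define L where "L k v = (\<Sum>i. ennreal (r ^ K i * card (D k v i)))" for k v
  define R where "R k v = ennreal (r ^ k * reach_lim r \<sigma> k v)" for k v
  have finD: "finite (D k v i)" for k v i using fin by (simp add: D_def)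
  have start: "L m j < R m j"
  proof -
    have "L m j \<le> (\<Sum>i. ennreal (r ^ K i * card (P i)))"
      unfolding L_def using r fin
      by (intro suminf_le ennreal_leI mult_left_mono) (auto intro!: card_mono simp: D_def)
    then show ?thesis using small by (simp add: R_def)
  qed
  have step: "\<exists>v'\<in>kids \<sigma> k v. L (Suc k) v' < R (Suc k) v'" if lt: "L k v < R k v" for k v
  proof (rule ccontr)
    assume "\<not> ?thesis"
    then have ge: "R (Suc k) v' \<le> L (Suc k) v'" if "v' \<in> kids \<sigma> k v" for v' using that by (auto simp: not_less)
    have "R k v \<le> ennreal (\<Sum>i\<in>kids \<sigma> k v. r ^ Suc k * reach_lim r \<sigma> (Suc k) i)"
      unfolding R_def
    proof (rule ennreal_leI)
      have "r ^ k * reach_lim r \<sigma> k v \<le> r ^ k * (\<Sum>i\<in>kids \<sigma> k v. r * reach_lim r \<sigma> (Suc k) i)"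
        using r by (intro mult_left_mono reach_lim_le_kids) auto
      then show "r ^ k * reach_lim r \<sigma> k v \<le> (\<Sum>i\<in>kids \<sigma> k v. r ^ Suc k * reach_lim r \<sigma> (Suc k) i)"
        by (simp add: sum_distrib_left mult_ac)
    qed
    also have "\<dots> = (\<Sum>i\<in>kids \<sigma> k v. R (Suc k) i)"
      unfolding R_def using r reach_lim_bounds(1)[OF r] by (subst sum_ennreal) auto
    also have "\<dots> \<le> (\<Sum>i\<in>kids \<sigma> k v. L (Suc k) i)"
      by (intro sum_mono ge)
    also have "\<dots> = (\<Sum>n. \<Sum>i\<in>kids \<sigma> k v. ennreal (r ^ K n * card (D (Suc k) i n)))"
      unfolding L_def by (subst suminf_sum) auto
    also have "\<dots> \<le> L k v"
      unfolding L_def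
    proof (intro suminf_le)
      fix n
      have sub: "(\<Union>i\<in>kids \<sigma> k v. D (Suc k) i n) \<subseteq> D k v n"
      proof
        fix l assume "l \<in> (\<Union>i\<in>kids \<sigma> k v. D (Suc k) i n)"
        then obtain i where i: "i \<in> kids \<sigma> k v" "l \<in> P n" "Suc k \<le> K n" "l div 4 ^ (K n - Suc k) = i"
          by (auto simp: D_def)
        have "K n - k = Suc (K n - Suc k)" using i by simp
        then have "l div 4 ^ (K n - k) = (l div 4 ^ (K n - Suc k)) div 4"
          by (simp only: power_Suc2 div_mult2_eq)
        also have "\<dots> = v" using i(1,4) by (auto simp: kids_def)
        finally show "l \<in> D k v n" using i by (simp add: D_def)
      qed
      have "(\<Sum>i\<in>kids \<sigma> k v. card (D (Suc k) i n)) = card (\<Union>i\<in>kids \<sigma> k v. D (Suc k) i n)"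
        by (rule card_UN_disjoint[symmetric]) (use finite_kids finD in \<open>auto simp: D_def\<close>)
      also have "\<dots> \<le> card (D k v n)" by (rule card_mono[OF finD sub])
      finally have c: "(\<Sum>i\<in>kids \<sigma> k v. card (D (Suc k) i n)) \<le> card (D k v n)" .
      have "(\<Sum>i\<in>kids \<sigma> k v. ennreal (r ^ K n * card (D (Suc k) i n)))
          = ennreal (r ^ K n * real (\<Sum>i\<in>kids \<sigma> k v. card (D (Suc k) i n)))"
        using r by (subst sum_ennreal) (auto simp: sum_distrib_left)
      also have "\<dots> \<le> ennreal (r ^ K n * card (D k v n))"
        using r c by (intro ennreal_leI mult_left_mono) (auto simp del: of_nat_sum)
      finally show "(\<Sum>i\<in>kids \<sigma> k v. ennreal (r ^ K n * card (D (Suc k) i n)))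
          \<le> ennreal (r ^ K n * card (D k v n))" .
    qed auto
    finally show False using lt by simp
  qed
  have "\<exists>f. \<forall>n. (L (m + n) (f n) < R (m + n) (f n) \<and> (n = 0 \<longrightarrow> f n = j)) \<and> f (Suc n) \<in> kids \<sigma> (m + n) (f n)"
  proof (rule dependent_nat_choice[of "\<lambda>n x. L (m + n) x < R (m + n) x \<and> (n = 0 \<longrightarrow> x = j)"
          "\<lambda>n x y. y \<in> kids \<sigma> (m + n) x"])
    show "\<exists>x. L (m + 0) x < R (m + 0) x \<and> (0 = (0::nat) \<longrightarrow> x = j)" using start by simp
    show "\<exists>y. (L (m + Suc n) y < R (m + Suc n) y \<and> (Suc n = 0 \<longrightarrow> y = j)) \<and> y \<in> kids \<sigma> (m + n) x"
      if "L (m + n) x < R (m + n) x \<and> (n = 0 \<longrightarrow> x = j)" for x n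
      using step[of "m + n" x] that by auto
  qed
  then obtain f where f: "\<And>n. L (m + n) (f n) < R (m + n) (f n)" "f 0 = j"
    "\<And>n. f (Suc n) \<in> kids \<sigma> (m + n) (f n)" by blast
  define a where "a k = f (k - m)" for k
  have "a (K i) \<notin> P i" if i: "m \<le> K i" for i
  proof
    assume h: "a (K i) \<in> P i"
    have "R (K i) (a (K i)) \<le> ennreal (r ^ K i * 1)"
      unfolding R_def using r reach_lim_bounds(2)[OF r] by (intro ennreal_leI mult_left_mono) auto
    also have "\<dots> \<le> ennreal (r ^ K i * card (D (K i) (a (K i)) i))"
    proof (intro ennreal_leI mult_left_mono)
      have "a (K i) \<in> D (K i) (a (K i)) i" using h by (simp add: D_def)
      then have "card (D (K i) (a (K i)) i) > 0" using finD card_gt_0_iff by blast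
      then show "1 \<le> real (card (D (K i) (a (K i)) i))" by simp
    qed (use r in simp)
    also have "\<dots> \<le> L (K i) (a (K i))"
      unfolding L_def
      using sum_le_suminf[of "\<lambda>n. ennreal (r ^ K n * card (D (K i) (a (K i)) n))" "{i}"] by simp
    also have "\<dots> < R (K i) (a (K i))" using f(1)[of "K i - m"] i by (simp add: a_def)
    finally show False by simp
  qed
  moreover have "a (Suc k) \<in> kids \<sigma> k (a k)" if "m \<le> k" for k
    using f(3)[of "k - m"] that by (simp add: a_def Suc_diff_le)
  ultimately show ?thesis using that[of a] f(2) by (simp add: a_def)
qed

lemma ray_point:
  assumes "\<And>k. m \<le> k \<Longrightarrow> a (Suc k) \<in> kids \<sigma> k (a k)"
  obtains x where "\<And>k. m \<le> k \<Longrightarrow> x \<in> cell k (a k)"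
proof -
  define F where "F n = cell (m + n) (a (m + n))" for n
  have "F (Suc n) \<subseteq> F n" for n
  proof -
    have "a (Suc (m + n)) = 4 * a (m + n) + 1 \<or> a (Suc (m + n)) = 4 * a (m + n) + 2"
      using assms[of "m + n"] by (auto simp: kids_def)
    then show ?thesis by (auto simp: F_def cell_def field_simps)
  qed
  then have "decseq F" by (rule decseq_SucI)
  then have "\<Inter>(range F) \<noteq> {}"
    by (intro compact_nest) (auto simp: F_def cell_def decseq_def divide_right_mono)
  then obtain x where x: "\<And>n. x \<in> F n" by blast
  have "x \<in> cell k (a k)" if "m \<le> k" for k using x[of "k - m"] that by (simp add: F_def)
  then show ?thesis using that by blast
qed

lemma card_cells_meeting:
  fixes U :: "real set"
  assumes "bounded U" "diameter U \<le> 1 / 4 ^ k"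
  shows "finite {l. U \<inter> cell k l \<noteq> {}}" "card {l. U \<inter> cell k l \<noteq> {}} \<le> 3"
proof -
  let ?P = "{l. U \<inter> cell k l \<noteq> {}}"
  have close: "l' \<le> l + 2" if l: "l \<in> ?P" and l': "l' \<in> ?P" for l l'
  proof -
    obtain x y where xy: "x \<in> U" "x \<in> cell k l" "y \<in> U" "y \<in> cell k l'" using l l' by blast
    have "\<bar>y - x\<bar> \<le> 1 / 4 ^ k"
      using diameter_bounded_bound[OF assms(1) xy(3,1)] assms(2) by (simp add: dist_real_def)
    moreover have "x \<le> (real l + 1) / 4 ^ k" "real l' / 4 ^ k \<le> y" using xy by (auto simp: cell_def)
    ultimately have "real l' / 4 ^ k \<le> (real l + 1) / 4 ^ k + 1 / 4 ^ k" by linarith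
    also have "\<dots> = (real l + 2) / 4 ^ k" by (simp add: add_divide_distrib)
    finally have "real l' \<le> real l + 2" by (simp add: divide_le_cancel)
    then show ?thesis by linarith
  qed
  have "finite ?P \<and> card ?P \<le> 3"
  proof (cases "?P = {}")
    case False
    then obtain l where "l \<in> ?P" by blast
    then have L: "(LEAST l. l \<in> ?P) \<in> ?P" by (rule LeastI)
    define l0 where "l0 = (LEAST l. l \<in> ?P)"
    have "l0 \<le> l \<and> l \<le> l0 + 2" if "l \<in> ?P" for l
      using close[OF L[folded l0_def] that] Least_le[of "\<lambda>l. l \<in> ?P" l] that unfolding l0_def by blast
    then have sub: "?P \<subseteq> {l0..l0 + 2}" by (intro subsetI) (simp only: atLeastAtMost_iff)
    then have "card ?P \<le> card {l0..l0 + 2}" by (intro card_mono) auto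
    then show ?thesis using finite_subset[OF sub] by auto
  qed simp
  then show "finite ?P" "card ?P \<le> 3" by auto
qed

text \<open>A covering set of diameter \<open>d > 0\<close> is compared with cells of the scale \<open>4^-k\<close> just above \<open>d\<close>. If
\<open>d = 0\<close> there is no such scale, and a fine one of negligible weight \<open>\<eta>\<close> serves instead.\<close>

lemma cover_scale:
  assumes s: "0 < s" and d: "0 \<le> d" "d \<le> 1 / 4 ^ m" and \<eta>: "0 < (\<eta> :: real)"
  obtains k where "m \<le> k" "d \<le> 1 / 4 ^ k" "(4 powr - s) ^ k \<le> 4 powr s * d powr s + \<eta>"
proof (cases "d = 0")
  case True
  have "4 powr - s < 1" using s by (simp add: powr_less_one)
  then have "(\<lambda>k. (4 powr - s) ^ k) \<longlonglongrightarrow> 0" by (intro LIMSEQ_realpow_zero) auto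
  then have "\<forall>\<^sub>F k in sequentially. (4 powr - s) ^ k < \<eta>" using \<eta> by (rule order_tendstoD)
  then obtain N where N: "\<And>k. N \<le> k \<Longrightarrow> (4 powr - s) ^ k < \<eta>" by (auto simp: eventually_sequentially)
  show ?thesis using that[of "max m N"] N[of "max m N"] True by simp
next
  case False
  then have "0 < d" using d by simp
  have "\<exists>n. 1 / 4 ^ n < d"
    using real_arch_pow_inv[OF \<open>0 < d\<close>, of "1 / 4"] by (auto simp: power_one_over)
  define n where "n = (LEAST n. 1 / 4 ^ n < d)"
  have n: "1 / 4 ^ n < d" unfolding n_def by (rule LeastI_ex) fact
  have l: "d \<le> 1 / 4 ^ k" if "k < n" for k
    using not_less_Least[of k "\<lambda>n. 1 / 4 ^ n < d"] that unfolding n_def by (simp add: not_less)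
  have "m < n"
  proof (rule ccontr)
    assume "\<not> m < n"
    then have "(1 / 4 :: real) ^ m \<le> (1 / 4) ^ n" by (intro power_decreasing) auto
    then show False using n d by (simp add: power_one_over)
  qed
  define k where "k = n - 1"
  have k: "m \<le> k" "k < n" "n = Suc k" using \<open>m < n\<close> by (auto simp: k_def)
  have "(4 powr - s) ^ k = (1 / 4 ^ k) powr s" by (simp add: quarter_powr)
  also have "\<dots> \<le> (4 * d) powr s" using n k s by (intro powr_mono2) (auto simp: field_simps)
  also have "\<dots> = 4 powr s * d powr s" using d by (simp add: powr_mult)
  finally show ?thesis using that[of k] k l[of k] \<eta> by simp
qed

text \<open>A countable cover by small sets induces a cut: replace each set by the at most three cells of
comparable size that it meets. If the cover were too light, some infinite line would avoid the cut, and
the limit point of that line would not be covered.\<close>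

lemma hausdorff_measure_rays_nonzero:
  assumes s: "0 < s" and pos: "reach_lim (4 powr - s) \<sigma> m j > 0"
    and E: "\<And>a x. a m = j \<Longrightarrow> (\<And>k. m \<le> k \<Longrightarrow> a (Suc k) \<in> kids \<sigma> k (a k)) \<Longrightarrow>
       (\<And>k. m \<le> k \<Longrightarrow> x \<in> cell k (a k)) \<Longrightarrow> x \<in> E"
  shows "hausdorff_measure s E \<noteq> 0"
proof
  define r where "r = 4 powr - s"
  have r: "0 < r" "r \<le> 1" using s by (auto simp: r_def powr_less_one less_imp_le)
  define u where "u = r ^ m * reach_lim r \<sigma> m j"
  have u: "u > 0" using pos r by (simp add: u_def r_def)
  \<comment> \<open>With this choice the induced cut weighs at most \<open>3 (u/12 + 2 u/12) = 3u/4 < u\<close>.\<close>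
  define \<epsilon> where "\<epsilon> = u / (12 * 4 powr s)"
  have \<epsilon>: "\<epsilon> > 0" using u by (simp add: \<epsilon>_def)
  assume "hausdorff_measure s E = 0"
  then have "hausdorff_premeasure s (1 / 4 ^ m) E < ennreal \<epsilon>"
    unfolding hausdorff_measure_zero_iff using \<epsilon> by simp
  then obtain U where U: "E \<subseteq> (\<Union>i. U i)" "\<And>i. bounded (U i)" "\<And>i. diameter (U i) \<le> 1 / 4 ^ m"
    "(\<Sum>i. hausdorff_weight s (U i)) < ennreal \<epsilon>"
    unfolding hausdorff_premeasure_def INF_less_iff by blast
  have "\<exists>k. m \<le> k \<and> diameter (U i) \<le> 1 / 4 ^ k \<and> r ^ k \<le> 4 powr s * diameter (U i) powr s + u / 12 * (1 / 2) ^ i" for i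
    using cover_scale[OF s diameter_ge_0[OF U(2)] U(3), of "u / 12 * (1 / 2) ^ i"] u unfolding r_def by (metis divide_pos_pos mult_pos_pos zero_less_numeral zero_less_one zero_less_power)
  then obtain K where K: "\<And>i. m \<le> K i" "\<And>i. diameter (U i) \<le> 1 / 4 ^ K i"
    "\<And>i. r ^ K i \<le> 4 powr s * diameter (U i) powr s + u / 12 * (1 / 2) ^ i" by metis
  define P where "P i = {l. U i \<inter> cell (K i) l \<noteq> {}}" for i
  have P: "finite (P i)" "card (P i) \<le> 3" for i
    unfolding P_def using card_cells_meeting[OF U(2) K(2)] by auto
  have "(\<Sum>i. ennreal (r ^ K i * card (P i))) \<le>
      (\<Sum>i. ennreal (3 * 4 powr s) * hausdorff_weight s (U i) + ennreal (u / 4 * (1 / 2) ^ i))"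
  proof (rule suminf_le)
    fix i
    show "ennreal (r ^ K i * card (P i)) \<le> ennreal (3 * 4 powr s) * hausdorff_weight s (U i) + ennreal (u / 4 * (1 / 2) ^ i)"
    proof (cases "U i = {}")
      case False
      then have w: "hausdorff_weight s (U i) = ennreal (diameter (U i) powr s)"
        using s by (simp add: hausdorff_weight_def)
      have "r ^ K i * card (P i) \<le> (4 powr s * diameter (U i) powr s + u / 12 * (1 / 2) ^ i) * 3"
        using K(3)[of i] P(2)[of i] u r by (intro mult_mono) auto
      then have "ennreal (r ^ K i * card (P i)) \<le> ennreal (3 * 4 powr s * diameter (U i) powr s + u / 4 * (1 / 2) ^ i)"
        by (intro ennreal_leI) (simp add: algebra_simps)
      then show ?thesis using u unfolding w by (simp add: ennreal_plus ennreal_mult del: ennreal_plus[symmetric])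
    qed (simp add: P_def)
  qed auto
  also have "\<dots> = ennreal (3 * 4 powr s) * (\<Sum>i. hausdorff_weight s (U i)) + (\<Sum>i. ennreal (u / 4 * (1 / 2) ^ i))"
    by (subst suminf_add[symmetric]) auto
  also have "(\<Sum>i. ennreal (u / 4 * (1 / 2) ^ i)) = ennreal (u / 2)"
  proof -
    have "(\<lambda>i. u / 4 * (1 / 2) ^ i) sums (u / 4 * (1 / (1 - 1 / 2)))"
      by (intro sums_mult geometric_sums) auto
    then show ?thesis using u by (subst suminf_ennreal_eq) (auto simp: field_simps)
  qed
  also have "ennreal (3 * 4 powr s) * (\<Sum>i. hausdorff_weight s (U i)) + ennreal (u / 2)
      \<le> ennreal (3 * 4 powr s) * ennreal \<epsilon> + ennreal (u / 2)"
    using U(4) by (intro add_mono mult_left_mono) auto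
  also have "\<dots> = ennreal (3 * u / 4)"
  proof -
    have "3 * 4 powr s * \<epsilon> = u / 4" by (simp add: \<epsilon>_def)
    then have "ennreal (3 * 4 powr s) * ennreal \<epsilon> = ennreal (u / 4)"
      by (metis ennreal_mult'' less_imp_le \<epsilon>)
    then show ?thesis using u by (simp flip: ennreal_plus)
  qed
  also have "\<dots> < ennreal (r ^ m * reach_lim r \<sigma> m j)" using u unfolding u_def[symmetric] by (intro ennreal_lessI) auto
  finally have small: "(\<Sum>i. ennreal (r ^ K i * card (P i))) < ennreal (r ^ m * reach_lim r \<sigma> m j)" .
  obtain a where a: "a m = j" "\<And>k. m \<le> k \<Longrightarrow> a (Suc k) \<in> kids \<sigma> k (a k)"
    "\<And>i. m \<le> K i \<Longrightarrow> a (K i) \<notin> P i"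
    using ray_avoiding_cut[OF less_imp_le[OF r(1)] r(2) P(1) small] by blast
  obtain x where x: "\<And>k. m \<le> k \<Longrightarrow> x \<in> cell k (a k)" using ray_point[of m a \<sigma>] a(2) by blast
  have "x \<in> E" by (rule E[of a]) (use a x in auto)
  then obtain i where "x \<in> U i" using U(1) by blast
  then have "a (K i) \<in> P i" using x[OF K(1)] by (auto simp: P_def)
  then show False using a(3)[OF K(1)] by blast
qed

section \<open>Dimension of the maximum set\<close>

text \<open>Along the line \<open>a\<close> the grid value equals the peak at every level, and the peaks converge to the maximum.\<close>

lemma ray_in_max_set:
  assumes \<sigma>: "signs \<sigma>" and j: "a m \<in> crest \<sigma> m"
    and a: "\<And>k. m \<le> k \<Longrightarrow> a (Suc k) \<in> kids \<sigma> k (a k)" and x: "\<And>k. m \<le> k \<Longrightarrow> x \<in> cell k (a k)"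
  shows "x \<in> max_set (signed_takagi \<sigma>)"
proof -
  have c: "a k \<in> crest \<sigma> k" if "m \<le> k" for k
    using that
  proof (induction k rule: dec_induct)
    case (step k)
    have "\<sigma> (2 * k) (a k) = 1" using a[OF step(1)] by (auto simp: kids_def)
    then have "gain \<sigma> k" using gain_iff[OF \<sigma>] step by blast
    then show ?case using crest_Suc[OF \<sigma>] step a[OF step(1)] by blast
  qed (rule j)
  have ge: "2 / 4 ^ k * peak \<sigma> k - 1 / 4 ^ k \<le> signed_takagi \<sigma> x \<and> x \<in> {0..1}" if "m \<le> k" for k
  proof -
    define t where "t = 4 ^ k * x - real (a k)"
    have t: "0 \<le> t" "t \<le> 1" using x[OF that] by (auto simp: cell_def t_def field_simps)
    have xt: "x = (real (a k) + t) / 4 ^ k" by (simp add: t_def)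
    have ck: "a k < 4 ^ k" "grid \<sigma> k (a k) = peak \<sigma> k" "grid \<sigma> k (Suc (a k)) = peak \<sigma> k"
      using c[OF that] by (auto simp: crest_def)
    have "real (Suc (a k)) \<le> real (4 ^ k)" using ck(1) by (simp del: of_nat_Suc)
    then have "x \<in> {0..1}" unfolding xt using t by auto
    moreover have "(1 - t) * peak \<sigma> k + t * peak \<sigma> k = peak \<sigma> k" by (simp add: left_diff_distrib)
    ultimately show ?thesis using takagi_cell[OF \<sigma> ck(1) t] unfolding ck(2,3) xt[symmetric] by simp
  qed
  have xI: "x \<in> {0..1}" using ge[of m] by blast
  have "(\<lambda>k. 2 / 4 ^ k * peak \<sigma> k - (1 / 4) ^ k) \<longlonglongrightarrow> max_value (signed_takagi \<sigma>) - 0"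
    by (intro tendsto_diff peak_tendsto_max_value \<sigma> LIMSEQ_realpow_zero) auto
  then have "max_value (signed_takagi \<sigma>) - 0 \<le> signed_takagi \<sigma> x"
    by (rule LIMSEQ_le_const2) (use ge in \<open>auto simp: power_one_over\<close>)
  moreover have "signed_takagi \<sigma> x \<le> max_value (signed_takagi \<sigma>)"
    using max_value_attained[OF \<sigma>] xI by metis
  ultimately show ?thesis using xI by (simp add: max_set_def)
qed

text \<open>When there is a gain, the maximum is at least one unit of level \<open>k + 1\<close> above all grid values inside an
interval outside the crest. The remaining layers contribute at most half of that unit.\<close>

lemma max_set_subset_crest:
  assumes \<sigma>: "signs \<sigma>" and g: "gain \<sigma> k"
  shows "max_set (signed_takagi \<sigma>) \<subseteq> (\<Union>j\<in>crest \<sigma> k. cell k j)"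
proof
  fix x assume "x \<in> max_set (signed_takagi \<sigma>)"
  then have x: "x \<in> {0..1}" "signed_takagi \<sigma> x = max_value (signed_takagi \<sigma>)" by (auto simp: max_set_def)
  obtain i t where i0: "i < 2 ^ (2 * Suc k)" and t: "0 \<le> t" "t \<le> 1" and xi0: "x = (real i + t) / 2 ^ (2 * Suc k)"
    using dyadic_cell[OF x(1)] .
  have i: "i < 4 ^ Suc k" and xi: "x = (real i + t) / 4 ^ Suc k"
    using i0 xi0 unfolding two_pow_double by auto
  define j where "j = i div 4"
  define c where "c = i mod 4"
  have j: "j < 4 ^ k" "c < 4" "i = 4 * j + c"
    using i by (auto simp: j_def c_def less_mult_imp_div_less mult.commute)
  have "j \<in> crest \<sigma> k"
  proof (rule ccontr)
    assume nj: "j \<notin> crest \<sigma> k"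
    have gr: "grid \<sigma> (Suc k) i \<le> 4 * peak \<sigma> k" "grid \<sigma> (Suc k) (Suc i) \<le> 4 * peak \<sigma> k"
      using grid_children_le(2)[OF \<sigma> j(1) _ nj, of c] grid_children_le(2)[OF \<sigma> j(1) _ nj, of "Suc c"] j(2,3) by auto
    have "(1 - t) * grid \<sigma> (Suc k) i + t * grid \<sigma> (Suc k) (Suc i) \<le> (1 - t) * (4 * peak \<sigma> k) + t * (4 * peak \<sigma> k)"
      using t gr by (intro add_mono mult_left_mono) auto
    also have "\<dots> = peak \<sigma> (Suc k) - 1" using peak_Suc[OF \<sigma>, of k] g by (simp add: algebra_simps)
    finally have "2 / 4 ^ Suc k * ((1 - t) * grid \<sigma> (Suc k) i + t * grid \<sigma> (Suc k) (Suc i)) \<le> 2 / 4 ^ Suc k * (peak \<sigma> (Suc k) - 1)"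
      by (intro mult_left_mono) auto
    also have "\<dots> = 2 / 4 ^ Suc k * peak \<sigma> (Suc k) - 2 * (1 / 4 ^ Suc k)" by (simp add: right_diff_distrib)
    finally have "signed_takagi \<sigma> x \<le> 2 / 4 ^ Suc k * peak \<sigma> (Suc k) - 1 / 4 ^ Suc k"
      using takagi_cell[OF \<sigma> i t] unfolding xi by linarith
    moreover have "2 / 4 ^ Suc k * peak \<sigma> (Suc k) \<le> signed_takagi \<sigma> x"
      using max_value_bounds(1)[OF \<sigma>, of "Suc k"] x(2) by simp
    moreover have "1 / 4 ^ Suc k > (0::real)" by simp
    ultimately show False by linarith
  qed
  moreover have "x \<in> cell k j"
  proof -
    have "real c + t \<le> 4" using j(2) t by linarith
    moreover have "x = (real j + (real c + t) / 4) / 4 ^ k" unfolding xi j(3) by (simp add: field_simps)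
    ultimately show ?thesis using t by (simp add: cell_def divide_right_mono)
  qed
  ultimately show "x \<in> (\<Union>j\<in>crest \<sigma> k. cell k j)" by blast
qed

lemma finite_crest: "finite (crest \<sigma> m)"
  by (rule finite_subset[of _ "{..<4 ^ m}"]) (auto simp: crest_def)

lemma card_crest_le:
  assumes \<sigma>: "signs \<sigma>" and "\<And>i. m \<le> i \<Longrightarrow> gain \<sigma> i"
  shows "real (card (crest \<sigma> (m + n))) \<le> (\<Sum>j\<in>crest \<sigma> m. offspring \<sigma> n m j)"
  using assms(2)
proof (induction n arbitrary: m)
  case 0
  then show ?case by simp
next
  case (Suc n)
  have "real (card (crest \<sigma> (m + Suc n))) \<le> (\<Sum>i\<in>crest \<sigma> (Suc m). offspring \<sigma> n (Suc m) i)"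
    using Suc.IH[of "Suc m"] Suc.prems by simp
  also have "crest \<sigma> (Suc m) = (\<Union>j\<in>crest \<sigma> m. kids \<sigma> m j)"
    using crest_Suc[OF \<sigma>] Suc.prems by simp
  also have "(\<Sum>i\<in>(\<Union>j\<in>crest \<sigma> m. kids \<sigma> m j). offspring \<sigma> n (Suc m) i)
      = (\<Sum>j\<in>crest \<sigma> m. \<Sum>i\<in>kids \<sigma> m j. offspring \<sigma> n (Suc m) i)"
    by (rule sum.UNION_disjoint) (use finite_crest finite_kids in \<open>auto simp: kids_def\<close>)
  also have "\<dots> = (\<Sum>j\<in>crest \<sigma> m. offspring \<sigma> (Suc n) m j)"
  proof (rule sum.cong[OF refl])
    fix j
    have "kids \<sigma> m j = (if \<sigma> (2 * m) j = 1 then (if \<sigma> (2 * m + 1) (2 * j) = 1 then {4 * j + 1} else {}) \<union>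
      (if \<sigma> (2 * m + 1) (2 * j + 1) = 1 then {4 * j + 2} else {}) else {})"
      by (auto simp: kids_def)
    then show "(\<Sum>i\<in>kids \<sigma> m j. offspring \<sigma> n (Suc m) i) = offspring \<sigma> (Suc n) m j" by auto
  qed
  finally show ?case .
qed

text \<open>The exponents are restricted to rational ones so that, for random signs, the two hypotheses hold almost
surely for all of them simultaneously.\<close>

lemma hausdorff_dim_max_set:
  assumes \<sigma>: "signs \<sigma>" and reach: "\<exists>j\<in>crest \<sigma> m. reach_lim 1 \<sigma> m j > 0" and d: "0 < d"
    and low: "\<And>s m j. s \<in> \<rat> \<Longrightarrow> 0 < s \<Longrightarrow> s < d \<Longrightarrow> j < 4 ^ m \<Longrightarrow> reach_lim 1 \<sigma> m j > 0 \<Longrightarrow> reach_lim (4 powr - s) \<sigma> m j > 0"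
    and high: "\<And>s m j. s \<in> \<rat> \<Longrightarrow> d < s \<Longrightarrow> j < 4 ^ m \<Longrightarrow> (\<lambda>n. offspring \<sigma> n m j * (4 powr - s) ^ n) \<longlonglongrightarrow> 0"
  shows "hausdorff_dim (max_set (signed_takagi \<sigma>)) = ereal d"
proof (rule antisym)
  let ?E = "max_set (signed_takagi \<sigma>)"
  let ?S = "{ereal s | s. 0 \<le> s \<and> hausdorff_measure s ?E = 0}"
  have g: "gain \<sigma> i" if "m \<le> i" for i using gain_forever[OF \<sigma> reach that] by blast
  have up: "hausdorff_measure s ?E = 0" if s: "s \<in> \<rat>" "d < s" for s
  proof (rule hausdorff_measure_zero_if_covers[where T = "\<lambda>n. crest \<sigma> (m + n)" and m = m])
    show "0 < s" using s d by simp
    show "?E \<subseteq> (\<Union>j\<in>crest \<sigma> (m + n). cell (m + n) j)" for n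
      by (rule max_set_subset_crest[OF \<sigma> g]) simp
    have "(\<lambda>n. \<Sum>j\<in>crest \<sigma> m. offspring \<sigma> n m j * (4 powr - s) ^ n) \<longlonglongrightarrow> (\<Sum>j\<in>crest \<sigma> m. 0)"
      by (intro tendsto_sum high s) (auto simp: crest_def)
    then have l: "(\<lambda>n. (\<Sum>j\<in>crest \<sigma> m. offspring \<sigma> n m j) * (4 powr - s) ^ n) \<longlonglongrightarrow> 0"
      by (simp add: sum_distrib_right)
    show "(\<lambda>n. real (card (crest \<sigma> (m + n))) * (4 powr - s) ^ n) \<longlonglongrightarrow> 0"
      by (rule tendsto_sandwich[OF _ _ tendsto_const l])
        (auto intro!: always_eventually mult_right_mono card_crest_le[OF \<sigma> g])
  qed (rule finite_crest)
  show "hausdorff_dim ?E \<le> ereal d"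
  proof (rule dense_ge)
    fix z assume "ereal d < z"
    then obtain y where y: "ereal d < ereal y" "ereal y < z" using ereal_dense2 by blast
    then obtain s where s: "s \<in> \<rat>" "d < s" "s < y" using Rats_dense_in_real[of d y] by auto
    have "hausdorff_dim ?E \<le> ereal s"
      unfolding hausdorff_dim_def by (rule Inf_lower) (use up[OF s(1,2)] s d in auto)
    also have "\<dots> \<le> ereal y" using s by simp
    finally show "hausdorff_dim ?E \<le> z" using y(2) by simp
  qed
  obtain j where j: "j \<in> crest \<sigma> m" "reach_lim 1 \<sigma> m j > 0" using reach by blast
  have "d \<le> s" if s: "0 \<le> s" "hausdorff_measure s ?E = 0" for s
  proof (rule ccontr)
    assume "\<not> d \<le> s"
    then obtain s' where s': "s' \<in> \<rat>" "s < s'" "s' < d" using Rats_dense_in_real[of s d] by auto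
    have "reach_lim (4 powr - s') \<sigma> m j > 0" using low s' s j by (auto simp: crest_def)
    then have "hausdorff_measure s' ?E \<noteq> 0"
    proof (rule hausdorff_measure_rays_nonzero[rotated])
      show "x \<in> ?E" if "a m = j" "\<And>k. m \<le> k \<Longrightarrow> a (Suc k) \<in> kids \<sigma> k (a k)"
        "\<And>k. m \<le> k \<Longrightarrow> x \<in> cell k (a k)" for a x
        by (rule ray_in_max_set[OF \<sigma> _ that(2,3)]) (use that(1) j in auto)
    qed (use s s' in simp)
    then show False using hausdorff_measure_zero_mono[OF s(1) s'(2) s(2)] by blast
  qed
  then show "ereal d \<le> hausdorff_dim ?E"
    unfolding hausdorff_dim_def by (intro Inf_greatest) auto
qed

section \<open>Independence of subtrees\<close>

text \<open>Indices of the signs in the \<open>j\<close>-th dyadic interval of length \<open>2^-n\<close>, that interval included. Here levels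
count halvings, whereas the grid and the crest are indexed by quarterings.\<close>

definition subtree :: "nat \<Rightarrow> nat \<Rightarrow> (nat \<times> nat) set" where
  "subtree n j = {(k, i). n \<le> k \<and> i < 2 ^ k \<and> i div 2 ^ (k - n) = j}"

definition before :: "nat \<Rightarrow> (nat \<times> nat) set" where
  "before n = {(k, i). k < n \<and> i < 2 ^ k}"

lemma subtree_root: "j < 2 ^ n \<Longrightarrow> (n, j) \<in> subtree n j"
  by (simp add: subtree_def)

lemma subtree_child: "c < 2 \<Longrightarrow> subtree (Suc n) (2 * j + c) \<subseteq> subtree n j"
proof (clarsimp simp: subtree_def)
  fix k i :: nat assume "c < 2" "Suc n \<le> k" "i div 2 ^ (k - Suc n) = 2 * j + c"
  moreover from this have "k - n = Suc (k - Suc n)" by simp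
  moreover from calculation have "i div 2 ^ (k - n) = (i div 2 ^ (k - Suc n)) div 2"
    by (simp only: power_Suc2 div_mult2_eq)
  ultimately show "i div 2 ^ (k - n) = j" by simp
qed

lemma subtree_child0: "subtree (Suc n) (2 * j) \<subseteq> subtree n j"
  and subtree_child1: "subtree (Suc n) (2 * j + 1) \<subseteq> subtree n j"
  using subtree_child[of 0 n j] subtree_child[of 1 n j] by simp_all

lemma subtree_disjoint: "j \<noteq> j' \<Longrightarrow> subtree n j \<inter> subtree n j' = {}"
  by (auto simp: subtree_def)

lemma root_notin_subtree: "n < k \<Longrightarrow> (n, i) \<notin> subtree k j"
  by (simp add: subtree_def)

lemma before_subtree_disjoint: "before n \<inter> subtree n j = {}"
  by (auto simp: before_def subtree_def)

lemma before_mono: "n \<le> n' \<Longrightarrow> before n \<subseteq> before n'"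
  by (auto simp: before_def)

definition nodes :: "(nat \<times> nat) set" where
  "nodes = {(n, j). j < 2 ^ n}"

lemma subtree_nodes: "subtree n j \<subseteq> nodes" and before_nodes: "before n \<subseteq> nodes"
  by (auto simp: subtree_def before_def nodes_def)


text \<open>The signs take no values other than \<open>1\<close> and \<open>-1\<close> by the choice of target space in the independence
assumption.\<close>

locale random_signs = prob_space M for M :: "'a measure" +
  fixes p :: real and \<omega> :: "nat \<Rightarrow> nat \<Rightarrow> 'a \<Rightarrow> real"
  assumes p_pos: "0 < p" and p_less: "p < 1"
    and indep: "indep_vars (\<lambda>_. count_space {-1, 1}) (\<lambda>(n, j). \<omega> n j) {(n, j). j < 2 ^ n}"
    and prob_plus: "\<And>n j. j < 2 ^ n \<Longrightarrow> prob {w \<in> space M. \<omega> n j w = 1} = p"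
begin

definition plus :: "nat \<times> nat \<Rightarrow> 'a set" where
  "plus = (\<lambda>(n, j). {w \<in> space M. \<omega> n j w = 1})"

text \<open>The information contained in the signs with indices in \<open>K\<close>.\<close>

definition sig :: "(nat \<times> nat) set \<Rightarrow> 'a measure" where
  "sig K = sigma (space M) (plus ` K)"

definition sample :: "'a \<Rightarrow> nat \<Rightarrow> nat \<Rightarrow> real" where
  "sample w n j = \<omega> n j w"

lemma \<omega>_measurable: "j < 2 ^ n \<Longrightarrow> \<omega> n j \<in> measurable M (count_space {-1, 1})"
  using indep unfolding indep_vars_def by auto

lemma signs_sample: "w \<in> space M \<Longrightarrow> signs (sample w)"
  using measurable_space[OF \<omega>_measurable] by (auto simp: signs_def sample_def)

lemma plus_vimage: "i \<in> nodes \<Longrightarrow> plus i = (case i of (n, j) \<Rightarrow> \<omega> n j) -` {1} \<inter> space M"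
  by (auto simp: plus_def)

lemma space_sig [simp]: "space (sig K) = space M"
  by (simp add: sig_def space_measure_of_conv)

lemma sets_sig: "sets (sig K) = sigma_sets (space M) (plus ` K)"
  unfolding sig_def by (rule sets_measure_of) (auto simp: plus_def)

lemma plus_sig: "i \<in> K \<Longrightarrow> plus i \<in> sets (sig K)"
  by (auto simp: sets_sig)

lemma plus_events: "i \<in> nodes \<Longrightarrow> plus i \<in> events"
proof -
  assume "i \<in> nodes"
  then obtain n j where i: "i = (n, j)" "j < 2 ^ n" by (auto simp: nodes_def)
  have "\<omega> n j -` {1} \<inter> space M \<in> events"
    by (rule measurable_sets[OF \<omega>_measurable[OF i(2)]]) simp
  then show ?thesis using plus_vimage[OF \<open>i \<in> nodes\<close>] i by simp
qed

lemma subalgebra_sig: "K \<subseteq> nodes \<Longrightarrow> subalgebra M (sig K)"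
  unfolding subalgebra_def sets_sig
  by (auto intro!: sets.sigma_sets_subset plus_events)

lemma subalgebra_sig_mono: "K \<subseteq> L \<Longrightarrow> subalgebra (sig L) (sig K)"
  unfolding subalgebra_def by (auto simp: sets_sig intro!: sigma_sets_mono')

lemma sig_mono: "K \<subseteq> L \<Longrightarrow> f \<in> borel_measurable (sig K) \<Longrightarrow> f \<in> borel_measurable (sig L)"
  by (rule measurable_from_subalg[OF subalgebra_sig_mono])

lemma sig_M: "K \<subseteq> nodes \<Longrightarrow> f \<in> borel_measurable (sig K) \<Longrightarrow> f \<in> borel_measurable M"
  by (rule measurable_from_subalg[OF subalgebra_sig])

lemma sig_events: "K \<subseteq> nodes \<Longrightarrow> A \<in> sets (sig K) \<Longrightarrow> A \<in> events"
  using subalgebra_sig by (auto simp: subalgebra_def)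

lemma prob_Int_sig:
  assumes "K \<subseteq> nodes" "L \<subseteq> nodes" "K \<inter> L = {}" "A \<in> sets (sig K)" "B \<in> sets (sig L)"
  shows "prob (A \<inter> B) = prob A * prob B"
proof -
  let ?X = "\<lambda>(n, j). \<omega> n j"
  let ?E = "\<lambda>i. {?X i -` S \<inter> space M | S. S \<in> sets (count_space {-1, 1 :: real})}"
  have "indep_sets ?E {(n, j). j < 2 ^ n}"
    using indep unfolding indep_vars_def2 by simp
  then have "indep_sets ?E (\<Union>b\<in>UNIV. case_bool K L b)"
    by (rule indep_sets_mono_index[rotated]) (use assms(1,2) in \<open>auto simp: UNIV_bool nodes_def\<close>)
  then have "indep_sets (\<lambda>b. sigma_sets (space M) (\<Union>i\<in>case_bool K L b. ?E i)) UNIV"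
  proof (rule indep_sets_collect_sigma)
    show "Int_stable (?E i)" for i
      unfolding Int_stable_def
    proof (intro ballI)
      fix a b assume "a \<in> ?E i" "b \<in> ?E i"
      then obtain S T where "a = ?X i -` S \<inter> space M" "b = ?X i -` T \<inter> space M"
        "S \<in> sets (count_space {-1, 1})" "T \<in> sets (count_space {-1, 1})" by blast
      then show "a \<inter> b \<in> ?E i"
        by (intro CollectI exI[of _ "S \<inter> T"]) (auto intro: sets.Int)
    qed
    show "disjoint_family_on (case_bool K L) UNIV"
      using assms(3) by (auto simp: disjoint_family_on_def split: bool.splits)
  qed
  from indep_setsD[OF this, of UNIV "case_bool A B"] show ?thesis
  proof -
    have g: "plus ` N \<subseteq> (\<Union>i\<in>N. ?E i)" if "N \<subseteq> nodes" for N
    proof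
      fix a assume "a \<in> plus ` N"
      then obtain i where i: "i \<in> N" "a = plus i" by blast
      have "i \<in> nodes" using i(1) that by blast
      then have "a = ?X i -` {1} \<inter> space M" using plus_vimage i(2) by (simp only:)
      then have "a \<in> ?E i" by (intro CollectI exI[of _ "{1}"]) auto
      then show "a \<in> (\<Union>i\<in>N. ?E i)" using i by blast
    qed
    have "A \<in> sigma_sets (space M) (\<Union>i\<in>K. ?E i)" "B \<in> sigma_sets (space M) (\<Union>i\<in>L. ?E i)"
      using sigma_sets_mono'[OF g[OF assms(1)]] sigma_sets_mono'[OF g[OF assms(2)]] assms(4,5)
      by (auto simp: sets_sig)
    then have "prob (\<Inter>j\<in>UNIV. case_bool A B j) = (\<Prod>j\<in>UNIV. prob (case_bool A B j))"
      by (intro indep_setsD[OF \<open>indep_sets (\<lambda>b. sigma_sets (space M) (\<Union>i\<in>case_bool K L b. ?E i)) UNIV\<close>])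
        (auto split: bool.splits)
    then show ?thesis by (simp add: UNIV_bool ac_simps)
  qed
qed

lemma expectation_mult_sig:
  fixes f g :: "'a \<Rightarrow> real"
  assumes KL: "K \<subseteq> nodes" "L \<subseteq> nodes" "K \<inter> L = {}"
    and f: "f \<in> borel_measurable (sig K)" "integrable M f"
    and g: "g \<in> borel_measurable (sig L)" "integrable M g"
  shows "expectation (\<lambda>w. f w * g w) = expectation f * expectation g"
    and "integrable M (\<lambda>w. f w * g w)"
proof -
  have sub: "sigma_sets (space M) {h -` A \<inter> space M | A. A \<in> sets borel} \<subseteq> sets (sig N)"
    if "h \<in> borel_measurable (sig N)" for h :: "'a \<Rightarrow> real" and N
  proof -
    have "{h -` A \<inter> space M | A. A \<in> sets borel} \<subseteq> sets (sig N)"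
      using measurable_sets[OF that] by auto
    then show ?thesis using sets.sigma_sets_subset[of _ "sig N"] by simp
  qed
  have "indep_var borel f borel g"
    unfolding indep_var_eq indep_sets2_eq
    using sub[OF f(1)] sub[OF g(1)] prob_Int_sig[OF KL] f g sig_events KL
    by (auto intro: sig_M)
  then show "expectation (\<lambda>w. f w * g w) = expectation f * expectation g"
    "integrable M (\<lambda>w. f w * g w)"
    using indep_var_lebesgue_integral indep_var_integrable f(2) g(2) by blast+
qed

definition up :: "nat \<Rightarrow> nat \<Rightarrow> 'a \<Rightarrow> real" where
  "up n j w = of_bool (\<omega> n j w = 1)"

lemma up_measurable: "(n, j) \<in> K \<Longrightarrow> up n j \<in> borel_measurable (sig K)"
proof -
  assume "(n, j) \<in> K"
  then have "plus (n, j) \<in> sets (sig K)" by (rule plus_sig)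
  then have "indicator (plus (n, j)) \<in> borel_measurable (sig K)" by simp
  then show ?thesis
    by (rule measurable_cong[THEN iffD1, rotated]) (auto simp: plus_def up_def indicator_def)
qed

lemma integrable_bounded:
  assumes "f \<in> borel_measurable M" "\<And>w. w \<in> space M \<Longrightarrow> 0 \<le> f w" "\<And>w. w \<in> space M \<Longrightarrow> f w \<le> (B :: real)"
  shows "integrable M f"
  by (rule integrable_const_bound[of _ B]) (use assms in \<open>auto intro!: AE_I2\<close>)

lemma integrable_indicator_events: "A \<in> events \<Longrightarrow> integrable M (indicator A :: 'a \<Rightarrow> real)"
  by (rule integrable_bounded[of _ 1]) auto

lemma expectation_up: "j < 2 ^ n \<Longrightarrow> expectation (up n j) = p"
proof -
  assume j: "j < 2 ^ n"
  have "expectation (up n j) = expectation (indicator (plus (n, j)))"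
    by (rule Bochner_Integration.integral_cong) (auto simp: up_def plus_def indicator_def)
  also have "\<dots> = prob (plus (n, j))"
    using plus_events[of "(n, j)"] j by (simp add: nodes_def)
  finally show ?thesis using prob_plus[OF j] by (simp add: plus_def)
qed

lemma up_integrable: "j < 2 ^ n \<Longrightarrow> integrable M (up n j)"
  by (rule integrable_bounded[of _ 1])
    (auto simp: up_def nodes_def intro!: sig_M[of nodes] up_measurable)

lemma up_mult:
  fixes a :: "'a \<Rightarrow> real"
  assumes "j < 2 ^ n" "K \<subseteq> nodes" "(n, j) \<notin> K" "a \<in> borel_measurable (sig K)" "integrable M a"
  shows "expectation (\<lambda>w. up n j w * a w) = p * expectation a" "integrable M (\<lambda>w. up n j w * a w)"
  using expectation_mult_sig[of "{(n, j)}" K "up n j" a] assms up_integrable expectation_up up_measurable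
  by (auto simp: nodes_def)

section \<open>Recursions for expectations\<close>

lemma block_nodes:
  fixes j :: nat
  assumes "j < 4 ^ m"
  shows "j < 2 ^ (2 * m)" "2 * j < 2 ^ (2 * m + 1)" "2 * j + 1 < 2 ^ (2 * m + 1)"
    "4 * j + 1 < 4 ^ Suc m" "4 * j + 2 < 4 ^ Suc m"
  using assms by (simp_all add: power_mult)

lemma block_subtrees:
  "subtree (2 * Suc m) (4 * j + 1) \<subseteq> subtree (2 * m + 1) (2 * j)"
  "subtree (2 * Suc m) (4 * j + 2) \<subseteq> subtree (2 * m + 1) (2 * j + 1)"
  using subtree_child1[of "2 * m + 1" "2 * j"] subtree_child0[of "2 * m + 1" "2 * j + 1"] by simp_all

context
  fixes m j :: nat and a b :: "'a \<Rightarrow> real"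
  assumes j: "j < 4 ^ m"
    and a: "a \<in> borel_measurable (sig (subtree (2 * Suc m) (4 * j + 1)))" "integrable M a"
    and b: "b \<in> borel_measurable (sig (subtree (2 * Suc m) (4 * j + 2)))" "integrable M b"
begin

lemma block_up_mult:
  "(\<lambda>w. up (2 * m + 1) (2 * j) w * a w) \<in> borel_measurable (sig (subtree (2 * m + 1) (2 * j)))"
  "expectation (\<lambda>w. up (2 * m + 1) (2 * j) w * a w) = p * expectation a"
  "integrable M (\<lambda>w. up (2 * m + 1) (2 * j) w * a w)"
  "(\<lambda>w. up (2 * m + 1) (2 * j + 1) w * b w) \<in> borel_measurable (sig (subtree (2 * m + 1) (2 * j + 1)))"
  "expectation (\<lambda>w. up (2 * m + 1) (2 * j + 1) w * b w) = p * expectation b"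
  "integrable M (\<lambda>w. up (2 * m + 1) (2 * j + 1) w * b w)"
proof -
  note n = block_nodes[OF j]
  show "(\<lambda>w. up (2 * m + 1) (2 * j) w * a w) \<in> borel_measurable (sig (subtree (2 * m + 1) (2 * j)))"
    by (intro borel_measurable_times up_measurable subtree_root n sig_mono[OF block_subtrees(1)] a)
  show "(\<lambda>w. up (2 * m + 1) (2 * j + 1) w * b w) \<in> borel_measurable (sig (subtree (2 * m + 1) (2 * j + 1)))"
    by (intro borel_measurable_times up_measurable subtree_root n sig_mono[OF block_subtrees(2)] b)
  show "expectation (\<lambda>w. up (2 * m + 1) (2 * j) w * a w) = p * expectation a"
    "integrable M (\<lambda>w. up (2 * m + 1) (2 * j) w * a w)"
    by (rule up_mult[OF n(2) subtree_nodes root_notin_subtree a]; simp)+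
  show "expectation (\<lambda>w. up (2 * m + 1) (2 * j + 1) w * b w) = p * expectation b"
    "integrable M (\<lambda>w. up (2 * m + 1) (2 * j + 1) w * b w)"
    by (rule up_mult[OF n(3) subtree_nodes root_notin_subtree b]; simp)+
qed

lemma block_sum:
  "expectation (\<lambda>w. up (2 * m) j w * (up (2 * m + 1) (2 * j) w * a w + up (2 * m + 1) (2 * j + 1) w * b w))
    = p * (p * expectation a + p * expectation b)"
  "integrable M (\<lambda>w. up (2 * m) j w * (up (2 * m + 1) (2 * j) w * a w + up (2 * m + 1) (2 * j + 1) w * b w))"
  "(\<lambda>w. up (2 * m) j w * (up (2 * m + 1) (2 * j) w * a w + up (2 * m + 1) (2 * j + 1) w * b w))
    \<in> borel_measurable (sig (subtree (2 * m) j))"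
proof -
  note n = block_nodes[OF j] and u = block_up_mult
  let ?K = "subtree (2 * m + 1) (2 * j) \<union> subtree (2 * m + 1) (2 * j + 1)"
  let ?s = "\<lambda>w. up (2 * m + 1) (2 * j) w * a w + up (2 * m + 1) (2 * j + 1) w * b w"
  have s: "?s \<in> borel_measurable (sig ?K)"
    by (intro borel_measurable_add sig_mono[OF _ u(1)] sig_mono[OF _ u(4)]) auto
  have i: "integrable M ?s" using u by simp
  have K: "?K \<subseteq> nodes" "(2 * m, j) \<notin> ?K" "?K \<subseteq> subtree (2 * m) j"
    using subtree_nodes root_notin_subtree subtree_child0[of "2 * m" j] subtree_child1[of "2 * m" j] by auto
  show "expectation (\<lambda>w. up (2 * m) j w * ?s w) = p * (p * expectation a + p * expectation b)"
    using up_mult(1)[OF n(1) K(1,2) s i] u by simp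
  show "integrable M (\<lambda>w. up (2 * m) j w * ?s w)" by (rule up_mult(2)[OF n(1) K(1,2) s i])
  show "(\<lambda>w. up (2 * m) j w * ?s w) \<in> borel_measurable (sig (subtree (2 * m) j))"
    by (intro borel_measurable_times up_measurable subtree_root n sig_mono[OF K(3) s])
qed

text \<open>One step of the branching recursion for expectations: the sign of an interval, and its two halves with
everything below them, are independent.\<close>

lemma block_prod:
  fixes r :: real
  shows "expectation (\<lambda>w. up (2 * m) j w * (1 - (1 - r * (up (2 * m + 1) (2 * j) w * a w))
       * (1 - r * (up (2 * m + 1) (2 * j + 1) w * b w))))
    = p * (1 - (1 - r * (p * expectation a)) * (1 - r * (p * expectation b)))" (is ?E)
    and "(\<lambda>w. up (2 * m) j w * (1 - (1 - r * (up (2 * m + 1) (2 * j) w * a w))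
       * (1 - r * (up (2 * m + 1) (2 * j + 1) w * b w))))
    \<in> borel_measurable (sig (subtree (2 * m) j))" (is ?B)
proof -
  note n = block_nodes[OF j] and u = block_up_mult
  let ?L = "subtree (2 * m + 1) (2 * j)" and ?R = "subtree (2 * m + 1) (2 * j + 1)"
  let ?x = "\<lambda>w. 1 - r * (up (2 * m + 1) (2 * j) w * a w)"
  let ?y = "\<lambda>w. 1 - r * (up (2 * m + 1) (2 * j + 1) w * b w)"
  have x: "?x \<in> borel_measurable (sig ?L)" "integrable M ?x" "expectation ?x = 1 - r * (p * expectation a)"
    using u by (auto simp: prob_space intro!: borel_measurable_diff borel_measurable_times)
  have y: "?y \<in> borel_measurable (sig ?R)" "integrable M ?y" "expectation ?y = 1 - r * (p * expectation b)"
    using u by (auto simp: prob_space intro!: borel_measurable_diff borel_measurable_times)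
  have d: "?L \<inter> ?R = {}" by (rule subtree_disjoint) simp
  note e = expectation_mult_sig[OF subtree_nodes subtree_nodes d x(1,2) y(1,2)]
  let ?s = "\<lambda>w. 1 - ?x w * ?y w"
  have s: "?s \<in> borel_measurable (sig (?L \<union> ?R))"
    by (intro borel_measurable_diff borel_measurable_times borel_measurable_const
          sig_mono[OF _ x(1)] sig_mono[OF _ y(1)]) auto
  have i: "integrable M ?s" using e(2) by simp
  have K: "?L \<union> ?R \<subseteq> nodes" "(2 * m, j) \<notin> ?L \<union> ?R" "?L \<union> ?R \<subseteq> subtree (2 * m) j"
    using subtree_nodes root_notin_subtree subtree_child0[of "2 * m" j] subtree_child1[of "2 * m" j] by auto
  have "expectation ?s = 1 - (1 - r * (p * expectation a)) * (1 - r * (p * expectation b))"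
    using e x(3) y(3) by (simp add: prob_space)
  then show ?E using up_mult(1)[OF n(1) K(1,2) s i] by simp
  show ?B
    by (intro borel_measurable_times[of "up (2 * m) j"] up_measurable subtree_root n sig_mono[OF K(3) s])
qed

end

lemma reach_sample:
  "reach r (sample w) (Suc n) m j = up (2 * m) j w * (1 -
     (1 - r * (up (2 * m + 1) (2 * j) w * reach r (sample w) n (Suc m) (4 * j + 1))) *
     (1 - r * (up (2 * m + 1) (2 * j + 1) w * reach r (sample w) n (Suc m) (4 * j + 2))))"
  by (simp add: up_def sample_def)

section \<open>Survival probabilities\<close>

text \<open>The common value of the expectation of \<open>reach r\<close> for generation \<open>n\<close>, at all intervals.\<close>

fun mean_reach :: "real \<Rightarrow> nat \<Rightarrow> real" where
  "mean_reach r 0 = 1"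
| "mean_reach r (Suc n) = p * (1 - (1 - r * (p * mean_reach r n)) ^ 2)"

lemma reach_expectation:
  assumes "0 \<le> r" "r \<le> 1" "j < 4 ^ m"
  shows "(\<lambda>w. reach r (sample w) n m j) \<in> borel_measurable (sig (subtree (2 * m) j))"
    and "integrable M (\<lambda>w. reach r (sample w) n m j)"
    and "expectation (\<lambda>w. reach r (sample w) n m j) = mean_reach r n"
proof -
  have i: "integrable M (\<lambda>w. reach r (sample w) n m j)"
    if "(\<lambda>w. reach r (sample w) n m j) \<in> borel_measurable (sig (subtree (2 * m) j))" for n m j
    by (rule integrable_bounded[OF sig_M[OF subtree_nodes that]]) (use reach_bounds[OF assms(1,2)] in auto)
  have "(\<lambda>w. reach r (sample w) n m j) \<in> borel_measurable (sig (subtree (2 * m) j)) \<and>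
     expectation (\<lambda>w. reach r (sample w) n m j) = mean_reach r n"
    using assms(3)
  proof (induction n arbitrary: m j)
    case 0
    then show ?case by (simp add: prob_space)
  next
    case (Suc n)
    note k = block_nodes(4,5)[OF Suc.prems]
    note a = Suc.IH[OF k(1)] and b = Suc.IH[OF k(2)]
    note B = block_prod[OF Suc.prems a[THEN conjunct1] i[OF a[THEN conjunct1]]
        b[THEN conjunct1] i[OF b[THEN conjunct1]], of r]
    show ?case
      unfolding reach_sample mean_reach.simps power2_eq_square
      using B[unfolded a[THEN conjunct2] b[THEN conjunct2]] by (rule conjI[rotated])
  qed
  then show "(\<lambda>w. reach r (sample w) n m j) \<in> borel_measurable (sig (subtree (2 * m) j))"
    "integrable M (\<lambda>w. reach r (sample w) n m j)"
    "expectation (\<lambda>w. reach r (sample w) n m j) = mean_reach r n"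
    using i by (blast, blast, blast)
qed

lemma reach_lim_measurable:
  assumes "0 \<le> r" "r \<le> 1" "j < 4 ^ m"
  shows "(\<lambda>w. reach_lim r (sample w) m j) \<in> borel_measurable (sig (subtree (2 * m) j))"
  by (rule borel_measurable_LIMSEQ_real[OF reach_tendsto[OF assms(1,2)] reach_expectation(1)[OF assms]])

lemma reach_lim_expectation:
  assumes "0 \<le> r" "r \<le> 1" "j < 4 ^ m"
  shows "mean_reach r \<longlonglongrightarrow> expectation (\<lambda>w. reach_lim r (sample w) m j)"
    and "integrable M (\<lambda>w. reach_lim r (sample w) m j)"
proof -
  have m: "(\<lambda>w. reach r (sample w) n m j) \<in> borel_measurable M" for n
    using reach_expectation(2)[OF assms] by auto
  have "(\<lambda>n. expectation (\<lambda>w. reach r (sample w) n m j)) \<longlonglongrightarrow> expectation (\<lambda>w. reach_lim r (sample w) m j)"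
    by (rule integral_dominated_convergence[where w = "\<lambda>_. 1"])
      (use m reach_tendsto[OF assms(1,2)] reach_bounds[OF assms(1,2)] sig_M[OF subtree_nodes reach_lim_measurable[OF assms]]
        in \<open>auto intro!: AE_I2\<close>)
  then show "mean_reach r \<longlonglongrightarrow> expectation (\<lambda>w. reach_lim r (sample w) m j)"
    using reach_expectation(3)[OF assms] by simp
  show "integrable M (\<lambda>w. reach_lim r (sample w) m j)"
    by (rule integrable_bounded[OF sig_M[OF subtree_nodes reach_lim_measurable[OF assms]]])
      (use reach_lim_bounds[OF assms(1,2)] in auto)
qed

text \<open>Survival probability of the branching process.\<close>

definition q :: real where
  "q = max ((2 * p\<^sup>2 - 1) / p ^ 3) 0"

lemma offspring_mono:
  fixes x y x' y' :: real
  assumes "0 \<le> x" "x \<le> x'" "x' \<le> 1" "0 \<le> y" "y \<le> y'" "y' \<le> 1"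
  shows "p * (1 - (1 - p * x) * (1 - p * y)) \<le> p * (1 - (1 - p * x') * (1 - p * y'))"
proof (intro mult_left_mono branch_mono(1))
  show "p * x' \<le> 1" "p * y' \<le> 1" using p_pos p_less assms by (auto intro: mult_le_one)
qed (use p_pos assms in \<open>auto intro: mult_left_mono\<close>)

lemma mean_reach_bounds: "0 \<le> r \<Longrightarrow> r \<le> 1 \<Longrightarrow> 0 \<le> mean_reach r n \<and> mean_reach r n \<le> 1"
proof -
  assume r: "0 \<le> r" "r \<le> 1"
  have "expectation (\<lambda>w. reach r (sample w) n 0 0) \<le> expectation (\<lambda>_. 1)"
    by (rule integral_mono) (use reach_bounds[OF r] reach_expectation(2)[OF r, of 0 0 n] in auto)
  moreover have "0 \<le> expectation (\<lambda>w. reach r (sample w) n 0 0)"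
    using reach_bounds[OF r] by simp
  ultimately
  show ?thesis using reach_expectation(3)[OF r, of 0 0] by (simp add: prob_space)
qed

text \<open>The function \<open>a \<mapsto> p (1 - (1 - p a)\<^sup>2)\<close> exceeds \<open>a\<close> strictly between \<open>0\<close> and \<open>q\<close>.\<close>

lemma fixpoint_cases:
  assumes "0 \<le> a" "p * (1 - (1 - p * a)\<^sup>2) \<le> a"
  shows "a = 0 \<or> q \<le> a"
proof (cases "a = 0")
  case False
  have "(2 * p\<^sup>2 - p ^ 3 * a) * a \<le> 1 * a"
    using assms(2) by (simp add: algebra_simps power2_eq_square power3_eq_cube)
  then have "2 * p\<^sup>2 - p ^ 3 * a \<le> 1" using False assms(1) by (simp only: mult_le_cancel_right)
  then have "(2 * p\<^sup>2 - 1) / p ^ 3 \<le> a"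
    using p_pos by (simp add: pos_divide_le_eq mult.commute)
  then show ?thesis using assms(1) by (simp add: q_def)
qed simp

lemma mean_reach_ge:
  assumes r: "0 < r" "r \<le> 1" and c: "0 \<le> c" "c \<le> 1" "c \<le> p * (1 - (1 - r * (p * c))\<^sup>2)"
  shows "c \<le> mean_reach r n"
proof (induction n)
  case (Suc n)
  have "p * (1 - (1 - p * (r * c)) * (1 - p * (r * c)))
     \<le> p * (1 - (1 - p * (r * mean_reach r n)) * (1 - p * (r * mean_reach r n)))"
    using r c mean_reach_bounds[of r n] Suc by (intro offspring_mono) (auto intro: mult_le_one mult_left_mono)
  then show ?case using c(3) by (simp add: power2_eq_square mult_ac)
qed (use c in simp)

lemma q_bounds: "0 \<le> q" "q \<le> 1" "p * (1 - (1 - p * q)\<^sup>2) = q"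
proof -
  show "0 \<le> q" by (simp add: q_def)
  have "p * p \<le> p * 1" using p_pos p_less by (intro mult_left_mono) auto
  \<comment> \<open>The product is \<open>p^3 - 2p\<^sup>2 + 1\<close>, so this says \<open>q \<le> 1\<close>.\<close>
  have "(p - 1) * (p\<^sup>2 - p - 1) \<ge> 0"
    using p_less \<open>p * p \<le> p * 1\<close> unfolding power2_eq_square
    by (intro mult_nonpos_nonpos) linarith+
  then have "2 * p\<^sup>2 - 1 \<le> p ^ 3" by (simp add: algebra_simps power2_eq_square power3_eq_cube)
  then show "q \<le> 1" using p_pos by (simp add: q_def pos_divide_le_eq)
  show "p * (1 - (1 - p * q)\<^sup>2) = q"
  proof (cases "q = 0")
    case False
    then have "q = (2 * p\<^sup>2 - 1) / p ^ 3" by (auto simp: q_def max_def split: if_splits)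
    then have "p ^ 3 * q = 2 * p\<^sup>2 - 1" using p_pos by simp
    then have "q * (2 * p\<^sup>2 - p ^ 3 * q) = q" by simp
    then show ?thesis by (simp add: algebra_simps power2_eq_square power3_eq_cube)
  qed simp
qed

text \<open>The iterates start at \<open>1 \<ge> q\<close>, stay above the fixed point \<open>q\<close> by monotonicity, and
their limit is itself a fixed point; \<open>q\<close> is the largest one.\<close>

lemma mean_reach_1_limit: "mean_reach 1 \<longlonglongrightarrow> q"
proof -
  define a where "a = expectation (\<lambda>w. reach_lim 1 (sample w) 0 0)"
  have l: "mean_reach 1 \<longlonglongrightarrow> a" unfolding a_def by (rule reach_lim_expectation) auto
  have "(\<lambda>n. mean_reach 1 (Suc n)) \<longlonglongrightarrow> p * (1 - (1 - 1 * (p * a)) ^ 2)"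
    unfolding mean_reach.simps by (intro tendsto_intros l)
  then have fp: "p * (1 - (1 - p * a)\<^sup>2) = a" using LIMSEQ_Suc[OF l] LIMSEQ_unique by fastforce
  have a: "0 \<le> a" using l mean_reach_bounds[of 1] by (intro LIMSEQ_le_const[OF l]) auto
  have "q \<le> mean_reach 1 n" for n
    by (rule mean_reach_ge) (use q_bounds in \<open>auto simp: mult_ac\<close>)
  then have "q \<le> a" by (intro LIMSEQ_le_const[OF l]) auto
  moreover have "a \<le> q"
  proof (cases "a = 0")
    case False
    have "(2 * p\<^sup>2 - p ^ 3 * a) * a = 1 * a"
      using fp by (simp add: algebra_simps power2_eq_square power3_eq_cube)
    then have "2 * p\<^sup>2 - p ^ 3 * a = 1" using False by (simp only: mult_cancel_right) simp
    then have "a = (2 * p\<^sup>2 - 1) / p ^ 3" using p_pos by (simp add: field_simps)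
    then show ?thesis by (simp add: q_def)
  qed (simp add: q_bounds)
  ultimately show ?thesis using l by simp
qed

lemma reach_lim_pos_measurable:
  assumes "0 \<le> r" "r \<le> 1" "j < 4 ^ m"
  shows "{w \<in> space M. reach_lim r (sample w) m j > 0} \<in> sets (sig (subtree (2 * m) j))"
  using reach_lim_measurable[OF assms] borel_measurable_iff_greater[of _ "sig (subtree (2 * m) j)"] by auto

lemma reach_lim_pos_events:
  assumes "0 \<le> r" "r \<le> 1" "j < 4 ^ m"
  shows "{w \<in> space M. reach_lim r (sample w) m j > 0} \<in> events"
  by (rule sig_events[OF subtree_nodes reach_lim_pos_measurable[OF assms]])

lemma prob_survival:
  assumes "j < 4 ^ m"
  shows "prob {w \<in> space M. reach_lim 1 (sample w) m j > 0} = q"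
proof -
  have "expectation (\<lambda>w. reach_lim 1 (sample w) m j) = q"
    using reach_lim_expectation(1)[of 1, OF _ _ assms] mean_reach_1_limit LIMSEQ_unique by fastforce
  moreover have "expectation (\<lambda>w. reach_lim 1 (sample w) m j)
      = expectation (indicator {w \<in> space M. reach_lim 1 (sample w) m j > 0})"
  proof (rule Bochner_Integration.integral_cong[OF refl])
    fix w assume "w \<in> space M"
    then show "reach_lim 1 (sample w) m j = indicator {w \<in> space M. reach_lim 1 (sample w) m j > 0} w"
      using reach_lim_1_cases[of "sample w" m j] by (auto simp: indicator_def)
  qed
  moreover have "{w \<in> space M. reach_lim 1 (sample w) m j > 0} \<in> events"
    using reach_lim_pos_events[of 1, OF _ _ assms] by simp
  ultimately show ?thesis by simp
qed

lemma prob_reach_lim_pos_rec: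
  assumes r: "0 < r" "r \<le> 1" and j: "j < 4 ^ m"
  shows "prob {w \<in> space M. reach_lim r (sample w) m j > 0} = p * (1 -
     (1 - p * prob {w \<in> space M. reach_lim r (sample w) (Suc m) (4 * j + 1) > 0}) *
     (1 - p * prob {w \<in> space M. reach_lim r (sample w) (Suc m) (4 * j + 2) > 0}))"
proof -
  let ?A = "\<lambda>m j. {w \<in> space M. reach_lim r (sample w) m j > 0}"
  have r0: "0 \<le> r" using r by simp
  have A: "?A m j \<in> sets (sig (subtree (2 * m) j))" "?A m j \<in> events" if "j < 4 ^ m" for m j
    by (rule reach_lim_pos_measurable[OF r0 r(2) that], rule reach_lim_pos_events[OF r0 r(2) that])
  note n = block_nodes[OF j]
  have "expectation (indicator (?A m j) :: 'a \<Rightarrow> real) = expectation (\<lambda>w. up (2 * m) j w *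
      (1 - (1 - 1 * (up (2 * m + 1) (2 * j) w * indicator (?A (Suc m) (4 * j + 1)) w))
       * (1 - 1 * (up (2 * m + 1) (2 * j + 1) w * indicator (?A (Suc m) (4 * j + 2)) w))))"
    by (rule Bochner_Integration.integral_cong)
      (auto simp: indicator_def up_def reach_lim_pos_rec[OF r, of _ m j] kids_def sample_def)
  also have "\<dots> = p * (1 - (1 - 1 * (p * expectation (indicator (?A (Suc m) (4 * j + 1))))) *
        (1 - 1 * (p * expectation (indicator (?A (Suc m) (4 * j + 2))))))"
    by (intro block_prod[OF j] borel_measurable_indicator integrable_indicator_events A n)
  finally show ?thesis using A n j by simp
qed

text \<open>Let \<open>l\<close> be the infimum, over all intervals, of the probability that \<open>reach_lim r\<close> is positive. By
\<open>prob_reach_lim_pos_rec\<close> and monotonicity, \<open>l\<close> is at least its own image under one branching step, so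
\<open>l = 0\<close> or \<open>l \<ge> q\<close>. Since \<open>2p\<^sup>2 r > 1\<close>, the thinned process is supercritical and the expectations of \<open>reach r\<close> stay
above a positive fixed point \<open>c\<close>, so \<open>l > 0\<close>. Positivity of \<open>reach_lim r\<close> thus has probability at least \<open>q\<close>,
and it is part of the survival event, which has probability \<open>q\<close>. The infimum is used
because the recursion relates the probabilities at different intervals.\<close>

lemma reach_lim_pos_AE:
  assumes r: "0 < r" "r \<le> 1" "1 < 2 * p\<^sup>2 * r" and j: "j < 4 ^ m"
  shows "AE w in M. reach_lim 1 (sample w) m j > 0 \<longrightarrow> reach_lim r (sample w) m j > 0"
proof -
  let ?A = "\<lambda>m j. {w \<in> space M. reach_lim r (sample w) m j > 0}"
  have r0: "0 \<le> r" using r by simp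
  have A: "?A m j \<in> events" if "j < 4 ^ m" for m j
    by (rule reach_lim_pos_events[OF r0 r(2) that])
  \<comment> \<open>The positive fixed point of \<open>c \<mapsto> p (1 - (1 - r p c)\<^sup>2)\<close>.\<close>
  define c where "c = (2 * p\<^sup>2 * r - 1) / (p ^ 3 * r\<^sup>2)"
  have c0: "0 < c" unfolding c_def using r p_pos by simp
  \<comment> \<open>The right-hand side is \<open>p^3 r\<^sup>2 - 2p\<^sup>2 r + 1\<close>, so this says \<open>c \<le> 1\<close>.\<close>
  have "0 \<le> p * (p * r - 1)\<^sup>2 + (1 - p)" using p_pos p_less by simp
  then have "2 * p\<^sup>2 * r - 1 \<le> p ^ 3 * r\<^sup>2"
    by (simp add: algebra_simps power2_eq_square power3_eq_cube)
  then have c1: "c \<le> 1" unfolding c_def using p_pos r by (simp add: pos_divide_le_eq)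
  have "p ^ 3 * r\<^sup>2 * c = 2 * p\<^sup>2 * r - 1" unfolding c_def using p_pos r by simp
  then have "c * (2 * p\<^sup>2 * r - p ^ 3 * r\<^sup>2 * c) = c" by simp
  then have cf: "p * (1 - (1 - r * (p * c))\<^sup>2) = c"
    by (simp add: algebra_simps power2_eq_square power3_eq_cube)
  have low: "c \<le> prob (?A m j)" if "j < 4 ^ m" for m j
  proof -
    have "c \<le> expectation (\<lambda>w. reach_lim r (sample w) m j)"
      using mean_reach_ge[OF r(1,2) _ c1] c0 cf
      by (intro LIMSEQ_le_const[OF reach_lim_expectation(1)[OF r0 r(2) that]]) auto
    also have "\<dots> \<le> expectation (indicator (?A m j))"
      by (rule integral_mono)
        (use reach_lim_expectation(2)[OF r0 r(2) that] reach_lim_bounds[OF r0 r(2)]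
          integrable_indicator_events[OF A[OF that]] in \<open>auto simp: indicator_def not_less intro: antisym\<close>)
    finally show ?thesis using A[OF that] by simp
  qed
  define l where "l = Inf {prob (?A m j) | m j. j < 4 ^ m}"
  have ne: "{prob (?A m j) | m j. j < 4 ^ m} \<noteq> {}" by (auto intro!: exI[of _ 0])
  have bd: "bdd_below {prob (?A m j) | m j. j < 4 ^ m}" by (rule bdd_belowI[of _ 0]) auto
  have le: "l \<le> prob (?A m j)" if "j < 4 ^ m" for m j
    unfolding l_def by (rule cInf_lower[OF _ bd]) (use that in auto)
  have lc: "c \<le> l" unfolding l_def by (rule cInf_greatest[OF ne]) (use low in auto)
  have "p * (1 - (1 - p * l)\<^sup>2) \<le> prob (?A m j)" if j: "j < 4 ^ m" for m j
    unfolding prob_reach_lim_pos_rec[OF r(1,2) j] power2_eq_square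
    using le[OF block_nodes(4)[OF j]] le[OF block_nodes(5)[OF j]] lc c0
    by (intro offspring_mono) auto
  then have "p * (1 - (1 - p * l)\<^sup>2) \<le> l"
    by (subst (2) l_def) (rule cInf_greatest[OF ne], auto)
  then have "q \<le> l" using fixpoint_cases[of l] lc c0 by auto
  then have "q \<le> prob (?A m j)" using le[OF j] by simp
  let ?S = "{w \<in> space M. reach_lim 1 (sample w) m j > 0}"
  have S: "?S \<in> events" using reach_lim_pos_events[of 1, OF _ _ j] by simp
  have sub: "?A m j \<subseteq> ?S" using reach_lim_mono[OF r0 r(2), of _ m j] by (auto intro: less_le_trans)
  have "prob (?S - ?A m j) = prob ?S - prob (?A m j)"
    by (rule finite_measure_Diff[OF S A[OF j] sub])
  then have "prob (?S - ?A m j) = 0"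
    using \<open>q \<le> prob (?A m j)\<close> prob_survival[OF j] measure_nonneg[of M "?S - ?A m j"] by linarith
  then have "AE w in M. w \<notin> ?S - ?A m j"
    using S A[OF j] by (simp add: prob_eq_0)
  then show ?thesis by (rule AE_mp) (auto intro!: AE_I2)
qed


section \<open>Measurability of the crest\<close>

lemma sample_measurable:
  assumes "(n, j) \<in> K" "K \<subseteq> nodes"
  shows "(\<lambda>w. sample w n j) \<in> borel_measurable (sig K)"
proof -
  have "(\<lambda>w. 2 * up n j w - 1) \<in> borel_measurable (sig K)"
    using up_measurable[OF assms(1)] by simp
  moreover have "2 * up n j w - 1 = sample w n j" if "w \<in> space M" for w
    using signsD[OF signs_sample[OF that], of j n] assms by (auto simp: nodes_def up_def sample_def)
  ultimately show ?thesis by (subst measurable_cong[where g = "\<lambda>w. 2 * up n j w - 1"]) auto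
qed

lemma grid_measurable:
  assumes "j \<le> 4 ^ m"
  shows "(\<lambda>w. grid (sample w) m j) \<in> borel_measurable (sig (before (2 * m)))"
proof (cases "j = 4 ^ m")
  case True
  then show ?thesis by (simp add: grid_last)
next
  case False
  then have "j < 4 ^ m" using assms by simp
  then have "real j < real (4 ^ m)" by (simp only: of_nat_less_iff)
  then have lt: "real j / 4 ^ m < 1" by simp
  have "(\<lambda>w. layer (sample w) i (real j / 4 ^ m)) \<in> borel_measurable (sig (before (2 * m)))"
    if "i < 2 * m" for i
  proof -
    have "2 ^ i * (real j / 4 ^ m) < 2 ^ i * 1" by (intro mult_strict_left_mono lt) simp
    then have "nat \<lfloor>2 ^ i * (real j / 4 ^ m)\<rfloor> < 2 ^ i"
      by (simp add: nat_less_iff floor_less_iff)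
    then have "(i, nat \<lfloor>2 ^ i * (real j / 4 ^ m)\<rfloor>) \<in> before (2 * m)"
      using that by (simp add: before_def)
    from sample_measurable[OF this before_nodes] show ?thesis
      unfolding layer_def by (intro borel_measurable_times borel_measurable_divide borel_measurable_const)
  qed
  then show ?thesis unfolding grid_def psum_def
    by (intro borel_measurable_times borel_measurable_divide borel_measurable_const borel_measurable_sum) auto
qed

lemma peak_measurable: "(\<lambda>w. peak (sample w) m) \<in> borel_measurable (sig (before (2 * m)))"
  unfolding peak_def by (intro borel_measurable_Max grid_measurable) auto

lemma crest_measurable: "{w \<in> space M. j \<in> crest (sample w) m} \<in> sets (sig (before (2 * m)))"
proof (cases "j < 4 ^ m")
  case True
  then have [measurable]: "(\<lambda>w. grid (sample w) m j) \<in> borel_measurable (sig (before (2 * m)))"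
    "(\<lambda>w. grid (sample w) m (Suc j)) \<in> borel_measurable (sig (before (2 * m)))"
    "(\<lambda>w. peak (sample w) m) \<in> borel_measurable (sig (before (2 * m)))"
    using grid_measurable peak_measurable by auto
  have "{w \<in> space (sig (before (2 * m))). grid (sample w) m j = peak (sample w) m \<and>
      grid (sample w) m (Suc j) = peak (sample w) m} \<in> sets (sig (before (2 * m)))"
    by measurable
  then show ?thesis using True by (simp add: crest_def)
next
  case False
  then have "{w \<in> space M. j \<in> crest (sample w) m} = {}" by (auto simp: crest_def)
  then show ?thesis by (simp only: sets.empty_sets)
qed

lemma sets_sig_mono: "K \<subseteq> L \<Longrightarrow> A \<in> sets (sig K) \<Longrightarrow> A \<in> sets (sig L)"
  using subalgebra_sig_mono[of K L] by (auto simp: subalgebra_def)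

lemma reach_measurable_before:
  assumes "j < 4 ^ m"
  shows "(\<lambda>w. reach r (sample w) n m j) \<in> borel_measurable (sig (before (2 * (m + n))))"
  using assms
proof (induction n arbitrary: m j)
  case 0
  then show ?case by simp
next
  case (Suc n)
  note k = block_nodes[OF Suc.prems]
  have e: "2 * (Suc m + n) = 2 * (m + Suc n)" by simp
  have u: "up (2 * m) j \<in> borel_measurable (sig (before (2 * (m + Suc n))))"
    "up (2 * m + 1) (2 * j) \<in> borel_measurable (sig (before (2 * (m + Suc n))))"
    "up (2 * m + 1) (2 * j + 1) \<in> borel_measurable (sig (before (2 * (m + Suc n))))"
    by (intro up_measurable; use k in \<open>simp add: before_def\<close>)+
  show ?case
    unfolding reach_sample
    by (intro borel_measurable_times borel_measurable_diff borel_measurable_const u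
        Suc.IH[OF k(4), unfolded e] Suc.IH[OF k(5), unfolded e])
qed

section \<open>Almost sure existence of a surviving line\<close>

definition extinct :: "nat \<Rightarrow> nat \<Rightarrow> 'a set" where
  "extinct m n = {w \<in> space M. \<forall>j\<in>crest (sample w) m. reach 1 (sample w) n m j = 0}"

lemma extinct_measurable: "extinct m n \<in> sets (sig (before (2 * (m + n))))"
proof -
  let ?S = "sig (before (2 * (m + n)))"
  have t: "{w \<in> space M. j \<in> crest (sample w) m} \<in> sets ?S" for j
    by (rule sets_sig_mono[OF before_mono crest_measurable]) simp
  have s: "{w \<in> space M. reach 1 (sample w) n m j = 0} \<in> sets ?S" if "j < 4 ^ m" for j
    using borel_measurable_eq[OF reach_measurable_before[OF that, of 1 n], of "\<lambda>_. 0"] by simp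
  have "space ?S \<inter> (\<Inter>j\<in>{..<4 ^ m}. (space ?S - {w \<in> space M. j \<in> crest (sample w) m})
      \<union> {w \<in> space M. reach 1 (sample w) n m j = 0}) \<in> sets ?S"
    by (intro sets.Int sets.top sets.finite_INT sets.Un sets.compl_sets t s) (auto simp: lessThan_empty_iff)
  moreover have "space ?S \<inter> (\<Inter>j\<in>{..<4 ^ m}. (space ?S - {w \<in> space M. j \<in> crest (sample w) m})
      \<union> {w \<in> space M. reach 1 (sample w) n m j = 0}) = extinct m n"
    unfolding extinct_def by (auto simp: crest_def)
  ultimately show ?thesis by simp
qed

text \<open>A line that does not survive has a finite length, so this event is the increasing limit of the events
\<open>extinct m n\<close>, which depend on finitely many layers.\<close>

definition doomed :: "nat \<Rightarrow> 'a set" where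
  "doomed m = {w \<in> space M. \<forall>j\<in>crest (sample w) m. reach_lim 1 (sample w) m j = 0}"

lemma extinct_incseq: "incseq (extinct m)"
proof (rule incseq_SucI)
  fix n
  have "reach 1 \<sigma> (Suc n) m j = 0" if "reach 1 \<sigma> n m j = 0" for \<sigma> j
    using reach_decreasing[of 1 \<sigma> n m j] reach_bounds(1)[of 1 \<sigma> "Suc n" m j] that by linarith
  then show "extinct m n \<subseteq> extinct m (Suc n)"
    unfolding extinct_def by blast
qed

lemma doomed_eq: "doomed m = (\<Union>n. extinct m n)"
proof
  show "(\<Union>n. extinct m n) \<subseteq> doomed m"
  proof
    fix w assume "w \<in> (\<Union>n. extinct m n)"
    then obtain n where n: "w \<in> space M" "\<And>j. j \<in> crest (sample w) m \<Longrightarrow> reach 1 (sample w) n m j = 0"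
      by (auto simp: extinct_def)
    have "reach_lim 1 (sample w) m j = 0" if "j \<in> crest (sample w) m" for j
      using reach_lim_bounds(1)[of 1 "sample w" m j] reach_lim_bounds(3)[of 1 "sample w" m j n] n(2)[OF that] by simp
    then show "w \<in> doomed m" using n(1) by (simp add: doomed_def)
  qed
  show "doomed m \<subseteq> (\<Union>n. extinct m n)"
  proof
    fix w assume w: "w \<in> doomed m"
    have fin: "finite (crest (sample w) m)"
      by (rule finite_subset[of _ "{..<4 ^ m}"]) (auto simp: crest_def)
    have "\<exists>n. reach 1 (sample w) n m j = 0" if "j \<in> crest (sample w) m" for j
      using w that reach_lim_1_cases[of "sample w" m j] by (auto simp: doomed_def)
    then obtain h where h: "\<And>j. j \<in> crest (sample w) m \<Longrightarrow> reach 1 (sample w) (h j) m j = 0" by metis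
    define n where "n = Max (insert 0 (h ` crest (sample w) m))"
    have "reach 1 (sample w) n m j = 0" if "j \<in> crest (sample w) m" for j
    proof -
      have "h j \<le> n" unfolding n_def using fin that by (intro Max_ge) auto
      then have "reach 1 (sample w) n m j \<le> reach 1 (sample w) (h j) m j"
        using reach_decseq[of 1 "sample w" m j] by (simp add: decseq_def)
      then show ?thesis using h[OF that] reach_bounds(1)[of 1 "sample w" n m j] by simp
    qed
    then show "w \<in> (\<Union>n. extinct m n)" using w by (auto simp: extinct_def doomed_def)
  qed
qed

lemma extinct_events: "extinct m n \<in> events"
  by (rule sig_events[OF before_nodes extinct_measurable])

lemma doomed_events: "doomed m \<in> events"
  unfolding doomed_eq using extinct_events by (intro sets.countable_UN) auto

lemma doomed_decseq: "decseq doomed"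
proof (rule decseq_SucI)
  fix m
  show "doomed (Suc m) \<subseteq> doomed m"
  proof
    fix w assume w: "w \<in> doomed (Suc m)"
    then have s: "signs (sample w)" by (intro signs_sample) (simp add: doomed_def)
    have "reach_lim 1 (sample w) m j = 0" if "j \<in> crest (sample w) m" for j
      using gain_if_reach_lim(2)[OF s that] w reach_lim_bounds(1)[of 1 "sample w" m j]
      by (force simp: doomed_def)
    then show "w \<in> doomed m" using w by (simp add: doomed_def)
  qed
qed

text \<open>Wait, after level \<open>N\<close>, for the first nonempty crest and take its leftmost interval. Which interval this is
depends on earlier layers only, so its line survives with probability \<open>q\<close> independently of this choice and
of \<open>C\<close>. Summation over the possible choices gives the bound.\<close>

lemma doomed_forever_le:
  assumes C: "C \<in> sets (sig (before (2 * N)))"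
    and hit: "AE w in M. \<exists>k\<ge>N. crest (sample w) k \<noteq> {}"
  shows "prob ((\<Inter>m. doomed m) \<inter> C) \<le> (1 - q) * prob C"
proof -
  let ?B = "\<Inter>m. doomed m"
  have B: "?B \<in> events" using doomed_events by (intro sets.countable_INT) auto
  have Cs: "C \<in> events" "C \<subseteq> space M"
    using sig_events[OF before_nodes C] sets.sets_into_space by auto
  define first where "first w k j \<longleftrightarrow> N \<le> k \<and> j \<in> crest (sample w) k \<and> (\<forall>i<j. i \<notin> crest (sample w) k) \<and>
      (\<forall>l\<in>{N..<k}. \<forall>i<4 ^ l. i \<notin> crest (sample w) l)" for w k j
  have first_unique: "k = k' \<and> j = j'" if "first w k j" "first w k' j'" for w k j k' j'
  proof -
    have "k = k'"
    proof (rule ccontr)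
      assume "k \<noteq> k'"
      then consider "k < k'" | "k' < k" by linarith
      then show False using that unfolding first_def by cases (auto simp: crest_def)
    qed
    then show ?thesis using that unfolding first_def by (metis linorder_neqE_nat)
  qed
  have first_exists: "\<exists>k j. first w k j" if "\<exists>k\<ge>N. crest (sample w) k \<noteq> {}" for w
  proof -
    define k where "k = (LEAST k. N \<le> k \<and> crest (sample w) k \<noteq> {})"
    have k: "N \<le> k" "crest (sample w) k \<noteq> {}"
      using LeastI_ex[of "\<lambda>k. N \<le> k \<and> crest (sample w) k \<noteq> {}"] that unfolding k_def by auto
    have l: "crest (sample w) l = {}" if "l \<in> {N..<k}" for l
      using not_less_Least[of l "\<lambda>k. N \<le> k \<and> crest (sample w) k \<noteq> {}"] that unfolding k_def by auto
    define j where "j = (LEAST j. j \<in> crest (sample w) k)"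
    have j: "j \<in> crest (sample w) k" using LeastI_ex[of "\<lambda>j. j \<in> crest (sample w) k"] k(2) unfolding j_def by blast
    have i: "i \<notin> crest (sample w) k" if "i < j" for i
      using not_less_Least[of i "\<lambda>j. j \<in> crest (sample w) k"] that unfolding j_def by blast
    show ?thesis using k(1) j i l unfolding first_def by blast
  qed
  define A where "A n = (case prod_decode n of (k, j) \<Rightarrow> {w \<in> C. first w k j})" for n
  have Am: "{w \<in> C. first w k j} \<in> sets (sig (before (2 * k)))" for k j
  proof (cases "N \<le> k")
    case True
    let ?S = "sig (before (2 * k))"
    have t: "{w \<in> space M. j \<in> crest (sample w) l} \<in> sets ?S" if "l \<le> k" for l j
      by (rule sets_sig_mono[OF before_mono crest_measurable]) (use that in simp)
    have "C \<inter> ({w \<in> space M. j \<in> crest (sample w) k} \<inter>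
      ((space ?S - (\<Union>i\<in>{..<j}. {w \<in> space M. i \<in> crest (sample w) k})) \<inter>
      (space ?S - (\<Union>l\<in>{N..<k}. \<Union>i\<in>{..<4 ^ l}. {w \<in> space M. i \<in> crest (sample w) l})))) \<in> sets ?S"
      by (intro sets.Int sets.compl_sets sets.finite_UN sets_sig_mono[OF before_mono C] t) (use True in auto)
    also have "C \<inter> ({w \<in> space M. j \<in> crest (sample w) k} \<inter>
      ((space ?S - (\<Union>i\<in>{..<j}. {w \<in> space M. i \<in> crest (sample w) k})) \<inter>
      (space ?S - (\<Union>l\<in>{N..<k}. \<Union>i\<in>{..<4 ^ l}. {w \<in> space M. i \<in> crest (sample w) l}))))
      = {w \<in> C. first w k j}"
      using True Cs(2) unfolding first_def by auto
    finally show ?thesis .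
  next
    case False
    then have "{w \<in> C. first w k j} = {}" by (auto simp: first_def)
    then show ?thesis by (simp only: sets.empty_sets)
  qed
  have Ae: "A n \<in> events" for n
    unfolding A_def using sig_events[OF before_nodes Am] by (auto split: prod.splits)
  have disj: "disjoint_family A"
    unfolding disjoint_family_on_def
  proof (intro ballI impI equals0I)
    fix n n' w assume nn: "n \<noteq> n'" and w: "w \<in> A n \<inter> A n'"
    obtain k j k' j' where d: "prod_decode n = (k, j)" "prod_decode n' = (k', j')"
      by (metis surj_pair)
    then have "first w k j" "first w k' j'" using w by (auto simp: A_def)
    then have "prod_decode n = prod_decode n'" using first_unique d by auto
    then show False using nn by (simp add: prod_decode_eq)
  qed
  have AE_A: "AE w in M. w \<in> C \<longrightarrow> w \<in> (\<Union>n. A n)"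
  proof (rule AE_mp[OF hit], intro AE_I2 impI)
    fix w assume "\<exists>k\<ge>N. crest (sample w) k \<noteq> {}" "w \<in> C"
    then obtain k j where "first w k j" using first_exists by blast
    then have "w \<in> A (prod_encode (k, j))" using \<open>w \<in> C\<close> by (simp add: A_def)
    then show "w \<in> (\<Union>n. A n)" by blast
  qed
  have sub: "A n \<subseteq> C" for n by (auto simp: A_def split: prod.splits)
  have "(\<lambda>n. prob (A n)) sums prob (\<Union>n. A n)"
    using Ae disj by (intro finite_measure_UNION) auto
  moreover have "prob (\<Union>n. A n) = prob C"
  proof (rule measure_eq_AE)
    show "AE w in M. (w \<in> (\<Union>n. A n)) = (w \<in> C)"
      using AE_A by (rule AE_mp) (use sub in \<open>auto intro!: AE_I2\<close>)
  qed (use Ae Cs in auto)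
  ultimately have s1: "(\<lambda>n. (1 - q) * prob (A n)) sums ((1 - q) * prob C)"
    by (auto intro: sums_mult)
  have "(\<lambda>n. prob (?B \<inter> A n)) sums prob (\<Union>n. ?B \<inter> A n)"
    using Ae B disj by (intro finite_measure_UNION) (auto simp: disjoint_family_on_def)
  moreover have "prob (\<Union>n. ?B \<inter> A n) = prob (?B \<inter> C)"
  proof (rule measure_eq_AE)
    show "AE w in M. (w \<in> (\<Union>n. ?B \<inter> A n)) = (w \<in> ?B \<inter> C)"
      using AE_A by (rule AE_mp) (use sub in \<open>auto intro!: AE_I2\<close>)
  qed (use Ae Cs B in auto)
  ultimately have s2: "(\<lambda>n. prob (?B \<inter> A n)) sums prob (?B \<inter> C)" by simp
  have "prob (?B \<inter> A n) \<le> (1 - q) * prob (A n)" for n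
  proof -
    obtain k j where n: "prod_decode n = (k, j)" by (cases "prod_decode n")
    show ?thesis
    proof (cases "j < 4 ^ k")
      case True
      let ?D = "{w \<in> space M. reach_lim 1 (sample w) k j > 0}"
      have D: "space M - ?D \<in> sets (sig (subtree (2 * k) j))"
        using sets.compl_sets[OF reach_lim_pos_measurable[of 1, OF _ _ True]] by simp
      have "prob (?B \<inter> A n) \<le> prob (A n \<inter> (space M - ?D))"
      proof (rule finite_measure_mono)
        show "?B \<inter> A n \<subseteq> A n \<inter> (space M - ?D)"
          using Cs(2) by (force simp: A_def n first_def doomed_def)
        show "A n \<inter> (space M - ?D) \<in> events"
          by (intro sets.Int Ae sig_events[OF subtree_nodes D])
      qed
      also have "\<dots> = prob (A n) * prob (space M - ?D)"
        by (rule prob_Int_sig[OF before_nodes subtree_nodes before_subtree_disjoint _ D])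
          (use Am in \<open>simp add: A_def n\<close>)
      also have "prob (space M - ?D) = 1 - q"
        using prob_compl[OF reach_lim_pos_events[of 1, OF _ _ True]] prob_survival[OF True] by simp
      finally show ?thesis by (simp add: mult.commute)
    next
      case False
      then have "A n = {}" by (auto simp: A_def n first_def crest_def)
      then show ?thesis by simp
    qed
  qed
  then show ?thesis by (rule sums_le[OF _ s2 s1])
qed

text \<open>Apply the previous bound with \<open>C\<close> the approximating events of \<open>doomed m\<close> and then let \<open>m\<close> tend to
infinity: the event \<open>B\<close> that all crest intervals are doomed satisfies \<open>P(B) \<le> (1 - q) P(B)\<close>.\<close>

lemma survivor_AE:
  assumes "0 < q" and hit: "\<And>N. AE w in M. \<exists>k\<ge>N. crest (sample w) k \<noteq> {}"
  shows "AE w in M. \<exists>m. \<exists>j\<in>crest (sample w) m. reach_lim 1 (sample w) m j > 0"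
proof -
  let ?B = "\<Inter>m. doomed m"
  have B: "?B \<in> events" using doomed_events by (intro sets.countable_INT) auto
  have le: "prob ?B \<le> (1 - q) * prob (doomed m)" for m
  proof (rule LIMSEQ_le)
    show "(\<lambda>n. (1 - q) * prob (extinct m n)) \<longlonglongrightarrow> (1 - q) * prob (doomed m)"
      unfolding doomed_eq
      by (intro tendsto_intros finite_Lim_measure_incseq extinct_incseq) (use extinct_events in auto)
    have "incseq (\<lambda>n. ?B \<inter> extinct m n)"
      by (intro incseq_SucI Int_mono order_refl incseq_SucD[OF extinct_incseq])
    then have "(\<lambda>n. prob (?B \<inter> extinct m n)) \<longlonglongrightarrow> prob (\<Union>n. ?B \<inter> extinct m n)"
      by (rule finite_Lim_measure_incseq[rotated]) (use extinct_events B in auto)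
    moreover have "(\<Union>n. ?B \<inter> extinct m n) = ?B"
      using doomed_eq[of m] by auto
    ultimately show "(\<lambda>n. prob (?B \<inter> extinct m n)) \<longlonglongrightarrow> prob ?B" by simp
    show "\<exists>N. \<forall>n\<ge>N. prob (?B \<inter> extinct m n) \<le> (1 - q) * prob (extinct m n)"
      using doomed_forever_le[OF extinct_measurable hit] by blast
  qed
  have "prob ?B \<le> (1 - q) * prob ?B"
  proof (rule LIMSEQ_le_const)
    show "(\<lambda>m. (1 - q) * prob (doomed m)) \<longlonglongrightarrow> (1 - q) * prob ?B"
      by (intro tendsto_intros finite_Lim_measure_decseq doomed_decseq) (use doomed_events in auto)
  qed (use le in blast)
  then have "q * prob ?B \<le> 0" by (simp add: algebra_simps)
  then have "prob ?B = 0" using assms(1) by (simp add: mult_le_0_iff measure_le_0_iff)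
  then have "AE w in M. w \<notin> ?B" using B by (simp add: prob_eq_0)
  then show ?thesis
  proof (rule AE_mp, intro AE_I2 impI)
    fix w assume "w \<in> space M" "w \<notin> ?B"
    then obtain m j where "j \<in> crest (sample w) m" "reach_lim 1 (sample w) m j \<noteq> 0"
      by (auto simp: doomed_def)
    then show "\<exists>m. \<exists>j\<in>crest (sample w) m. reach_lim 1 (sample w) m j > 0"
      using reach_lim_bounds(1)[of 1 "sample w" m j] by force
  qed
qed

section \<open>Recurrence of the crest\<close>

definition edge_sum :: "nat \<Rightarrow> nat \<Rightarrow> nat \<Rightarrow> 'a \<Rightarrow> real" where
  "edge_sum m j n w = (\<Sum>i<n. sample w (2 * (m + i)) (j * 4 ^ i) + sample w (2 * (m + i) + 1) (2 * (j * 4 ^ i)))"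

text \<open>This is \<open>2 powr - edge_sum\<close>, written as a product of independent factors: \<open>2 - 3/2 = 1/2\<close> for the sign
\<open>1\<close>, and \<open>2\<close> for the sign \<open>-1\<close>.\<close>

definition edge_weight :: "nat \<Rightarrow> nat \<Rightarrow> nat \<Rightarrow> 'a \<Rightarrow> real" where
  "edge_weight m j n w = (\<Prod>i<n. (2 - 3 / 2 * up (2 * (m + i)) (j * 4 ^ i) w) *
      (2 - 3 / 2 * up (2 * (m + i) + 1) (2 * (j * 4 ^ i)) w))"

lemma edge_weight_eq:
  assumes "j < 4 ^ m" "w \<in> space M"
  shows "edge_weight m j n w = 2 powr (- edge_sum m j n w)"
proof (induction n)
  case 0
  then show ?case by (simp add: edge_weight_def edge_sum_def)
next
  case (Suc n)
  have k: "j * 4 ^ n < 4 ^ (m + n)" using assms(1) by (simp add: power_add)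
  have f: "2 - 3 / 2 * up a b w = 2 powr (- sample w a b)" if ba: "b < 2 ^ a" for a b
  proof -
    consider "\<omega> a b w = - 1" | "\<omega> a b w = 1"
      using signsD[OF signs_sample[OF assms(2)] ba] unfolding sample_def by blast
    then show ?thesis by cases (simp_all add: up_def sample_def powr_minus)
  qed
  have "edge_weight m j (Suc n) w = edge_weight m j n w *
    ((2 - 3 / 2 * up (2 * (m + n)) (j * 4 ^ n) w) * (2 - 3 / 2 * up (2 * (m + n) + 1) (2 * (j * 4 ^ n)) w))"
    by (simp add: edge_weight_def)
  also have "\<dots> = 2 powr (- edge_sum m j n w) *
     (2 powr (- sample w (2 * (m + n)) (j * 4 ^ n)) * 2 powr (- sample w (2 * (m + n) + 1) (2 * (j * 4 ^ n))))"
    unfolding Suc.IH f[OF block_nodes(1)[OF k]] f[OF block_nodes(2)[OF k]] ..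
  also have "\<dots> = 2 powr (- edge_sum m j (Suc n) w)"
    by (simp add: edge_sum_def flip: powr_add)
  finally show ?case .
qed

lemma edge_weight_expectation:
  assumes "j < 4 ^ m"
  shows "edge_weight m j n \<in> borel_measurable (sig (before (2 * (m + n))))"
    and "integrable M (edge_weight m j n)"
    and "expectation (edge_weight m j n) = (2 - 3 / 2 * p) ^ (2 * n)"
proof -
  have "edge_weight m j n \<in> borel_measurable (sig (before (2 * (m + n)))) \<and>
    integrable M (edge_weight m j n) \<and> expectation (edge_weight m j n) = (2 - 3 / 2 * p) ^ (2 * n)"
  proof (induction n)
    case 0
    then show ?case by (simp add: edge_weight_def[abs_def] prob_space)
  next
    case (Suc n)
    define g where "g a b w = 2 - 3 / 2 * up a b w" for a b w
    have k: "j * 4 ^ n < 4 ^ (m + n)" using assms(1) by (simp add: power_add)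
    have gm: "g a b \<in> borel_measurable (sig K)" if "(a, b) \<in> K" for a b K
      unfolding g_def using up_measurable[OF that] by (intro borel_measurable_diff borel_measurable_times borel_measurable_const)
    have gi: "integrable M (g a b)" "expectation (g a b) = 2 - 3 / 2 * p" if "b < 2 ^ a" for a b
      unfolding g_def using up_integrable[OF that] expectation_up[OF that] by (auto simp: prob_space)
    let ?a = "2 * (m + n)" and ?b = "j * 4 ^ n"
    note kb = block_nodes(1,2)[OF k]
    have step: "edge_weight m j (Suc n) = (\<lambda>w. edge_weight m j n w * g ?a ?b w * g (?a + 1) (2 * ?b) w)"
      by (rule ext) (simp add: edge_weight_def g_def)
    have s: "{(x, y)} \<subseteq> nodes" if "y < 2 ^ x" for x y using that by (simp add: nodes_def)
    note IH = Suc.IH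
    note e1 = expectation_mult_sig[OF before_nodes s[OF kb(1)] _ IH[THEN conjunct1]
        IH[THEN conjunct2, THEN conjunct1] gm gi(1)[OF kb(1)]]
    have d1: "before ?a \<inter> {(?a, ?b)} = {}" "before (?a + 1) \<inter> {(?a + 1, 2 * ?b)} = {}"
      by (auto simp: before_def)
    have m1: "(\<lambda>w. edge_weight m j n w * g ?a ?b w) \<in> borel_measurable (sig (before (?a + 1)))"
      by (intro borel_measurable_times sig_mono[OF before_mono IH[THEN conjunct1]] gm)
        (use kb in \<open>auto simp: before_def\<close>)
    note e1 = e1[OF d1(1) singletonI]
    note e2 = expectation_mult_sig[OF before_nodes s[OF kb(2)] d1(2) m1 e1(2) gm[OF singletonI] gi(1)[OF kb(2)]]
    have m2: "edge_weight m j (Suc n) \<in> borel_measurable (sig (before (2 * (m + Suc n))))"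
      unfolding step
      by (intro borel_measurable_times sig_mono[OF before_mono m1] gm) (use kb in \<open>auto simp: before_def\<close>)
    have "expectation (edge_weight m j (Suc n)) = (2 - 3 / 2 * p) ^ (2 * Suc n)"
      unfolding step e2(1) e1(1) gi(2)[OF kb(1)] gi(2)[OF kb(2)]
      using IH by (simp add: power2_eq_square)
    then show ?case using m2 e2(2) unfolding step by blast
  qed
  then show "edge_weight m j n \<in> borel_measurable (sig (before (2 * (m + n))))"
    "integrable M (edge_weight m j n)"
    "expectation (edge_weight m j n) = (2 - 3 / 2 * p) ^ (2 * n)" by auto
qed

text \<open>Exponential Markov inequality with base \<open>2\<close>: each factor has mean \<open>2 - 3p/2\<close>, which is below
\<open>1\<close> precisely if \<open>p > 2/3\<close>.\<close>

lemma edge_sum_unbounded: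
  assumes "2 / 3 < p" and j: "j < 4 ^ m"
  shows "AE w in M. \<exists>n. edge_sum m j n w > real c"
proof -
  let ?E = "\<lambda>n. {w \<in> space M. edge_weight m j n w \<ge> 1 / 2 ^ c}"
  have m: "edge_weight m j n \<in> borel_measurable M" for n
    by (rule sig_M[OF before_nodes edge_weight_expectation(1)[OF j]])
  have E: "?E n \<in> events" for n using m[of n] by measurable
  have "prob (?E n) \<le> 2 ^ c * ((2 - 3 / 2 * p)\<^sup>2) ^ n" for n
  proof -
    have nn: "0 \<le> edge_weight m j n w" if "w \<in> space M" for w
      using edge_weight_eq[OF j that, of n] by simp
    have "prob (?E n) = expectation (indicator (?E n))" using E by simp
    also have "\<dots> \<le> expectation (\<lambda>w. 2 ^ c * edge_weight m j n w)"
      by (rule integral_mono)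
        (use integrable_indicator_events[OF E] edge_weight_expectation(2)[OF j] nn
          in \<open>auto simp: indicator_def field_simps\<close>)
    also have "\<dots> = 2 ^ c * ((2 - 3 / 2 * p)\<^sup>2) ^ n"
      using edge_weight_expectation(3)[OF j] by (simp add: power_mult)
    finally show ?thesis .
  qed
  moreover have "prob (\<Inter>n. ?E n) \<le> prob (?E n)" for n
    using E by (intro finite_measure_mono) auto
  ultimately have le: "prob (\<Inter>n. ?E n) \<le> 2 ^ c * ((2 - 3 / 2 * p)\<^sup>2) ^ n" for n
    by (meson order_trans)
  have "\<bar>2 - 3 / 2 * p\<bar> < 1" using assms(1) p_less by linarith
  then have "(2 - 3 / 2 * p)\<^sup>2 < 1" by (simp add: abs_square_less_1)
  then have "(\<lambda>n. 2 ^ c * ((2 - 3 / 2 * p)\<^sup>2) ^ n) \<longlonglongrightarrow> 2 ^ c * 0"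
    by (intro tendsto_intros LIMSEQ_realpow_zero) auto
  then have "prob (\<Inter>n. ?E n) \<le> 2 ^ c * 0"
    by (rule LIMSEQ_le_const) (use le in blast)
  then have "prob (\<Inter>n. ?E n) = 0" by (simp add: measure_le_0_iff)
  moreover have "(\<Inter>n. ?E n) \<in> events" using E by (intro sets.countable_INT) auto
  ultimately have "AE w in M. w \<notin> (\<Inter>n. ?E n)" by (simp add: prob_eq_0)
  then show ?thesis
  proof (rule AE_mp, intro AE_I2 impI)
    fix w assume w: "w \<in> space M" "w \<notin> (\<Inter>n. ?E n)"
    then obtain n where "\<not> edge_weight m j n w \<ge> 1 / 2 ^ c" by auto
    then have "2 powr (- edge_sum m j n w) < 2 powr (- real c)"
      using edge_weight_eq[OF j w(1), of n] by (simp add: powr_minus powr_realpow divide_inverse)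
    then show "\<exists>n. edge_sum m j n w > real c" by (intro exI[of _ n]) simp
  qed
qed

lemma crest_recurs:
  assumes "2 / 3 < p"
  shows "AE w in M. \<exists>k\<ge>m. crest (sample w) k \<noteq> {}"
proof -
  have "AE w in M. \<forall>j\<in>{..<4 ^ m}. \<forall>c. \<exists>n. edge_sum m j n w > real c"
    using edge_sum_unbounded[OF assms] by (simp add: AE_ball_countable AE_all_countable)
  then show ?thesis
  proof (rule AE_mp, intro AE_I2 impI)
    fix w assume w: "w \<in> space M" "\<forall>j\<in>{..<4 ^ m}. \<forall>c. \<exists>n. edge_sum m j n w > real c"
    show "\<exists>k\<ge>m. crest (sample w) k \<noteq> {}"
    proof (rule ccontr)
      assume "\<not> ?thesis"
      then have "\<And>k. m \<le> k \<Longrightarrow> crest (sample w) k = {}" by blast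
      then obtain j c where "j < 4 ^ m" "\<And>n. edge_sum m j n w \<le> real c"
        using edge_walk_bounded[OF signs_sample[OF w(1)], of m] unfolding edge_sum_def by blast
      then show False using w(2) by (meson lessThan_iff not_le)
    qed
  qed
qed

section \<open>Expected generation sizes\<close>

lemma offspring_sample:
  "offspring (sample w) (Suc n) m j = up (2 * m) j w *
     (up (2 * m + 1) (2 * j) w * offspring (sample w) n (Suc m) (4 * j + 1) +
      up (2 * m + 1) (2 * j + 1) w * offspring (sample w) n (Suc m) (4 * j + 2))"
  by (simp add: up_def sample_def)

lemma offspring_expectation:
  assumes "j < 4 ^ m"
  shows "(\<lambda>w. offspring (sample w) n m j) \<in> borel_measurable (sig (subtree (2 * m) j))
    \<and> integrable M (\<lambda>w. offspring (sample w) n m j)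
    \<and> expectation (\<lambda>w. offspring (sample w) n m j) = (2 * p\<^sup>2) ^ n"
  using assms
proof (induction n arbitrary: m j)
  case 0
  then show ?case by (simp add: prob_space)
next
  case (Suc n)
  note k = block_nodes(4,5)[OF Suc.prems]
  note a = Suc.IH[OF k(1)] and b = Suc.IH[OF k(2)]
  note B = block_sum[OF Suc.prems a[THEN conjunct1] a[THEN conjunct2, THEN conjunct1]
      b[THEN conjunct1] b[THEN conjunct2, THEN conjunct1]]
  have e: "p * (p * (2 * p\<^sup>2) ^ n + p * (2 * p\<^sup>2) ^ n) = (2 * p\<^sup>2) ^ Suc n"
    by (simp add: power2_eq_square algebra_simps)
  show ?case
    unfolding offspring_sample
    using B(2,3) B(1)[unfolded a[THEN conjunct2, THEN conjunct2] b[THEN conjunct2, THEN conjunct2] e]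
    by blast
qed

text \<open>The expectations \<open>(2p\<^sup>2 r)^n\<close> are summable, hence so are the random variables almost surely.\<close>

lemma offspring_small:
  assumes "j < 4 ^ m" "0 \<le> r" "2 * p\<^sup>2 * r < 1"
  shows "AE w in M. (\<lambda>n. offspring (sample w) n m j * r ^ n) \<longlonglongrightarrow> 0"
proof -
  let ?f = "\<lambda>n w. offspring (sample w) n m j * r ^ n"
  have nn: "0 \<le> ?f n w" for n w using offspring_nonneg assms(2) by simp
  have i: "integrable M (?f n)" "expectation (?f n) = (2 * p\<^sup>2 * r) ^ n" for n
    using offspring_expectation[OF assms(1), of n] by (auto simp: power_mult_distrib)
  have "(\<integral>\<^sup>+ w. (\<Sum>n. ennreal (?f n w)) \<partial>M) = (\<Sum>n. \<integral>\<^sup>+ w. ennreal (?f n w) \<partial>M)"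
    by (rule nn_integral_suminf) (use borel_measurable_integrable[OF i(1)] in measurable)
  also have "\<dots> = (\<Sum>n. ennreal ((2 * p\<^sup>2 * r) ^ n))"
    using nn_integral_eq_integral[OF i(1)] nn i(2) by simp
  also have "\<dots> \<noteq> top"
    using assms by (subst suminf_ennreal_eq[OF _ summable_sums[OF summable_geometric]]) auto
  finally have "AE w in M. (\<Sum>n. ennreal (?f n w)) \<noteq> \<infinity>"
    by (intro nn_integral_PInf_AE) (use borel_measurable_integrable[OF i(1)] in measurable)
  then show ?thesis
  proof (rule AE_mp, intro AE_I2 impI)
    fix w assume "(\<Sum>n. ennreal (?f n w)) \<noteq> \<infinity>"
    then have "summable (\<lambda>n. ?f n w)" by (intro summable_suminf_not_top nn) auto
    then show "(\<lambda>n. ?f n w) \<longlonglongrightarrow> 0" by (rule summable_LIMSEQ_zero)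
  qed
qed


section \<open>Distribution and dimension of the maximum\<close>

lemma max_value_measurable:
  "(\<lambda>w. max_value (signed_takagi (sample w))) \<in> borel_measurable M"
proof (rule borel_measurable_LIMSEQ_real)
  show "(\<lambda>m. 2 / 4 ^ m * peak (sample w) m) \<longlonglongrightarrow> max_value (signed_takagi (sample w))" if "w \<in> space M" for w
    by (rule peak_tendsto_max_value[OF signs_sample[OF that]])
  show "(\<lambda>w. 2 / 4 ^ m * peak (sample w) m) \<in> borel_measurable M" for m
    by (intro borel_measurable_times borel_measurable_const sig_M[OF before_nodes peak_measurable])
qed

lemma prob_max_value: "prob {w \<in> space M. max_value (signed_takagi (sample w)) = 2 / 3} = q"
proof -
  have "{w \<in> space M. max_value (signed_takagi (sample w)) = 2 / 3}
      = {w \<in> space M. reach_lim 1 (sample w) 0 0 > 0}"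
    using max_value_two_thirds_iff_reach_lim[OF signs_sample] by blast
  then show ?thesis using prob_survival[of 0 0] by simp
qed

context
  assumes super: "1 < 2 * p\<^sup>2"
begin

text \<open>The supercritical range lies within the range of \<open>edge_sum_unbounded\<close>, since \<open>1/2 > 4/9\<close>.\<close>

lemma p_large: "2 / 3 < p"
proof (rule ccontr)
  assume "\<not> ?thesis"
  then have "p\<^sup>2 \<le> (2 / 3)\<^sup>2" using p_pos by (intro power_mono) auto
  then show False using super by (simp add: power2_eq_square)
qed

lemma survivor_exists_AE: "AE w in M. \<exists>m. \<exists>j\<in>crest (sample w) m. reach_lim 1 (sample w) m j > 0"
proof (rule survivor_AE)
  show "0 < q" using super p_pos by (simp add: q_def less_max_iff_disj)
  show "AE w in M. \<exists>k\<ge>N. crest (sample w) k \<noteq> {}" for N by (rule crest_recurs[OF p_large])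
qed

lemma max_value_cofinite_AE: "AE w in M. max_value (signed_takagi (sample w)) \<in> cofinite_quarter_sums"
  using survivor_exists_AE
proof (rule AE_mp, intro AE_I2 impI)
  fix w assume w: "w \<in> space M" "\<exists>m. \<exists>j\<in>crest (sample w) m. reach_lim 1 (sample w) m j > 0"
  then show "max_value (signed_takagi (sample w)) \<in> cofinite_quarter_sums"
    using max_value_cofinite[OF signs_sample[OF w(1)]] gain_forever[OF signs_sample[OF w(1)]] by metis
qed

lemma hausdorff_dim_AE:
  "AE w in M. hausdorff_dim (max_set (signed_takagi (sample w))) = ereal (ln (2 * p\<^sup>2) / ln 4)"
proof -
  define d where "d = ln (2 * p\<^sup>2) / ln 4"
  have d0: "0 < d" unfolding d_def using super by (intro divide_pos_pos ln_gt_zero) auto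
  have "2 * p\<^sup>2 = 4 powr d" using p_pos by (simp add: d_def powr_def)
  then have r: "2 * p\<^sup>2 * 4 powr - s = 4 powr (d - s)" for s by (simp add: powr_add[symmetric])
  have "AE w in M. \<forall>s\<in>{s\<in>\<rat>. 0 < s \<and> s < d}. \<forall>m. \<forall>j\<in>{..<4 ^ m}.
      reach_lim 1 (sample w) m j > 0 \<longrightarrow> reach_lim (4 powr - s) (sample w) m j > 0"
  proof -
    have "countable {s\<in>\<rat>. 0 < s \<and> s < d}"
      by (rule countable_subset[OF _ countable_rat]) auto
    moreover have "AE w in M. reach_lim 1 (sample w) m j > 0 \<longrightarrow> reach_lim (4 powr - s) (sample w) m j > 0"
      if "0 < s" "s < d" "j < 4 ^ m" for s m j
    proof (rule reach_lim_pos_AE[OF _ _ _ that(3)])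
      show "4 powr - s \<le> 1" using powr_less_one[of 4 "- s"] that(1) by simp
      show "1 < 2 * p\<^sup>2 * 4 powr - s" unfolding r using that(2) by simp
    qed simp
    ultimately show ?thesis
      by (subst AE_ball_countable) (auto simp: AE_all_countable AE_ball_countable)
  qed
  moreover have "AE w in M. \<forall>s\<in>{s\<in>\<rat>. d < s}. \<forall>m. \<forall>j\<in>{..<4 ^ m}.
      (\<lambda>n. offspring (sample w) n m j * (4 powr - s) ^ n) \<longlonglongrightarrow> 0"
  proof -
    have "countable {s\<in>\<rat>. d < s}"
      by (rule countable_subset[OF _ countable_rat]) auto
    moreover have "AE w in M. (\<lambda>n. offspring (sample w) n m j * (4 powr - s) ^ n) \<longlonglongrightarrow> 0"
      if "d < s" "j < 4 ^ m" for s m j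
    proof (rule offspring_small[OF that(2)])
      show "2 * p\<^sup>2 * 4 powr - s < 1" unfolding r using that(1) by (simp add: powr_less_one)
    qed simp
    ultimately show ?thesis
      by (subst AE_ball_countable) (auto simp: AE_all_countable AE_ball_countable)
  qed
  ultimately have "AE w in M. hausdorff_dim (max_set (signed_takagi (sample w))) = ereal d"
    using survivor_exists_AE AE_space
  proof eventually_elim
    case (elim w)
    then obtain m where "\<exists>j\<in>crest (sample w) m. reach_lim 1 (sample w) m j > 0" by blast
    then show ?case
      by (rule hausdorff_dim_max_set[OF signs_sample[OF elim(4)] _ d0]) (use elim(1,2) in auto)
  qed
  then show ?thesis by (simp add: d_def)
qed

end

end

theorem theorem1p9:
  fixes M :: "'a measure" and p :: real and \<omega> :: "nat \<Rightarrow> nat \<Rightarrow> 'a \<Rightarrow> real"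
    and f :: "'a \<Rightarrow> real \<Rightarrow> real"
  assumes "0 < p" and "p < 1"
    and "prob_space M"
    and "prob_space.indep_vars M (\<lambda>_. count_space {-1, 1})
           (\<lambda>(n, j). \<omega> n j) {(n, j). j < 2 ^ n}"
    and "\<And>n j. j < 2 ^ n \<Longrightarrow> measure M {w \<in> space M. \<omega> n j w = 1} = p"
    and "\<And>n j. j < 2 ^ n \<Longrightarrow> measure M {w \<in> space M. \<omega> n j w = -1} = 1 - p"
    and "\<And>w x. f w x = signed_takagi (\<lambda>n j. \<omega> n j w) x"
  shows "(\<lambda>w. max_value (f w)) \<in> borel_measurable M
    \<and> measure M {w \<in> space M. max_value (f w) = 2 / 3} = max ((2 * p\<^sup>2 - 1) / p ^ 3) 0
    \<and> (p > 1 / sqrt 2 \<longrightarrow>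
         (AE w in M. hausdorff_dim (max_set (f w)) = ereal (ln (2 * p\<^sup>2) / ln 4))
         \<and> countable cofinite_quarter_sums
         \<and> (AE w in M. max_value (f w) \<in> cofinite_quarter_sums))"
proof -
  interpret prob_space M by fact
  interpret random_signs M p \<omega> by unfold_locales (use assms in auto)
  have f: "f w = signed_takagi (sample w)" for w
    by (rule ext) (simp add: assms(7) sample_def[abs_def])
  have "1 < 2 * p\<^sup>2" if "p > 1 / sqrt 2"
  proof -
    have "(1 / sqrt 2)\<^sup>2 < p\<^sup>2" using that by (intro power_strict_mono) auto
    then show ?thesis by (simp add: power_divide)
  qed
  then show ?thesis
    unfolding f
    using max_value_measurable prob_max_value countable_cofinite_quarter_sums
      hausdorff_dim_AE max_value_cofinite_AE unfolding q_def by blast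
qed

end
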